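(* Let $\phi\colon D\to\mathbb{D}$ be a holomorphic function with Clark measures $\mu_\alpha$, $\alpha\in\mathbb{T}$. The mapping $\alpha\mapsto\mu_\alpha$ is vaguely continuous on $\mathbb{T}$, and $$\int_{\mathbb{T}}\mu_\alpha\,\mathrm{d}\beta_{\mathbb{T}}(\alpha)=\beta.$$ If, in addition, $\phi$ is inner, then $\beta_{\mathbb{T}}$ is a pseudo-image measure of $\beta$ under $\phi_1$, and $(\mu_\alpha)_{\alpha\in\mathbb{T}}$ is a disintegration of $\beta$ relative to $\beta_{\mathbb{T}}$. Finally, if $\phi$ is inner and $\phi(0)=0$, then $(\phi_1)_*(\beta)=\beta_{\mathbb{T}}$.
   Context: Setting. $D\subseteq\mathbb{C}^n$ is a bounded symmetric domain (a bounded connected open set such that for every $z\in D$ there is a holomorphic involution of $D$ having $z$ as an isolated fixed point) which is convex and circular ($\alpha z\in D$ for all $z\in D$ and $\alpha\in\mathbb{T}$). Here $\mathbb{D}$ is the open unit disc in $\mathbb{C}$ and $\mathbb{T}=\partial\mathbb{D}$, with normalized Haar measure $\beta_{\mathbb{T}}$. $\mathrm{b}D$ is the Silov boundary of $D$: the smallest closed subset of $\partial D$ such that $\sup_D|f|=\max_{\mathrm{b}D}|f|$ for every holomorphic $f$ on $D$ extending continuously to the closure $\overline{D}$. $K$ is the compact group of linear automorphisms of $D$; it acts transitively on $\mathrm{b}D$, and it is assumed that $K\subseteq U(n)$ and that $\mathrm{b}D$ is contained in the Euclidean unit sphere. $\beta$ is the unique $K$-invariant probability measure on $\mathrm{b}D$.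 The vague topology is the weak-* topology on measures on $\mathrm{b}D$ in duality with $C(\mathrm{b}D)$; the integral of measures is understood in the sense that $\int_{\mathbb{T}}\int_{\mathrm{b}D}f\,\mathrm{d}\mu_\alpha\,\mathrm{d}\beta_{\mathbb{T}}(\alpha)=\int_{\mathrm{b}D}f\,\mathrm{d}\beta$ for every $f\in C(\mathrm{b}D)$. Kernels. The Hardy space $H^2(D)$ is the space of holomorphic $f$ on $D$ with $\|f\|^2=\sup_{0\le\rho<1}\int_{\mathrm{b}D}|f(\rho\zeta)|^2\,\mathrm{d}\beta(\zeta)<\infty$; $\mathcal{C}$ is its reproducing kernel, which extends to a sesqui-holomorphic function on a neighbourhood of $D\times\overline{D}$. The Poisson–Szegő kernel is $\mathcal{P}(z,\zeta)=|\mathcal{C}(z,\zeta)|^2/\mathcal{C}(z,z)$ for $z\in D$, $\zeta\in\mathrm{b}D$, and $(\mathcal{P}\mu)(z)=\int_{\mathrm{b}D}\mathcal{P}(z,\zeta)\,\mathrm{d}\mu(\zeta)$. Clark measures. For $\alpha\in\mathbb{T}$, $\mu_\alpha$ is the unique positive Radon measure on $\mathrm{b}D$ such that $\mathcal{P}(\mu_\alpha)=\mathrm{Re}\left(\frac{\alpha+\phi}{\alpha-\phi}\right)=\frac{1-|\phi|^2}{|\alpha-\phi|^2}$ on $D$. Boundary values and inner functions. For a function $f$ on $D$, $f_1(\zeta)=\lim_{\rho\to1^-}f(\rho\zeta)$ for those $\zeta\in\mathrm{b}D$ where the limit exists. An inner function on $D$ is a bounded holomorphic function $\phi\colon D\to\mathbb{C}$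 such that $\phi_1(\zeta)\in\mathbb{T}$ for $\beta$-almost every $\zeta\in\mathrm{b}D$. Disintegration. For $X,Y$ locally compact spaces with countable base, complex Radon measures $\mu$ on $X$ and $\nu$ on $Y$, and a $\mu$-measurable ($\mu$-almost everywhere defined) $p\colon X\to Y$: $\nu$ is a pseudo-image measure (resp. weak pseudo-image measure) of $\mu$ under $p$ if a subset $N$ of $Y$ is $\nu$-negligible if and only if (resp. only if) $p^{-1}(N)$ is $\mu$-negligible. When $\nu$ is a weak pseudo-image measure, a disintegration of $\mu$ relative to $\nu$ is a family $(\mu_y)_{y\in Y}$ of complex Radon measures on $X$ such that: for $\nu$-almost every $y$, $\mu_y$ is concentrated on $p^{-1}(y)$; and for every $\mu$-integrable $f$, $f$ is $\mu_y$-integrable for $\nu$-almost every $y$, the map $y\mapsto\int_X f\,\mathrm{d}\mu_y$ is $\nu$-integrable, and $\int_X f\,\mathrm{d}\mu=\int_Y\int_X f\,\mathrm{d}\mu_y\,\mathrm{d}\nu(y)$. Here $X=\mathrm{b}D$, $Y=\mathbb{T}$, $p=\phi_1$, the measure being disintegrated is $\beta$, and $\nu=\beta_{\mathbb{T}}$. *)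

theory Defs
  imports "HOL-Probability.Probability"
begin

text \<open>\<open>\<complex>\<^sup>n\<close> is \<^typ>\<open>complex ^ 'n\<close>; its library norm is the Euclidean one, and complex scalars act
  by \<open>*s\<close>. Holomorphic means Frechet differentiable with complex-linear derivative. These
  definitions are only used on open sets.\<close>

definition cn_holomorphic_on :: "(complex ^ 'n \<Rightarrow> complex) \<Rightarrow> (complex ^ 'n) set \<Rightarrow> bool"
    (infix "cn'_holomorphic'_on" 50) where
  "f cn_holomorphic_on U \<longleftrightarrow>
     (\<forall>z\<in>U. \<exists>L. (f has_derivative L) (at z) \<and> (\<forall>c v. L (c *s v) = c * L v))"

definition cn_holomorphic_map_on ::
    "(complex ^ 'n \<Rightarrow> complex ^ 'm) \<Rightarrow> (complex ^ 'n) set \<Rightarrow> bool"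
    (infix "cn'_holomorphic'_map'_on" 50) where
  "s cn_holomorphic_map_on U \<longleftrightarrow> (\<forall>i. (\<lambda>z. s z $ i) cn_holomorphic_on U)"

text \<open>Sesqui-holomorphic: holomorphic in the first variable and antiholomorphic in the second
  (take \<open>v = 0\<close>, resp. \<open>u = 0\<close>, in the condition on the derivative).\<close>

definition sesqui_holomorphic_on ::
    "(complex ^ 'n \<Rightarrow> complex ^ 'n \<Rightarrow> complex) \<Rightarrow> ((complex ^ 'n) \<times> (complex ^ 'n)) set \<Rightarrow> bool"
    (infix "sesqui'_holomorphic'_on" 50) where
  "C sesqui_holomorphic_on U \<longleftrightarrow>
     (\<forall>p\<in>U. \<exists>L. ((\<lambda>(z, w). C z w) has_derivative L) (at p) \<and>
        (\<forall>c u v. L (c *s u, cnj c *s v) = c * L (u, v)))"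

definition bounded_symmetric_domain :: "(complex ^ 'n) set \<Rightarrow> bool" where
  "bounded_symmetric_domain D \<longleftrightarrow>
     D \<noteq> {} \<and> open D \<and> connected D \<and> bounded D \<and>
     (\<forall>z\<in>D. \<exists>s. s cn_holomorphic_map_on D \<and> s ` D \<subseteq> D \<and> (\<forall>w\<in>D. s (s w) = w) \<and>
        s z = z \<and> (\<exists>e>0. \<forall>w\<in>D \<inter> ball z e. s w = w \<longrightarrow> w = z))"

definition circular :: "(complex ^ 'n) set \<Rightarrow> bool" where
  "circular D \<longleftrightarrow> (\<forall>z\<in>D. \<forall>\<alpha>\<in>sphere 0 1. \<alpha> *s z \<in> D)"

definition linear_automorphisms :: "(complex ^ 'n) set \<Rightarrow> (complex ^ 'n ^ 'n) set" where
  "linear_automorphisms D = {k. invertible k \<and> (\<lambda>z. k *v z) ` D = D}"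

definition unitary_group :: "(complex ^ 'n ^ 'n) set" where
  "unitary_group = {k. map_matrix cnj (transpose k) ** k = mat 1}"

definition determines_sup :: "(complex ^ 'n) set \<Rightarrow> (complex ^ 'n) set \<Rightarrow> bool" where
  "determines_sup D S \<longleftrightarrow>
     (\<forall>f. f cn_holomorphic_on D \<and> continuous_on (closure D) f \<longrightarrow>
        (\<exists>\<zeta>\<in>S. (\<forall>\<xi>\<in>S. cmod (f \<xi>) \<le> cmod (f \<zeta>)) \<and> (SUP z\<in>D. cmod (f z)) = cmod (f \<zeta>)))"

definition is_silov_boundary :: "(complex ^ 'n) set \<Rightarrow> (complex ^ 'n) set \<Rightarrow> bool" where
  "is_silov_boundary D B \<longleftrightarrow>
     closed B \<and> B \<subseteq> frontier D \<and> determines_sup D B \<and>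
     (\<forall>S. closed S \<and> S \<subseteq> frontier D \<and> determines_sup D S \<longrightarrow> B \<subseteq> S)"

text \<open>The standing assumptions on \<open>D\<close> and its Silov boundary \<open>B\<close>. Transitivity of the group of
  linear automorphisms on \<open>B\<close> is a classical fact on bounded symmetric domains, and the last two
  conditions are a normalization of the coordinates.\<close>

definition normalized_domain :: "(complex ^ 'n) set \<Rightarrow> (complex ^ 'n) set \<Rightarrow> bool" where
  "normalized_domain D B \<longleftrightarrow>
     bounded_symmetric_domain D \<and> convex D \<and> circular D \<and> is_silov_boundary D B \<and>
     (\<forall>\<zeta>\<in>B. \<forall>\<xi>\<in>B. \<exists>k\<in>linear_automorphisms D. k *v \<zeta> = \<xi>) \<and>
     linear_automorphisms D \<subseteq> unitary_group \<and> B \<subseteq> sphere 0 1"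

text \<open>On a compact set \<open>X\<close> of a Euclidean space, the positive Radon measures are the finite Borel
  measures.\<close>

definition positive_radon_on :: "'a::euclidean_space set \<Rightarrow> 'a measure \<Rightarrow> bool" where
  "positive_radon_on X M \<longleftrightarrow> sets M = sets (restrict_space borel X) \<and> finite_measure M"

definition invariant_probability ::
    "(complex ^ 'n) set \<Rightarrow> (complex ^ 'n) set \<Rightarrow> (complex ^ 'n) measure \<Rightarrow> bool" where
  "invariant_probability D B \<beta> \<longleftrightarrow>
     positive_radon_on B \<beta> \<and> prob_space \<beta> \<and>
     (\<forall>k\<in>linear_automorphisms D. distr \<beta> \<beta> (\<lambda>\<zeta>. k *v \<zeta>) = \<beta>)"

text \<open>Normalized Haar measure on the unit circle, realized as the push-forward of normalized
  Lebesgue measure; that it is the rotation-invariant probability measure is proved below.\<close>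

definition haar_circle :: "complex measure" where
  "haar_circle =
     distr (uniform_measure lborel {0..<2 * pi}) (restrict_space borel (sphere 0 1)) cis"

lemma measurable_cis_circle:
  "cis \<in> lborel \<rightarrow>\<^sub>M restrict_space borel (sphere 0 1)"
  by (intro measurable_restrict_space2) (auto intro!: borel_measurable_continuous_onI continuous_intros)

lemma prob_space_haar_circle: "prob_space haar_circle"
proof -
  have "prob_space (uniform_measure lborel {0..<2 * pi})"
    by (rule prob_space_uniform_measure) auto
  moreover have "cis \<in> uniform_measure lborel {0..<2 * pi} \<rightarrow>\<^sub>M restrict_space borel (sphere 0 1)"
    using measurable_cis_circle by simp
  ultimately show ?thesis
    unfolding haar_circle_def by (rule prob_space.prob_space_distr)
qed

lemma nn_integral_shift_period:
  fixes h :: "real \<Rightarrow> ennreal"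
  assumes [measurable]: "h \<in> borel_measurable borel"
    and per: "\<And>x. h (x + 2 * pi) = h x" and t: "0 \<le> t" "t \<le> 2 * pi"
  shows "(\<integral>\<^sup>+x\<in>{0..<2 * pi}. h (x + t) \<partial>lborel) = (\<integral>\<^sup>+x\<in>{0..<2 * pi}. h x \<partial>lborel)"
proof -
  have shift: "(\<integral>\<^sup>+x. g x \<partial>lborel) = (\<integral>\<^sup>+x. g (x + s) \<partial>lborel)"
    if "g \<in> borel_measurable borel" for g :: "real \<Rightarrow> ennreal" and s
    using nn_integral_real_affine[OF that, of 1 s] by (simp add: add.commute)
  have "(\<integral>\<^sup>+x\<in>{0..<2 * pi}. h (x + t) \<partial>lborel) = (\<integral>\<^sup>+x\<in>{t..<2 * pi + t}. h x \<partial>lborel)"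
    by (subst (2) shift[of _ t]) (auto intro!: nn_integral_cong split: split_indicator)
  also have "\<dots> = (\<integral>\<^sup>+x. h x * indicator {t..<2 * pi} x + h x * indicator {2 * pi..<2 * pi + t} x \<partial>lborel)"
    using t by (auto intro!: nn_integral_cong split: split_indicator)
  also have "\<dots> = (\<integral>\<^sup>+x\<in>{t..<2 * pi}. h x \<partial>lborel) + (\<integral>\<^sup>+x\<in>{2 * pi..<2 * pi + t}. h x \<partial>lborel)"
    by (rule nn_integral_add) auto
  also have "(\<integral>\<^sup>+x\<in>{2 * pi..<2 * pi + t}. h x \<partial>lborel) = (\<integral>\<^sup>+x\<in>{0..<t}. h x \<partial>lborel)"
    by (subst shift[of _ "2 * pi"]) (auto intro!: nn_integral_cong simp: per split: split_indicator)
  also have "(\<integral>\<^sup>+x\<in>{t..<2 * pi}. h x \<partial>lborel) + (\<integral>\<^sup>+x\<in>{0..<t}. h x \<partial>lborel) =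
      (\<integral>\<^sup>+x. h x * indicator {t..<2 * pi} x + h x * indicator {0..<t} x \<partial>lborel)"
    by (rule nn_integral_add[symmetric]) auto
  also have "\<dots> = (\<integral>\<^sup>+x\<in>{0..<2 * pi}. h x \<partial>lborel)"
    using t by (auto intro!: nn_integral_cong split: split_indicator)
  finally show ?thesis .
qed

lemma distr_rotation_haar_circle:
  assumes "cmod c = 1"
  shows "distr haar_circle haar_circle (\<lambda>\<alpha>. c * \<alpha>) = haar_circle"
proof -
  let ?T = "restrict_space borel (sphere 0 1) :: complex measure"
  let ?U = "uniform_measure lborel {0..<2 * pi}"
  obtain t where t: "0 \<le> t" "t < 2 * pi" "c = cis t"
    using assms by (metis (no_types, lifting) complex_norm_eq_1_exp cis_conv_exp
        Arg2pi_ge_0 Arg2pi_lt_2pi Arg2pi_eq mult.left_neutral of_real_1 complex_norm_eq_1_exp)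
  note [measurable] = measurable_cis_circle
  have [measurable]: "(\<lambda>\<alpha>. c * \<alpha>) \<in> ?T \<rightarrow>\<^sub>M ?T"
    using assms by (intro measurable_restrict_space3) (auto simp: norm_mult)
  have U: "emeasure ?U {x. cis (x + s) \<in> A} =
      (\<integral>\<^sup>+x\<in>{0..<2 * pi}. indicator A (cis (x + s)) \<partial>lborel) / (2 * pi)"
    if [measurable]: "A \<in> sets ?T" for A s
  proof -
    have "(\<lambda>x. cis (x + s)) -` A \<inter> space borel \<in> sets borel"
      by (rule measurable_sets[of _ _ ?T])
        (auto intro!: measurable_restrict_space2 borel_measurable_continuous_onI continuous_intros that)
    then have [measurable]: "{x. cis (x + s) \<in> A} \<in> sets borel"
      by (simp add: vimage_def)
    have "emeasure lborel ({0..<2 * pi} \<inter> {x. cis (x + s) \<in> A}) =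
        (\<integral>\<^sup>+x. indicator ({0..<2 * pi} \<inter> {x. cis (x + s) \<in> A}) x \<partial>lborel)"
      by (rule nn_integral_indicator[symmetric]) auto
    also have "\<dots> = (\<integral>\<^sup>+x\<in>{0..<2 * pi}. indicator A (cis (x + s)) \<partial>lborel)"
      by (rule nn_integral_cong) (simp split: split_indicator)
    finally show ?thesis
      by simp
  qed
  show ?thesis
  proof (rule measure_eqI)
    fix A assume "A \<in> sets (distr haar_circle haar_circle (\<lambda>\<alpha>. c * \<alpha>))"
    then have A[measurable]: "A \<in> sets ?T" by (simp add: haar_circle_def)
    have cis_meas: "(\<lambda>x. indicator A (cis x) :: ennreal) \<in> borel_measurable borel"
      by measurable
    have "distr haar_circle haar_circle (\<lambda>\<alpha>. c * \<alpha>) = distr (distr ?U ?T cis) ?T (\<lambda>\<alpha>. c * \<alpha>)"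
      by (rule distr_cong) (simp_all add: haar_circle_def)
    also have "\<dots> = distr ?U ?T ((\<lambda>\<alpha>. c * \<alpha>) \<circ> cis)"
      by (rule distr_distr) auto
    also have "(\<lambda>\<alpha>. c * \<alpha>) \<circ> cis = (\<lambda>x. cis (x + t))"
      using t(3) by (auto simp: cis_mult add.commute)
    finally have "emeasure (distr haar_circle haar_circle (\<lambda>\<alpha>. c * \<alpha>)) A =
        emeasure (distr ?U ?T (\<lambda>x. cis (x + t))) A"
      by simp
    also have "\<dots> = emeasure ?U ((\<lambda>x. cis (x + t)) -` A \<inter> space ?U)"
      by (rule emeasure_distr)
        (auto intro!: measurable_restrict_space2 borel_measurable_continuous_onI continuous_intros A)
    also have "\<dots> = emeasure ?U {x. cis (x + t) \<in> A}"
      by (simp add: vimage_def)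
    also have "\<dots> = emeasure ?U {x. cis (x + 0) \<in> A}"
      unfolding U[OF A] using nn_integral_shift_period[OF cis_meas _ t(1)] t(2)
      by (simp add: cis_mult[symmetric] cis_2pi)
    also have "\<dots> = emeasure haar_circle A"
      unfolding haar_circle_def by (simp add: emeasure_distr vimage_def)
    finally show "emeasure (distr haar_circle haar_circle (\<lambda>\<alpha>. c * \<alpha>)) A = emeasure haar_circle A" .
  qed simp
qed

definition hardy_mean ::
    "(complex ^ 'n) measure \<Rightarrow> (complex ^ 'n \<Rightarrow> complex) \<Rightarrow> real \<Rightarrow> real" where
  "hardy_mean \<beta> f \<rho> = (\<integral>\<zeta>. (cmod (f (\<rho> *\<^sub>R \<zeta>)))\<^sup>2 \<partial>\<beta>)"

definition hardy_space ::
    "(complex ^ 'n) set \<Rightarrow> (complex ^ 'n) measure \<Rightarrow> (complex ^ 'n \<Rightarrow> complex) set" where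
  "hardy_space D \<beta> = {f. f cn_holomorphic_on D \<and> bdd_above (hardy_mean \<beta> f ` {0..<1})}"

definition hardy_norm_sq :: "(complex ^ 'n) measure \<Rightarrow> (complex ^ 'n \<Rightarrow> complex) \<Rightarrow> real" where
  "hardy_norm_sq \<beta> f = (SUP \<rho>\<in>{0..<1}. hardy_mean \<beta> f \<rho>)"

text \<open>The inner product (linear in the first argument) belonging to the norm, by polarization.\<close>

definition hardy_inner ::
    "(complex ^ 'n) measure \<Rightarrow> (complex ^ 'n \<Rightarrow> complex) \<Rightarrow> (complex ^ 'n \<Rightarrow> complex) \<Rightarrow> complex" where
  "hardy_inner \<beta> f g =
     Complex ((hardy_norm_sq \<beta> (\<lambda>z. f z + g z) - hardy_norm_sq \<beta> (\<lambda>z. f z - g z)) / 4)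
             ((hardy_norm_sq \<beta> (\<lambda>z. f z + \<i> * g z) - hardy_norm_sq \<beta> (\<lambda>z. f z - \<i> * g z)) / 4)"

text \<open>\<open>C\<close> is the reproducing kernel on \<open>D \<times> D\<close>, and its values on \<open>D \<times> closure D\<close> are those of the
  (unique) sesqui-holomorphic extension.\<close>

definition is_szego_kernel ::
    "(complex ^ 'n) set \<Rightarrow> (complex ^ 'n) measure \<Rightarrow> (complex ^ 'n \<Rightarrow> complex ^ 'n \<Rightarrow> complex) \<Rightarrow> bool" where
  "is_szego_kernel D \<beta> C \<longleftrightarrow>
     (\<forall>w\<in>D. (\<lambda>z. C z w) \<in> hardy_space D \<beta> \<and>
        (\<forall>f\<in>hardy_space D \<beta>. f w = hardy_inner \<beta> f (\<lambda>z. C z w))) \<and>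
     (\<exists>U. open U \<and> D \<times> closure D \<subseteq> U \<and> C sesqui_holomorphic_on U)"

definition poisson_szego ::
    "(complex ^ 'n \<Rightarrow> complex ^ 'n \<Rightarrow> complex) \<Rightarrow> complex ^ 'n \<Rightarrow> complex ^ 'n \<Rightarrow> real" where
  "poisson_szego C z \<zeta> = (cmod (C z \<zeta>))\<^sup>2 / Re (C z z)"

definition is_clark_measure ::
    "(complex ^ 'n) set \<Rightarrow> (complex ^ 'n) set \<Rightarrow> (complex ^ 'n \<Rightarrow> complex ^ 'n \<Rightarrow> complex) \<Rightarrow>
     (complex ^ 'n \<Rightarrow> complex) \<Rightarrow> complex \<Rightarrow> (complex ^ 'n) measure \<Rightarrow> bool" where
  "is_clark_measure D B C \<phi> \<alpha> M \<longleftrightarrow>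
     positive_radon_on B M \<and>
     (\<forall>z\<in>D. (\<integral>\<zeta>. poisson_szego C z \<zeta> \<partial>M) = Re ((\<alpha> + \<phi> z) / (\<alpha> - \<phi> z)))"

text \<open>A partial map; it is \<open>None\<close> where the radial limit does not exist.\<close>

definition radial_limit :: "(complex ^ 'n \<Rightarrow> complex) \<Rightarrow> complex ^ 'n \<Rightarrow> complex option" where
  "radial_limit f \<zeta> =
     (if \<exists>l. ((\<lambda>\<rho>. f (\<rho> *\<^sub>R \<zeta>)) \<longlongrightarrow> l) (at_left (1::real))
      then Some (Lim (at_left (1::real)) (\<lambda>\<rho>. f (\<rho> *\<^sub>R \<zeta>))) else None)"

definition inner_function ::
    "(complex ^ 'n) set \<Rightarrow> (complex ^ 'n) measure \<Rightarrow> (complex ^ 'n \<Rightarrow> complex) \<Rightarrow> bool" where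
  "inner_function D \<beta> \<phi> \<longleftrightarrow>
     \<phi> cn_holomorphic_on D \<and> bounded (\<phi> ` D) \<and>
     (AE \<zeta> in \<beta>. \<exists>l\<in>sphere 0 1. radial_limit \<phi> \<zeta> = Some l)"

definition vaguely_continuous_on ::
    "'a::euclidean_space set \<Rightarrow> 'b::topological_space set \<Rightarrow> ('b \<Rightarrow> 'a measure) \<Rightarrow> bool" where
  "vaguely_continuous_on X Y \<mu> \<longleftrightarrow>
     (\<forall>f :: 'a \<Rightarrow> complex. continuous_on X f \<longrightarrow> continuous_on Y (\<lambda>y. \<integral>x. f x \<partial>\<mu> y))"

definition has_vague_integral ::
    "'a::euclidean_space set \<Rightarrow> 'b measure \<Rightarrow> ('b \<Rightarrow> 'a measure) \<Rightarrow> 'a measure \<Rightarrow> bool" where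
  "has_vague_integral X \<nu> \<mu> M \<longleftrightarrow>
     (\<forall>f :: 'a \<Rightarrow> complex. continuous_on X f \<longrightarrow>
        integrable \<nu> (\<lambda>y. \<integral>x. f x \<partial>\<mu> y) \<and> (\<integral>y. (\<integral>x. f x \<partial>\<mu> y) \<partial>\<nu>) = (\<integral>x. f x \<partial>M))"

text \<open>Negligible sets are arbitrary subsets of Borel null sets, and integrability refers to
  functions that agree almost everywhere with a Borel function, whence the completions below.
  The map \<open>p\<close> is an almost everywhere defined map from \<open>space M\<close> to \<open>space \<nu>\<close>.\<close>

definition ae_version :: "'a measure \<Rightarrow> 'b measure \<Rightarrow> ('a \<Rightarrow> 'b option) \<Rightarrow> ('a \<Rightarrow> 'b) \<Rightarrow> bool" where
  "ae_version M \<nu> p g \<longleftrightarrow> g \<in> M \<rightarrow>\<^sub>M \<nu> \<and> (AE x in M. p x = Some (g x))"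

definition pseudo_image_measure ::
    "'a measure \<Rightarrow> ('a \<Rightarrow> 'b option) \<Rightarrow> 'b measure \<Rightarrow> bool" where
  "pseudo_image_measure M p \<nu> \<longleftrightarrow>
     (\<exists>g. ae_version M \<nu> p g) \<and>
     (\<forall>N\<subseteq>space \<nu>. N \<in> null_sets (completion \<nu>) \<longleftrightarrow>
        {x\<in>space M. \<exists>y\<in>N. p x = Some y} \<in> null_sets (completion M))"

definition weak_pseudo_image_measure ::
    "'a measure \<Rightarrow> ('a \<Rightarrow> 'b option) \<Rightarrow> 'b measure \<Rightarrow> bool" where
  "weak_pseudo_image_measure M p \<nu> \<longleftrightarrow>
     (\<exists>g. ae_version M \<nu> p g) \<and>
     (\<forall>N\<subseteq>space \<nu>. N \<in> null_sets (completion \<nu>) \<longrightarrow>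
        {x\<in>space M. \<exists>y\<in>N. p x = Some y} \<in> null_sets (completion M))"

definition disintegration ::
    "'a measure \<Rightarrow> ('a \<Rightarrow> 'b option) \<Rightarrow> 'b measure \<Rightarrow> ('b \<Rightarrow> 'a measure) \<Rightarrow> bool" where
  "disintegration M p \<nu> \<mu> \<longleftrightarrow>
     weak_pseudo_image_measure M p \<nu> \<and>
     (\<forall>y\<in>space \<nu>. sets (\<mu> y) = sets M \<and> finite_measure (\<mu> y)) \<and>
     (AE y in \<nu>. AE x in \<mu> y. p x = Some y) \<and>
     (\<forall>f :: 'a \<Rightarrow> complex. integrable (completion M) f \<longrightarrow>
        (AE y in \<nu>. integrable (completion (\<mu> y)) f) \<and>
        integrable (completion \<nu>) (\<lambda>y. \<integral>x. f x \<partial>completion (\<mu> y)) \<and>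
        (\<integral>x. f x \<partial>completion M) = (\<integral>y. (\<integral>x. f x \<partial>completion (\<mu> y)) \<partial>completion \<nu>))"

definition has_image_measure ::
    "'a measure \<Rightarrow> ('a \<Rightarrow> 'b option) \<Rightarrow> 'b measure \<Rightarrow> bool" where
  "has_image_measure M p \<nu> \<longleftrightarrow> (\<exists>g. ae_version M \<nu> p g \<and> distr M \<nu> g = \<nu>)"

end

theory Submission
  imports Defs "HOL-Complex_Analysis.Complex_Analysis"
begin

text \<open>
  The Poisson--Szego kernel \<open>P\<close> is an approximate identity for a soft reason: against
  \<open>P z \<zeta> d\<beta>(\<zeta>)\<close> holomorphic functions are reproduced, in particular constants and linear forms,
  and \<open>B\<close> lies in the unit sphere; hence \<open>\<integral> P (\<rho> \<zeta>) \<xi> \<bar>\<xi> - \<zeta>\<bar>\<^sup>2 d\<beta>(\<xi>) = 2 - 2 \<rho>\<close>. Together with the symmetry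
  \<open>P (\<rho> \<xi>) \<zeta> = P (\<rho> \<zeta>) \<xi>\<close>, which follows from circularity and transitivity, this gives
  \<open>\<integral> f d\<mu>\<^sub>\<alpha> = lim \<integral> f(\<xi>) Re ((\<alpha> + \<phi>(\<rho> \<xi>)) / (\<alpha> - \<phi>(\<rho> \<xi>))) d\<beta>(\<xi>)\<close> as \<open>\<rho>\<close> tends to \<open>1\<close>, uniformly in \<open>\<alpha>\<close>, for
  continuous \<open>f\<close>. Vague continuity is immediate, and integrating against \<open>1\<close> and \<open>cnj \<alpha>\<close> (where the
  Poisson kernel of the disc yields \<open>1\<close> and \<open>cnj \<phi>\<close>) gives \<open>\<integral> \<mu>\<^sub>\<alpha> d\<alpha> = \<beta>\<close> and
  \<open>\<integral> cnj \<alpha> \<mu>\<^sub>\<alpha> d\<alpha> = cnj \<phi>\<^sub>1 \<beta>\<close>. If \<open>\<phi>\<close> is inner, these two identities force \<open>\<phi>\<^sub>1 = \<alpha>\<close> almost everywhere for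
  \<open>\<mu>\<^sub>\<alpha>\<close>, for almost every \<open>\<alpha>\<close>; the remaining claims follow because \<open>\<mu>\<^sub>\<alpha>\<close> has the mass
  \<open>Re ((\<alpha> + \<phi>(0)) / (\<alpha> - \<phi>(0))) > 0\<close>.
\<close>

section \<open>Parameter integrals\<close>

text \<open>Reproduction against the Poisson-Szego kernel rests on a product: if \<open>u\<close> is
  holomorphic on \<open>D\<close> and continuous up to the boundary, so is \<open>u\<close> times
  the kernel function at \<open>z\<close>, and reproducing this product at \<open>z\<close> gives
  \<open>u z * C z z\<close>. For this the Hardy norm, a supremum over dilates, has to be identified
  with the \<beta>-norm on \<open>B\<close>; identities at boundary points are proved inside
  \<open>D\<close> and continued by continuity. The obstacle for inner functions is that vague
  identities are tested on continuous functions, while \<open>\<phi>\<^sub>1\<close> is merely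
  measurable. The dilates of \<phi> are continuous on \<open>B\<close> and stand in for it, in two
  successive limits. To follow these limits under \<open>\<mu>\<^sub>\<alpha>\<close>, the average
  of the Clark measures is first extended from continuous to integrable functions. The outcome is
  that the average over \<alpha> of \<integral> \<open>cnj \<alpha> * \<phi>\<^sub>1\<close> against
  \<open>\<mu>\<^sub>\<alpha>\<close> is \<open>1\<close>, which is also the average mass; as the
  integrand is unimodular, it must equal \<open>1\<close> almost everywhere.\<close>

lemma space_positive_radon_on: "positive_radon_on X M \<Longrightarrow> space M = X"
  unfolding positive_radon_on_def using sets_eq_imp_space_eq[of M "restrict_space borel X"]
  by (simp add: space_restrict_space)

lemma positive_radon_on_continuous_measurable:
  assumes "positive_radon_on X M" "continuous_on X f"
  shows "f \<in> borel_measurable M"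
  using borel_measurable_continuous_on_restrict[OF assms(2)] assms(1)
  unfolding positive_radon_on_def by (metis measurable_cong_sets)

lemma positive_radon_on_borel_measurable:
  assumes "positive_radon_on X M" "f \<in> borel_measurable borel"
  shows "f \<in> borel_measurable M"
  using measurable_restrict_space1[OF assms(2), of X] assms(1)
  unfolding positive_radon_on_def by (metis measurable_cong_sets)

lemma positive_radon_on_integrable:
  fixes f :: "'a::euclidean_space \<Rightarrow> 'b::{banach,second_countable_topology}"
  assumes "positive_radon_on X M" "compact X" "continuous_on X f"
  shows "integrable M f"
proof -
  obtain K where "\<forall>x\<in>X. norm (f x) \<le> K"
    using compact_imp_bounded[OF compact_continuous_image[OF assms(3,2)]] by (auto simp: bounded_iff)
  then show ?thesis
    using assms positive_radon_on_continuous_measurable[OF assms(1,3)] space_positive_radon_on[OF assms(1)]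
    by (intro finite_measure.integrable_const_bound[where B=K])
      (auto simp: positive_radon_on_def)
qed

lemma
  assumes "continuous_on (Y \<times> X) (\<lambda>(y, x). h y x)"
  shows continuous_on_slice_right: "y \<in> Y \<Longrightarrow> continuous_on X (h y)"
    and continuous_on_slice_left: "x \<in> X \<Longrightarrow> continuous_on Y (\<lambda>y. h y x)"
proof -
  show "continuous_on X (h y)" if "y \<in> Y"
  proof -
    have "continuous_on X (\<lambda>x. case (y, x) of (y, x) \<Rightarrow> h y x)"
      by (rule continuous_on_compose2[OF assms continuous_on_Pair[OF continuous_on_const continuous_on_id]])
        (use that in auto)
    then show ?thesis by simp
  qed
  show "continuous_on Y (\<lambda>y. h y x)" if "x \<in> X"
  proof -
    have "continuous_on Y (\<lambda>y. case (y, x) of (y, x) \<Rightarrow> h y x)"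
      by (rule continuous_on_compose2[OF assms continuous_on_Pair[OF continuous_on_id continuous_on_const]])
        (use that in auto)
    then show ?thesis by simp
  qed
qed

lemma continuous_on_integral_parameter:
  fixes h :: "'b::metric_space \<Rightarrow> 'a::euclidean_space \<Rightarrow> 'c::{banach,second_countable_topology}"
  assumes M: "positive_radon_on X M" "compact X" and "compact Y"
    and h: "continuous_on (Y \<times> X) (\<lambda>(y, x). h y x)"
  shows "continuous_on Y (\<lambda>y. \<integral>x. h y x \<partial>M)"
proof -
  note hy = continuous_on_slice_right[OF h] and hx = continuous_on_slice_left[OF h]
  obtain K where K: "\<forall>p\<in>Y \<times> X. norm (case p of (y, x) \<Rightarrow> h y x) \<le> K"
    using compact_imp_bounded[OF compact_continuous_image[OF h compact_Times[OF assms(3,2)]]]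
    by (auto simp: bounded_iff)
  interpret finite_measure M using M by (simp add: positive_radon_on_def)
  show ?thesis
    unfolding continuous_on_sequentially comp_def
  proof (intro ballI allI impI; elim conjE)
    fix s a assume s: "\<forall>n. s n \<in> Y" "s \<longlonglongrightarrow> a" and a: "a \<in> Y"
    show "(\<lambda>n. \<integral>x. h (s n) x \<partial>M) \<longlonglongrightarrow> (\<integral>x. h a x \<partial>M)"
    proof (rule integral_dominated_convergence[where w="\<lambda>_. K"])
      show "h a \<in> borel_measurable M" "h (s i) \<in> borel_measurable M" for i
        using s a hy M by (auto intro: positive_radon_on_continuous_measurable)
      show "AE x in M. (\<lambda>i. h (s i) x) \<longlonglongrightarrow> h a x"
      proof (rule AE_I2)
        fix x assume "x \<in> space M"
        then show "(\<lambda>i. h (s i) x) \<longlonglongrightarrow> h a x"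
          using hx[of x] s a M unfolding continuous_on_sequentially
          by (auto simp: comp_def space_positive_radon_on)
      qed
      show "AE x in M. norm (h (s i) x) \<le> K" for i
        using K s M by (auto simp: space_positive_radon_on)
    qed simp
  qed
qed

lemma positive_radon_on_Fubini:
  fixes h :: "'a::euclidean_space \<Rightarrow> 'b::euclidean_space \<Rightarrow> 'c::{banach,second_countable_topology}"
  assumes M: "positive_radon_on X M" "compact X" and N: "positive_radon_on Y N" "compact Y"
    and h: "continuous_on (X \<times> Y) (\<lambda>(x, y). h x y)"
  shows "(\<integral>x. (\<integral>y. h x y \<partial>N) \<partial>M) = (\<integral>y. (\<integral>x. h x y \<partial>M) \<partial>N)"
proof -
  interpret M: finite_measure M using M by (simp add: positive_radon_on_def)
  interpret N: finite_measure N using N by (simp add: positive_radon_on_def)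
  interpret pair_sigma_finite M N ..
  interpret P: finite_measure "M \<Otimes>\<^sub>M N"
    by (rule finite_measure_pair_measure) (unfold_locales)
  have [simp]: "space M = X" "space N = Y"
    using M N space_positive_radon_on by auto
  have XY: "X \<times> Y \<in> sets borel"
    using M N by (intro borel_closed closed_Times compact_imp_closed)
  \<comment> \<open>Continuity on \<open>X \<times> Y\<close> is relative to that set. Extended by
    zero, the integrand is Borel on the whole space, where the Borel sets are those of the product
    sigma-algebra.\<close>
  define H where "H = (\<lambda>p. indicator (X \<times> Y) p *\<^sub>R (case p of (x, y) \<Rightarrow> h x y))"
  have H0: "H \<in> borel_measurable borel"
    unfolding H_def by (rule borel_measurable_continuous_on_indicator[OF XY h])
  have "fst \<in> M \<Otimes>\<^sub>M N \<rightarrow>\<^sub>M borel"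
    using measurable_compose[OF measurable_fst[of M N] positive_radon_on_borel_measurable[OF M(1) measurable_ident]] by simp
  moreover have "snd \<in> M \<Otimes>\<^sub>M N \<rightarrow>\<^sub>M borel"
    using measurable_compose[OF measurable_snd[of M N] positive_radon_on_borel_measurable[OF N(1) measurable_ident]] by simp
  ultimately have "(\<lambda>p. (fst p, snd p)) \<in> M \<Otimes>\<^sub>M N \<rightarrow>\<^sub>M borel \<Otimes>\<^sub>M borel"
    by (rule measurable_Pair)
  then have "(\<lambda>p. p) \<in> M \<Otimes>\<^sub>M N \<rightarrow>\<^sub>M borel"
    by (simp add: borel_prod)
  then have H: "H \<in> borel_measurable (M \<Otimes>\<^sub>M N)"
    using measurable_compose[OF _ H0] by blast
  obtain K where K: "\<forall>p\<in>X \<times> Y. norm (case p of (x, y) \<Rightarrow> h x y) \<le> K"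
    using compact_imp_bounded[OF compact_continuous_image[OF h compact_Times[OF M(2) N(2)]]]
    by (auto simp: bounded_iff)
  have "integrable (M \<Otimes>\<^sub>M N) H"
    by (rule P.integrable_const_bound[where B=K])
      (use K H in \<open>auto simp: H_def space_pair_measure\<close>)
  then have "(\<integral>y. (\<integral>x. H (x, y) \<partial>M) \<partial>N) = (\<integral>x. (\<integral>y. H (x, y) \<partial>N) \<partial>M)"
    by (intro Fubini_integral) (simp add: case_prod_unfold)
  also have "(\<integral>y. (\<integral>x. H (x, y) \<partial>M) \<partial>N) = (\<integral>y. (\<integral>x. h x y \<partial>M) \<partial>N)"
    by (intro Bochner_Integration.integral_cong) (auto simp: H_def)
  also have "(\<integral>x. (\<integral>y. H (x, y) \<partial>N) \<partial>M) = (\<integral>x. (\<integral>y. h x y \<partial>N) \<partial>M)"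
    by (intro Bochner_Integration.integral_cong) (auto simp: H_def)
  finally show ?thesis by simp
qed

lemma positive_radon_on_haar_circle: "positive_radon_on (sphere 0 1) haar_circle"
  using prob_space_haar_circle
  by (auto simp: positive_radon_on_def haar_circle_def intro: prob_space.finite_measure)

text \<open>The difference quotients are dominated by Cauchy's estimate for the derivative.\<close>

lemma holomorphic_on_integral_parameter:
  fixes h :: "complex \<Rightarrow> 'a \<Rightarrow> complex"
  assumes "finite_measure M" and S: "open S"
    and meas: "\<And>l. l \<in> S \<Longrightarrow> h l \<in> borel_measurable M"
    and hol: "\<And>x. x \<in> space M \<Longrightarrow> (\<lambda>l. h l x) holomorphic_on S"
    and K: "\<And>l x. l \<in> S \<Longrightarrow> x \<in> space M \<Longrightarrow> cmod (h l x) \<le> K"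
  shows "(\<lambda>l. \<integral>x. h l x \<partial>M) holomorphic_on S"
proof -
  interpret finite_measure M by fact
  have int: "integrable M (h l)" if "l \<in> S" for l
    by (rule integrable_const_bound[where B=K]) (use K meas that in auto)
  have "(\<lambda>l. \<integral>x. h l x \<partial>M) field_differentiable at a" if a: "a \<in> S" for a
  proof -
    obtain r0 where r0: "r0 > 0" "cball a r0 \<subseteq> S"
      using S a open_contains_cball by blast
    \<comment> \<open>Half the radius: a disc of radius \<open>r\<close> around any point of
      \<open>cball a r\<close> still lies in \<open>S\<close>. So Cauchy's estimate bounds the
      derivative by \<open>K / r\<close> at all these points and not only at \<open>a\<close>, which
      makes \<open>lip\<close> uniform in \<open>x\<close>.\<close>
    define r where "r = r0 / 2"
    have r: "r > 0" using r0 by (simp add: r_def)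
    have sub: "cball b r \<subseteq> S" if "b \<in> cball a r" for b
    proof
      fix z assume "z \<in> cball b r"
      then have "dist a z \<le> r0"
        using that dist_triangle[of a z b] by (auto simp: r_def)
      then show "z \<in> S" using r0 by auto
    qed
    have der: "cmod (deriv (\<lambda>l. h l x) b) \<le> K / r" if "x \<in> space M" "b \<in> cball a r" for x b
    proof -
      have "norm ((deriv ^^ 1) (\<lambda>l. h l x) b) \<le> fact 1 * K / r ^ 1"
      proof (rule Cauchy_inequality)
        show "(\<lambda>l. h l x) holomorphic_on ball b r"
          using hol[OF that(1)] sub[OF that(2)]
          by (meson ball_subset_cball holomorphic_on_subset order_trans)
        show "continuous_on (cball b r) (\<lambda>l. h l x)"
          using hol[OF that(1)] sub[OF that(2)]
          by (meson holomorphic_on_imp_continuous_on holomorphic_on_subset)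
        fix y assume "norm (b - y) = r"
        then have "y \<in> S" using sub[OF that(2)] by (auto simp: dist_norm)
        then show "cmod (h y x) \<le> K" using K that by auto
      qed (use r in auto)
      then show ?thesis by simp
    qed
    have lip: "cmod (h b x - h a x) \<le> K / r * cmod (b - a)" if "x \<in> space M" "b \<in> cball a r" for x b
    proof (rule field_differentiable_bound[where S="cball a r" and f'="deriv (\<lambda>l. h l x)"])
      fix z assume z: "z \<in> cball a r"
      have "(\<lambda>l. h l x) field_differentiable at z"
        using hol[OF that(1)] sub[of a] z r S by (auto simp: holomorphic_on_open field_differentiable_def)
      then show "((\<lambda>l. h l x) has_field_derivative deriv (\<lambda>l. h l x) z) (at z within cball a r)"
        by (simp add: field_differentiable_derivI has_field_derivative_at_within)
      show "cmod (deriv (\<lambda>l. h l x) z) \<le> K / r"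
        by (rule der) (use z that in auto)
    qed (use that r in auto)
    define h' where "h' = (\<lambda>x. deriv (\<lambda>l. h l x) a)"
    have quot: "(\<lambda>n. (h (u n) x - h a x) / (u n - a)) \<longlonglongrightarrow> h' x"
      if "x \<in> space M" "\<forall>n. u n \<noteq> a" "u \<longlonglongrightarrow> a" for x u
    proof -
      have "(\<lambda>l. h l x) field_differentiable at a"
        using hol[OF that(1)] a S by (auto simp: holomorphic_on_open field_differentiable_def)
      then have "((\<lambda>y. (h y x - h a x) / (y - a)) \<longlongrightarrow> h' x) (at a)"
        unfolding h'_def by (rule has_field_derivative_iff[THEN iffD1, OF field_differentiable_derivI])
      then show ?thesis
        using that by (auto simp: tendsto_at_iff_sequentially comp_def)
    qed
    \<comment> \<open>The derivative is measurable in \<open>x\<close> as a pointwise limit of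
      difference quotients along one fixed sequence of increments.\<close>
    have meas': "h' \<in> borel_measurable M"
    proof (rule borel_measurable_LIMSEQ_metric)
      let ?u = "\<lambda>n. a + of_real (r / (Suc n))"
      have u: "?u n \<in> S" for n
      proof -
        have "?u n \<in> cball a r" using r by (auto simp: dist_norm field_simps norm_divide simp flip: of_real_divide)
        then show ?thesis using sub[of a] r by auto
      qed
      show "(\<lambda>x. (h (?u n) x - h a x) / (?u n - a)) \<in> borel_measurable M" for n
        using meas[OF u[of n]] meas[OF a] by measurable
      have "(\<lambda>n. a + of_real (r * inverse (real (Suc n)))) \<longlonglongrightarrow> a + of_real (r * 0)"
        by (intro tendsto_intros LIMSEQ_inverse_real_of_nat)
      then have "?u \<longlonglongrightarrow> a" by (simp add: divide_inverse)
      then show "(\<lambda>n. (h (?u n) x - h a x) / (?u n - a)) \<longlonglongrightarrow> h' x" if "x \<in> space M" for x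
        using that r by (intro quot) (auto simp: less_eq_real_def simp del: of_nat_Suc)
    qed
    have "((\<lambda>y. ((\<integral>x. h y x \<partial>M) - (\<integral>x. h a x \<partial>M)) / (y - a)) \<longlongrightarrow> (\<integral>x. h' x \<partial>M)) (at a)"
      unfolding tendsto_at_iff_sequentially comp_def
    proof (intro allI impI)
      fix u :: "nat \<Rightarrow> complex" assume u: "\<forall>i. u i \<in> UNIV - {a}" "u \<longlonglongrightarrow> a"
      have "\<forall>\<^sub>F n in sequentially. dist (u n) a < r"
        using u(2) r by (auto simp: tendsto_iff)
      then obtain n0 where n0: "\<forall>n\<ge>n0. u n \<in> cball a r"
        by (force simp: eventually_sequentially dist_commute)
      then have uS: "u (n + n0) \<in> S" for n using sub[of a] r by auto
      have "(\<lambda>n. \<integral>x. (h (u (n + n0)) x - h a x) / (u (n + n0) - a) \<partial>M) \<longlonglongrightarrow> (\<integral>x. h' x \<partial>M)"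
      proof (rule integral_dominated_convergence[where w="\<lambda>_. K / r"])
        show "(\<lambda>x. (h (u (n + n0)) x - h a x) / (u (n + n0) - a)) \<in> borel_measurable M" for n
          using meas[OF uS[of n]] meas[OF a] by measurable
        show "AE x in M. (\<lambda>n. (h (u (n + n0)) x - h a x) / (u (n + n0) - a)) \<longlonglongrightarrow> h' x"
          by (intro AE_I2 quot) (use u in \<open>auto intro: LIMSEQ_ignore_initial_segment\<close>)
        show "AE x in M. cmod ((h (u (n + n0)) x - h a x) / (u (n + n0) - a)) \<le> K / r" for n
          using lip[of _ "u (n + n0)"] n0 u(1) by (intro AE_I2) (auto simp: norm_divide divide_simps)
      qed (use meas' in auto)
      also have "(\<lambda>n. \<integral>x. (h (u (n + n0)) x - h a x) / (u (n + n0) - a) \<partial>M) =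
          (\<lambda>n. ((\<integral>x. h (u (n + n0)) x \<partial>M) - (\<integral>x. h a x \<partial>M)) / (u (n + n0) - a))"
        using int[OF uS] int[OF a] by (intro ext) (simp add: integral_diff)
      finally show "(\<lambda>n. ((\<integral>x. h (u n) x \<partial>M) - (\<integral>x. h a x \<partial>M)) / (u n - a)) \<longlonglongrightarrow> (\<integral>x. h' x \<partial>M)"
        by (rule LIMSEQ_offset)
    qed
    then show ?thesis
      unfolding field_differentiable_def has_field_derivative_iff by blast
  qed
  then show ?thesis
    using S by (simp add: holomorphic_on_def field_differentiable_at_within)
qed

text \<open>Rotations give identities for unimodular scalars only; the maximum principle for the
  difference carries them to the whole disc.\<close>

lemma holomorphic_eq_on_disc:
  assumes "f holomorphic_on S" "g holomorphic_on S" "cball 0 1 \<subseteq> S"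
    and "\<And>l. cmod l = 1 \<Longrightarrow> f l = g l" and "cmod l \<le> 1"
  shows "f l = g l"
proof -
  have hol: "(\<lambda>l. f l - g l) holomorphic_on S" using assms by (intro holomorphic_intros)
  have "cmod (f l - g l) \<le> 0"
  proof (rule maximum_modulus_frontier[of "\<lambda>l. f l - g l" "cball 0 1"])
    show "(\<lambda>l. f l - g l) holomorphic_on interior (cball 0 1)"
      using hol assms(3) ball_subset_cball holomorphic_on_subset by (metis interior_cball order_trans)
    show "continuous_on (closure (cball 0 1)) (\<lambda>l. f l - g l)"
      using hol assms(3) by (simp add: holomorphic_on_imp_continuous_on holomorphic_on_subset)
  qed (use assms in auto)
  then show ?thesis by simp
qed

section \<open>Symmetries of the Szego kernel\<close>

lemma cn_holomorphic_on_imp_continuous_on: "f cn_holomorphic_on D \<Longrightarrow> continuous_on D f"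
  unfolding cn_holomorphic_on_def
  by (meson continuous_at_imp_continuous_on has_derivative_continuous)

lemma cn_holomorphic_on_const: "(\<lambda>z. a) cn_holomorphic_on D"
  unfolding cn_holomorphic_on_def by (auto intro!: exI[of _ "\<lambda>_. 0"])

lemma cn_holomorphic_on_add:
  assumes "f cn_holomorphic_on D" "g cn_holomorphic_on D"
  shows "(\<lambda>z. f z + g z) cn_holomorphic_on D"
  unfolding cn_holomorphic_on_def
proof
  fix z assume "z \<in> D"
  with assms obtain L L' where "(f has_derivative L) (at z)" "\<forall>c v. L (c *s v) = c * L v"
    "(g has_derivative L') (at z)" "\<forall>c v. L' (c *s v) = c * L' v"
    unfolding cn_holomorphic_on_def by meson
  then show "\<exists>L. ((\<lambda>z. f z + g z) has_derivative L) (at z) \<and> (\<forall>c v. L (c *s v) = c * L v)"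
    by (intro exI[of _ "\<lambda>v. L v + L' v"]) (auto intro: has_derivative_add simp: distrib_left)
qed

lemma cn_holomorphic_on_mult:
  assumes "f cn_holomorphic_on D" "g cn_holomorphic_on D"
  shows "(\<lambda>z. f z * g z) cn_holomorphic_on D"
  unfolding cn_holomorphic_on_def
proof
  fix z assume "z \<in> D"
  with assms obtain L L' where "(f has_derivative L) (at z)" "\<forall>c v. L (c *s v) = c * L v"
    "(g has_derivative L') (at z)" "\<forall>c v. L' (c *s v) = c * L' v"
    unfolding cn_holomorphic_on_def by meson
  then show "\<exists>L. ((\<lambda>z. f z * g z) has_derivative L) (at z) \<and> (\<forall>c v. L (c *s v) = c * L v)"
    by (intro exI[of _ "\<lambda>v. f z * L' v + L v * g z"] conjI has_derivative_mult)
      (auto simp: algebra_simps)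
qed

lemma cn_holomorphic_on_compose_matrix:
  assumes f: "f cn_holomorphic_on D" and k: "\<And>z. z \<in> D \<Longrightarrow> k *v z \<in> D"
  shows "(\<lambda>z. f (k *v z)) cn_holomorphic_on D"
  unfolding cn_holomorphic_on_def
proof
  fix z assume "z \<in> D"
  then obtain L where L: "(f has_derivative L) (at (k *v z))" "\<forall>c v. L (c *s v) = c * L v"
    using f k unfolding cn_holomorphic_on_def by meson
  have "((\<lambda>z. k *v z) has_derivative (\<lambda>z. k *v z)) (at z)"
    by (rule bounded_linear_imp_has_derivative) simp
  from has_derivative_compose[OF this L(1)] L(2)
  show "\<exists>L. ((\<lambda>z. f (k *v z)) has_derivative L) (at z) \<and> (\<forall>c v. L (c *s v) = c * L v)"
    by (intro exI[of _ "\<lambda>v. L (k *v v)"]) (auto simp: vector_scalar_commute)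
qed

lemma bounded_linear_scale_left: "bounded_linear (\<lambda>l. l *s (z :: complex ^ 'n))"
proof -
  have "linear (\<lambda>l. l *s z)"
    by (rule linearI) (auto simp: vec_eq_iff algebra_simps)
  then show ?thesis by (simp add: linear_conv_bounded_linear)
qed

lemma continuous_on_scale_vec:
  fixes g :: "'a::metric_space \<Rightarrow> complex ^ 'n"
  assumes "continuous_on S f" "continuous_on S g"
  shows "continuous_on S (\<lambda>x. f x *s g x)"
  unfolding continuous_on_vec_lambda vector_scalar_mult_def
  using assms by (auto intro!: continuous_intros)

lemma scaleR_eq_scale: "r *\<^sub>R (z :: complex ^ 'n) = of_real r *s z"
  by (simp add: vec_eq_iff scaleR_conv_of_real[where 'a=complex])

lemma mat_mult_vec: "mat c *v z = c *s (z :: complex ^ 'n)"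
  by (simp add: vec_eq_iff mat_def matrix_vector_mult_def if_distrib if_distribR cong: if_cong)

text \<open>Restriction to the complex line through \<open>z\<close> opens the way to one-variable
  theory: complex-linearity turns the derivative of the slice into multiplication by
  \<open>L z\<close>.\<close>

lemma cn_holomorphic_on_slice:
  assumes f: "f cn_holomorphic_on D" and S: "open S" and D: "\<And>l. l \<in> S \<Longrightarrow> l *s z \<in> D"
  shows "(\<lambda>l. f (l *s z)) holomorphic_on S"
proof -
  have "(\<lambda>l. f (l *s z)) field_differentiable at l" if l: "l \<in> S" for l
  proof -
    obtain L where L: "(f has_derivative L) (at (l *s z))" "\<forall>c v. L (c *s v) = c * L v"
      using f D[OF l] unfolding cn_holomorphic_on_def by meson
    have "((\<lambda>l. l *s z) has_derivative (\<lambda>l. l *s z)) (at l)"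
      by (rule bounded_linear_imp_has_derivative[OF bounded_linear_scale_left])
    from has_derivative_compose[OF this L(1)] L(2)
    have "((\<lambda>l. f (l *s z)) has_derivative (\<lambda>h. h * L z)) (at l)" by simp
    moreover have "(\<lambda>h. h * L z) = (*) (L z)" by (auto simp: mult.commute)
    ultimately show ?thesis
      unfolding field_differentiable_def has_field_derivative_def by metis
  qed
  then show ?thesis using S by (simp add: holomorphic_on_def field_differentiable_at_within)
qed

text \<open>The Hardy norm samples a function only at the points
  \<open>\<rho> *\<^sub>R \<zeta>\<close> with \<open>\<rho> < 1\<close>, all of them in
  \<open>D\<close>. Hence a kernel function may be exchanged for one that agrees with it on
  \<open>D\<close> and behaves better on the boundary.\<close>

lemma hardy_inner_cong:
  fixes f :: "complex ^ 'n \<Rightarrow> complex"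
  assumes "positive_radon_on B \<beta>" "\<And>\<rho> \<zeta>. 0 \<le> \<rho> \<Longrightarrow> \<rho> < 1 \<Longrightarrow> \<zeta> \<in> B \<Longrightarrow> \<rho> *\<^sub>R \<zeta> \<in> D"
    and "\<And>z. z \<in> D \<Longrightarrow> f z = f' z" "\<And>z. z \<in> D \<Longrightarrow> g z = g' z"
  shows "hardy_inner \<beta> f g = hardy_inner \<beta> f' g'"
proof -
  have "hardy_norm_sq \<beta> u = hardy_norm_sq \<beta> u'" if "\<And>z. z \<in> D \<Longrightarrow> u z = u' z"
    for u u' :: "complex ^ 'n \<Rightarrow> complex"
    unfolding hardy_norm_sq_def hardy_mean_def
    using assms(2) that space_positive_radon_on[OF assms(1)]
    by (intro SUP_cong Bochner_Integration.integral_cong refl) auto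
  then show ?thesis
    unfolding hardy_inner_def using assms(3,4) by (metis (no_types, lifting))
qed

text \<open>Since \<open>a + \<i> * b\<close> is \<open>\<i>\<close> times
  \<open>b - \<i> * a\<close>, swapping \<open>f\<close> and \<open>g\<close> exchanges the two
  norms in the imaginary part of the polarization formula, for arbitrary functions.\<close>

lemma cnj_hardy_inner: "cnj (hardy_inner \<beta> f g) = hardy_inner \<beta> g f"
proof -
  have 1: "cmod (a + \<i> * b) = cmod (b - \<i> * a)" for a b
  proof -
    have "a + \<i> * b = \<i> * (b - \<i> * a)" by (simp add: algebra_simps)
    then show ?thesis by (simp add: norm_mult)
  qed
  have "hardy_norm_sq \<beta> (\<lambda>z. g z + \<i> * f z) = hardy_norm_sq \<beta> (\<lambda>z. f z - \<i> * g z)"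
    "hardy_norm_sq \<beta> (\<lambda>z. f z + \<i> * g z) = hardy_norm_sq \<beta> (\<lambda>z. g z - \<i> * f z)"
    unfolding hardy_norm_sq_def hardy_mean_def 1 by auto
  moreover have "hardy_norm_sq \<beta> (\<lambda>z. f z - g z) = hardy_norm_sq \<beta> (\<lambda>z. g z - f z)"
    unfolding hardy_norm_sq_def hardy_mean_def by (simp add: norm_minus_commute)
  ultimately show ?thesis
    by (simp add: hardy_inner_def complex_eq_iff add.commute minus_divide_left)
qed

lemma borel_measurable_cnj [measurable]:
  "f \<in> borel_measurable M \<Longrightarrow> (\<lambda>x. cnj (f x)) \<in> borel_measurable M"
  using measurable_compose[OF _ borel_measurable_continuous_onI[OF continuous_on_cnj[OF continuous_on_id]]] .

text \<open>The right-hand side has the shape of \<open>hardy_inner\<close>, with integrals in place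
  of Hardy norms; this is the bridge from the polarized definition to an \<open>L\<^sup>2\<close>
  pairing.\<close>

lemma integral_polarization:
  fixes f g :: "'a \<Rightarrow> complex"
  assumes "integrable M (\<lambda>x. (cmod (f x))\<^sup>2)" "integrable M (\<lambda>x. (cmod (g x))\<^sup>2)"
    and "f \<in> borel_measurable M" "g \<in> borel_measurable M"
  shows "(\<integral>x. f x * cnj (g x) \<partial>M) =
    Complex (((\<integral>x. (cmod (f x + g x))\<^sup>2 \<partial>M) - (\<integral>x. (cmod (f x - g x))\<^sup>2 \<partial>M)) / 4)
      (((\<integral>x. (cmod (f x + \<i> * g x))\<^sup>2 \<partial>M) - (\<integral>x. (cmod (f x - \<i> * g x))\<^sup>2 \<partial>M)) / 4)"
proof -
  note [measurable] = assms(3,4)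
  have sq: "(cmod (a + c * b))\<^sup>2 \<le> 2 * (cmod a)\<^sup>2 + 2 * (cmod b)\<^sup>2" if "cmod c = 1" for a b c
  proof -
    have "(cmod (a + c * b))\<^sup>2 \<le> (cmod a + cmod b)\<^sup>2"
      using norm_triangle_ineq[of a "c * b"] that by (intro power_mono) (auto simp: norm_mult)
    then show ?thesis using sum_squares_bound[of "cmod a" "cmod b"] by (simp add: power2_sum)
  qed
  have int: "integrable M (\<lambda>x. (cmod (f x + c * g x))\<^sup>2)" if "cmod c = 1" for c
    by (rule Bochner_Integration.integrable_bound[OF Bochner_Integration.integrable_add[OF integrable_mult_right[OF assms(1), of 2]
        integrable_mult_right[OF assms(2), of 2]]])
      (use sq[OF that] in auto)
  have prod: "integrable M (\<lambda>x. f x * cnj (g x))"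
  proof (rule Bochner_Integration.integrable_bound[OF Bochner_Integration.integrable_add[OF assms(1,2)]])
    have "cmod a * cmod b \<le> (cmod a)\<^sup>2 + (cmod b)\<^sup>2" for a b
      using sum_squares_bound[of "cmod a" "cmod b"] mult_nonneg_nonneg[of "cmod a" "cmod b"]
      by (simp del: mult_nonneg_nonneg)
    then show "AE x in M. norm (f x * cnj (g x)) \<le> norm ((cmod (f x))\<^sup>2 + (cmod (g x))\<^sup>2)"
      by (auto simp: norm_mult)
  qed simp
  have id: "(cmod (a + b))\<^sup>2 - (cmod (a - b))\<^sup>2 = 4 * Re (a * cnj b)" for a b
    unfolding cmod_power2 by (simp add: power2_eq_square algebra_simps)
  \<comment> \<open>One computation serves both components: \<open>c = 1\<close> gives the real part
    and \<open>c = \<i>\<close> the imaginary part, because \<open>Re (a * cnj (\<i> * b))\<close>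
    is \<open>Im (a * cnj b)\<close>.\<close>
  have diff: "(\<integral>x. (cmod (f x + c * g x))\<^sup>2 \<partial>M) - (\<integral>x. (cmod (f x + (- c) * g x))\<^sup>2 \<partial>M) =
      4 * (\<integral>x. Re (f x * cnj (c * g x)) \<partial>M)" if "cmod c = 1" for c
  proof -
    have "(\<integral>x. (cmod (f x + c * g x))\<^sup>2 \<partial>M) - (\<integral>x. (cmod (f x + (- c) * g x))\<^sup>2 \<partial>M) =
        (\<integral>x. (cmod (f x + c * g x))\<^sup>2 - (cmod (f x + (- c) * g x))\<^sup>2 \<partial>M)"
      using int[of c] int[of "- c"] that by (intro Bochner_Integration.integral_diff[symmetric]) auto
    also have "\<dots> = (\<integral>x. 4 * Re (f x * cnj (c * g x)) \<partial>M)"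
      using id[of "f _" "c * g _"] by (simp only: mult_minus_left add_uminus_conv_diff)
    finally show ?thesis by (simp only: integral_mult_right_zero)
  qed
  have re: "Re (a * cnj (\<i> * b)) = Im (a * cnj b)" for a b
    by simp
  have "(\<integral>x. (cmod (f x + g x))\<^sup>2 \<partial>M) - (\<integral>x. (cmod (f x - g x))\<^sup>2 \<partial>M) = 4 * (\<integral>x. Re (f x * cnj (g x)) \<partial>M)"
    using diff[of 1] by (simp only: norm_one mult_1 mult_minus_left add_uminus_conv_diff simp_thms)
  moreover have "(\<integral>x. (cmod (f x + \<i> * g x))\<^sup>2 \<partial>M) - (\<integral>x. (cmod (f x - \<i> * g x))\<^sup>2 \<partial>M) =
      4 * (\<integral>x. Im (f x * cnj (g x)) \<partial>M)"
    using diff[of \<i>] by (simp only: norm_ii re mult_minus_left add_uminus_conv_diff simp_thms)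
  moreover have "Re (\<integral>x. f x * cnj (g x) \<partial>M) = (\<integral>x. Re (f x * cnj (g x)) \<partial>M)"
    "Im (\<integral>x. f x * cnj (g x) \<partial>M) = (\<integral>x. Im (f x * cnj (g x)) \<partial>M)"
    by (rule integral_Re[OF prod, symmetric], rule integral_Im[OF prod, symmetric])
  ultimately show ?thesis
    by (simp only: complex_eq_iff complex.sel) simp
qed

locale szego_domain =
  fixes D B :: "(complex ^ 'n) set" and \<beta> :: "(complex ^ 'n) measure"
    and C :: "complex ^ 'n \<Rightarrow> complex ^ 'n \<Rightarrow> complex"
  assumes domain: "normalized_domain D B"
    and invariant: "invariant_probability D B \<beta>"
    and szego: "is_szego_kernel D \<beta> C"
begin

section \<open>Geometry of the domain and of its Silov boundary\<close>

lemma D: "D \<noteq> {}" "open D" "bounded D" "convex D" "circular D"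
  using domain by (auto simp: normalized_domain_def bounded_symmetric_domain_def)

lemma silov: "is_silov_boundary D B"
  using domain by (auto simp: normalized_domain_def)

lemma radon: "positive_radon_on B \<beta>"
  using invariant by (simp add: invariant_probability_def)

sublocale prob_space \<beta>
  using invariant by (simp add: invariant_probability_def)

lemma space_beta [simp]: "space \<beta> = B"
  using radon by (rule space_positive_radon_on)

lemma compact_closure_D: "compact (closure D)"
  using D by (simp add: compact_closure)

lemma B_subset: "B \<subseteq> closure D" "B \<subseteq> frontier D"
  using silov by (auto simp: is_silov_boundary_def frontier_def)

lemma compact_B: "compact B"
  using silov B_subset compact_closure_D by (metis closed_Int_compact inf.absorb1 is_silov_boundary_def)

lemma norm_B: "\<zeta> \<in> B \<Longrightarrow> norm \<zeta> = 1"
  using domain by (auto simp: normalized_domain_def)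

text \<open>Circularity supplies \<open>- z\<close>, convexity the midpoint of \<open>z\<close> and
  \<open>- z\<close>.\<close>

lemma zero_in_D: "0 \<in> D"
proof -
  obtain z where z: "z \<in> D" using D by auto
  have "- z \<in> D"
    using bspec[OF bspec[OF D(5)[unfolded circular_def] z], of "- 1"] by simp
  then have "(1/2) *\<^sub>R z + (1/2) *\<^sub>R (- z) \<in> D"
    using D(4) z by (intro convexD) auto
  then show ?thesis by simp
qed

lemma scaleR_in_D:
  assumes "\<zeta> \<in> closure D" "0 \<le> \<rho>" "\<rho> < 1"
  shows "\<rho> *\<^sub>R \<zeta> \<in> D"
  using mem_interior_closure_convex_shrink[of D 0 \<zeta> "1 - \<rho>"] assms D zero_in_D
  by (simp add: interior_open algebra_simps)

lemma rotate_in_D: "z \<in> D \<Longrightarrow> cmod c = 1 \<Longrightarrow> c *s z \<in> D"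
  using D(5) by (auto simp: circular_def)

text \<open>Polar form of \<open>l\<close>: the modulus contracts by convexity, the phase rotates by
  circularity.\<close>

lemma scale_in_D:
  assumes "\<zeta> \<in> closure D" "cmod l < 1"
  shows "l *s \<zeta> \<in> D"
proof -
  have "l = cis (Arg l) * of_real (cmod l)" 
    by (metis mult.commute rcis_cmod_Arg rcis_def)
  then have "l *s \<zeta> = cis (Arg l) *s (cmod l *\<^sub>R \<zeta>)"
    by (metis scaleR_eq_scale vector_smult_assoc)
  then show ?thesis using rotate_in_D[OF scaleR_in_D[OF assms(1), of "cmod l"], of "cis (Arg l)"] assms by simp
qed

lemma scale_in_D_le:
  assumes "z \<in> D" "cmod l \<le> 1"
  shows "l *s z \<in> D"
  using assms rotate_in_D[of z l] scale_in_D[OF subsetD[OF closure_subset assms(1)], of l] by (cases "cmod l = 1") auto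

lemma automorphism_inverse:
  assumes "k \<in> linear_automorphisms D"
  obtains k' where "k' \<in> linear_automorphisms D" "\<And>z. k' *v (k *v z) = z" "\<And>z. k *v (k' *v z) = z"
proof -
  obtain k' where k': "k ** k' = mat 1" "k' ** k = mat 1"
    using assms by (auto simp: linear_automorphisms_def invertible_def)
  then have inv: "k' *v (k *v z) = z" "k *v (k' *v z) = z" for z
    by (auto simp: matrix_vector_mul_assoc)
  have "(\<lambda>z. k' *v z) ` D = (\<lambda>z. k' *v z) ` ((\<lambda>z. k *v z) ` D)"
    using assms by (simp add: linear_automorphisms_def)
  also have "\<dots> = D" by (simp add: image_image inv)
  finally have "k' \<in> linear_automorphisms D"
    using k' by (auto simp: linear_automorphisms_def invertible_def)
  then show ?thesis using inv that by blast
qed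

lemma automorphism_in_D: "k \<in> linear_automorphisms D \<Longrightarrow> z \<in> D \<Longrightarrow> k *v z \<in> D"
  by (auto simp: linear_automorphisms_def)

lemma rotation_automorphism:
  assumes "cmod c = 1"
  shows "mat c \<in> linear_automorphisms D"
proof -
  have cc: "c * cnj c = 1"
    using complex_norm_square[of c] assms by (simp only: power_one of_real_1)
  then have cc': "cnj c * c = 1"
    by (subst mult.commute)
  have mm: "mat a ** mat b = (mat (a * b) :: complex ^ 'n ^ 'n)" for a b
    by (simp add: matrix_eq mat_mult_vec vector_smult_assoc flip: matrix_vector_mul_assoc)
  have "(\<lambda>z. mat c *v z) ` D = D"
  proof (intro equalityI subsetI)
    fix z assume "z \<in> D"
    then have "cnj c *s z \<in> D" "z = mat c *v (cnj c *s z)"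
      using rotate_in_D[of z "cnj c"] assms by (auto simp: mat_mult_vec vector_smult_assoc cc cc')
    then show "z \<in> (\<lambda>z. mat c *v z) ` D" by blast
  qed (use assms rotate_in_D in \<open>auto simp: mat_mult_vec\<close>)
  moreover have "invertible (mat c :: complex ^ 'n ^ 'n)"
    unfolding invertible_def using mm cc cc' by (intro exI[of _ "mat (cnj c)"]) auto
  ultimately show ?thesis by (simp add: linear_automorphisms_def)
qed

lemma automorphism_closure:
  assumes "k \<in> linear_automorphisms D"
  shows "(\<lambda>z. k *v z) ` closure D = closure D"
proof -
  obtain k' where "\<And>z. k' *v (k *v z) = z" using automorphism_inverse[OF assms] by metis
  then have "inj (\<lambda>z. k *v z)" by (metis injI)
  then have "closure ((\<lambda>z. k *v z) ` D) = (\<lambda>z. k *v z) ` closure D"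
    by (intro closure_injective_linear_image[symmetric]) (simp_all add: linear_conv_bounded_linear)
  then show ?thesis using assms by (simp add: linear_automorphisms_def)
qed

text \<open>Composition with \<open>k\<close> preserves the functions that are holomorphic on
  \<open>D\<close> and continuous on its closure, and also their suprema over \<open>D\<close>. So
  the image of \<open>B\<close> is again a closed determining subset of the frontier, and minimality
  of the Silov boundary applies.\<close>

lemma B_subset_automorphism_image:
  assumes k: "k \<in> linear_automorphisms D"
  shows "B \<subseteq> (\<lambda>z. k *v z) ` B"
proof -
  obtain k' where k': "\<And>z. k' *v (k *v z) = z" using automorphism_inverse[OF k] by metis
  then have "inj (\<lambda>z. k *v z)" by (metis injI)
  then have "(\<lambda>z. k *v z) ` frontier D = frontier D"
    using k D automorphism_closure[OF k]
    by (simp add: frontier_def interior_open image_set_diff linear_automorphisms_def)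
  then have "(\<lambda>z. k *v z) ` B \<subseteq> frontier D" using B_subset by blast
  moreover have "closed ((\<lambda>z. k *v z) ` B)"
    by (intro compact_imp_closed compact_continuous_image compact_B linear_continuous_on) simp
  moreover have "determines_sup D ((\<lambda>z. k *v z) ` B)"
    unfolding determines_sup_def
  proof (intro allI impI; elim conjE)
    fix f assume f: "f cn_holomorphic_on D" "continuous_on (closure D) f"
    have "(\<lambda>z. f (k *v z)) cn_holomorphic_on D"
      using f(1) automorphism_in_D[OF k] by (rule cn_holomorphic_on_compose_matrix)
    moreover have "continuous_on (closure D) (\<lambda>z. f (k *v z))"
      by (rule continuous_on_compose2[OF f(2)])
        (use automorphism_closure[OF k] in \<open>auto intro!: linear_continuous_on\<close>)
    ultimately obtain \<zeta> where \<zeta>: "\<zeta> \<in> B" "\<forall>\<xi>\<in>B. cmod (f (k *v \<xi>)) \<le> cmod (f (k *v \<zeta>))"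
      "(SUP z\<in>D. cmod (f (k *v z))) = cmod (f (k *v \<zeta>))"
      using silov unfolding is_silov_boundary_def determines_sup_def by meson
    have "(SUP z\<in>D. cmod (f (k *v z))) = (SUP z\<in>(\<lambda>z. k *v z) ` D. cmod (f z))"
      by (simp add: image_image)
    also have "\<dots> = (SUP z\<in>D. cmod (f z))" using k by (simp add: linear_automorphisms_def)
    finally have eq: "(SUP z\<in>D. cmod (f (k *v z))) = (SUP z\<in>D. cmod (f z))" .
    show "\<exists>\<zeta>\<in>(\<lambda>z. k *v z) ` B. (\<forall>\<xi>\<in>(\<lambda>z. k *v z) ` B. cmod (f \<xi>) \<le> cmod (f \<zeta>)) \<and>
        (SUP z\<in>D. cmod (f z)) = cmod (f \<zeta>)"
      using \<zeta> unfolding eq by (intro bexI[of _ "k *v \<zeta>"] conjI ballI) auto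
  qed
  ultimately show ?thesis using silov by (simp add: is_silov_boundary_def)
qed

lemma automorphism_in_B:
  assumes k: "k \<in> linear_automorphisms D" and "\<zeta> \<in> B"
  shows "k *v \<zeta> \<in> B"
proof -
  obtain k' where k': "k' \<in> linear_automorphisms D" "\<And>z. k *v (k' *v z) = z"
    using automorphism_inverse[OF k] by metis
  \<comment> \<open>The inclusion is used for the inverse \<open>k'\<close>: writing
    \<open>\<zeta>\<close> as \<open>k' *v \<xi>\<close> identifies \<open>k *v \<zeta>\<close> with
    \<open>\<xi>\<close>.\<close>
  then obtain \<xi> where "\<xi> \<in> B" "\<zeta> = k' *v \<xi>" using B_subset_automorphism_image assms(2) by blast
  then show ?thesis using k' by simp
qed

lemma rotate_in_B: "\<zeta> \<in> B \<Longrightarrow> cmod c = 1 \<Longrightarrow> c *s \<zeta> \<in> B"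
  using automorphism_in_B[OF rotation_automorphism, of c \<zeta>] by (simp add: mat_mult_vec)

section \<open>Invariance of the Hardy space and of the Szego kernel under linear
  automorphisms\<close>

lemma integral_automorphism:
  fixes h :: "complex ^ 'n \<Rightarrow> 'b::{banach,second_countable_topology}"
  assumes k: "k \<in> linear_automorphisms D" and h: "h \<in> borel_measurable \<beta>"
  shows "(\<integral>\<zeta>. h (k *v \<zeta>) \<partial>\<beta>) = (\<integral>\<zeta>. h \<zeta> \<partial>\<beta>)"
proof -
  have "(\<lambda>\<zeta>. k *v \<zeta>) \<in> borel_measurable \<beta>"
    by (intro positive_radon_on_continuous_measurable[OF radon] linear_continuous_on) simp
  then have "(\<lambda>\<zeta>. k *v \<zeta>) \<in> \<beta> \<rightarrow>\<^sub>M restrict_space borel B"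
    by (intro measurable_restrict_space2) (use automorphism_in_B[OF k] in auto)
  then have "(\<lambda>\<zeta>. k *v \<zeta>) \<in> \<beta> \<rightarrow>\<^sub>M \<beta>"
    using radon unfolding positive_radon_on_def by (metis measurable_cong_sets)
  from integral_distr[OF this h] show ?thesis
    using invariant k by (simp add: invariant_probability_def)
qed

lemma hardy_mean_automorphism:
  assumes k: "k \<in> linear_automorphisms D" and f: "continuous_on D f" and "0 \<le> \<rho>" "\<rho> < 1"
  shows "hardy_mean \<beta> (\<lambda>z. f (k *v z)) \<rho> = hardy_mean \<beta> f \<rho>"
proof -
  have "continuous_on B (\<lambda>\<zeta>. f (\<rho> *\<^sub>R \<zeta>))"
    by (rule continuous_on_compose2[OF f])
      (use scaleR_in_D assms B_subset in \<open>auto intro!: continuous_intros\<close>)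
  then have "(\<lambda>\<zeta>. (cmod (f (\<rho> *\<^sub>R \<zeta>)))\<^sup>2) \<in> borel_measurable \<beta>"
    by (intro positive_radon_on_continuous_measurable[OF radon] continuous_intros)
  from integral_automorphism[OF k this] show ?thesis
    unfolding hardy_mean_def by (simp add: scaleR_eq_scale vector_scalar_commute)
qed

lemma hardy_space_automorphism:
  assumes k: "k \<in> linear_automorphisms D" and f: "f \<in> hardy_space D \<beta>"
  shows "(\<lambda>z. f (k *v z)) \<in> hardy_space D \<beta>"
proof -
  have f': "f cn_holomorphic_on D" using f by (simp add: hardy_space_def)
  have "hardy_mean \<beta> (\<lambda>z. f (k *v z)) ` {0..<1} = hardy_mean \<beta> f ` {0..<1}"
    using hardy_mean_automorphism[OF k cn_holomorphic_on_imp_continuous_on[OF f']] by auto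
  then show ?thesis
    using f cn_holomorphic_on_compose_matrix[OF f' automorphism_in_D[OF k]] by (simp add: hardy_space_def)
qed

lemma hardy_inner_automorphism:
  assumes k: "k \<in> linear_automorphisms D" and "continuous_on D f" "continuous_on D g"
  shows "hardy_inner \<beta> (\<lambda>z. f (k *v z)) (\<lambda>z. g (k *v z)) = hardy_inner \<beta> f g"
proof -
  have "hardy_norm_sq \<beta> (\<lambda>z. u (k *v z)) = hardy_norm_sq \<beta> u" if "continuous_on D u" for u
    unfolding hardy_norm_sq_def by (intro SUP_cong refl hardy_mean_automorphism[OF k that]) auto
  from this[of "\<lambda>z. f z + g z"] this[of "\<lambda>z. f z - g z"] this[of "\<lambda>z. f z + \<i> * g z"]
    this[of "\<lambda>z. f z - \<i> * g z"]
  show ?thesis unfolding hardy_inner_def using assms by (simp add: continuous_intros)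
qed

lemma kernel_in_hardy: "w \<in> D \<Longrightarrow> (\<lambda>z. C z w) \<in> hardy_space D \<beta>"
  using szego by (simp add: is_szego_kernel_def)

lemma kernel_reproducing:
  "w \<in> D \<Longrightarrow> f \<in> hardy_space D \<beta> \<Longrightarrow> hardy_inner \<beta> f (\<lambda>z. C z w) = f w"
  using szego by (simp add: is_szego_kernel_def)

lemma kernel_holomorphic: "w \<in> D \<Longrightarrow> (\<lambda>z. C z w) cn_holomorphic_on D"
  using kernel_in_hardy by (simp add: hardy_space_def)

lemma kernel_hermitian: "z \<in> D \<Longrightarrow> w \<in> D \<Longrightarrow> cnj (C z w) = C w z"
  by (metis cnj_hardy_inner kernel_in_hardy kernel_reproducing)

text \<open>Composition with \<open>k\<close> preserves Hardy inner products, so the pulled back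
  kernel function \<open>g\<close> also reproduces values at \<open>w\<close>, and reproducing
  functions are unique.\<close>

lemma kernel_automorphism:
  assumes k: "k \<in> linear_automorphisms D" and z: "z \<in> D" and w: "w \<in> D"
  shows "C (k *v z) (k *v w) = C z w"
proof -
  obtain k' where k': "k' \<in> linear_automorphisms D" "\<And>z. k' *v (k *v z) = z"
    using automorphism_inverse[OF k] by metis
  have kw: "k *v w \<in> D" using automorphism_in_D[OF k w] .
  define g where "g = (\<lambda>z. C (k *v z) (k *v w))"
  have g: "g \<in> hardy_space D \<beta>"
    unfolding g_def by (rule hardy_space_automorphism[OF k kernel_in_hardy[OF kw]])
  have "hardy_inner \<beta> f g = f w" if f: "f \<in> hardy_space D \<beta>" for f
  proof -
    define f' where "f' = (\<lambda>z. f (k' *v z))"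
    have f': "f' \<in> hardy_space D \<beta>"
      unfolding f'_def by (rule hardy_space_automorphism[OF k'(1) f])
    have "hardy_inner \<beta> f g = hardy_inner \<beta> (\<lambda>z. f' (k *v z)) g" by (simp add: f'_def k')
    also have "\<dots> = hardy_inner \<beta> f' (\<lambda>z. C z (k *v w))"
      unfolding g_def using f' kernel_in_hardy[OF kw]
      by (intro hardy_inner_automorphism[OF k])
        (auto simp: hardy_space_def intro: cn_holomorphic_on_imp_continuous_on)
    also have "\<dots> = f w" using kernel_reproducing[OF kw f'] by (simp add: f'_def k')
    finally show ?thesis .
  qed
  \<comment> \<open>Uniqueness: \<open>g\<close> and the kernel function at \<open>z\<close> are
    tested against each other, each reproducing the other, and \<open>cnj_hardy_inner\<close>
    compares the two values. This bypasses sesquilinearity of \<open>hardy_inner\<close>, which is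
    not at hand.\<close>
  from this[OF kernel_in_hardy[OF z]] have "hardy_inner \<beta> (\<lambda>u. C u z) g = C w z" .
  then have "hardy_inner \<beta> g (\<lambda>u. C u z) = C z w"
    using kernel_hermitian[OF w z] cnj_hardy_inner by metis
  then show ?thesis using kernel_reproducing[OF z g] by (simp add: g_def)
qed

end

section \<open>The Poisson-Szego kernel as an approximate identity\<close>

lemma cn_holomorphic_on_diff:
  assumes "f cn_holomorphic_on D" "g cn_holomorphic_on D"
  shows "(\<lambda>z. f z - g z) cn_holomorphic_on D"
  using cn_holomorphic_on_add[OF assms(1) cn_holomorphic_on_mult[OF cn_holomorphic_on_const[of "-1"] assms(2)]]
  by simp

lemma cn_holomorphic_on_cong:
  assumes "f cn_holomorphic_on D" "open D" "\<And>z. z \<in> D \<Longrightarrow> f z = g z"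
  shows "g cn_holomorphic_on D"
  unfolding cn_holomorphic_on_def
proof
  fix z assume z: "z \<in> D"
  then obtain L where "(f has_derivative L) (at z)" "\<forall>c v. L (c *s v) = c * L v"
    using assms(1) unfolding cn_holomorphic_on_def by meson
  then show "\<exists>L. (g has_derivative L) (at z) \<and> (\<forall>c v. L (c *s v) = c * L v)"
    using has_derivative_transform_within_open[OF _ assms(2) z] assms(3) by blast
qed

lemma cn_holomorphic_on_hermitian_product: "(\<lambda>z. \<Sum>i\<in>UNIV. z $ i * cnj (\<zeta> $ i)) cn_holomorphic_on D"
proof -
  have "bounded_linear (\<lambda>z. \<Sum>i\<in>UNIV. z $ i * cnj (\<zeta> $ i))"
    by (intro bounded_linear_sum bounded_linear_mult_const bounded_linear_vec_nth)
  then show ?thesis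
    unfolding cn_holomorphic_on_def
    by (auto intro!: exI[of _ "\<lambda>z. \<Sum>i\<in>UNIV. z $ i * cnj (\<zeta> $ i)"] bounded_linear_imp_has_derivative
        simp: sum_distrib_left mult.assoc)
qed

lemma Re_hermitian_product: "Re (\<Sum>i\<in>UNIV. z $ i * cnj (\<zeta> $ i)) = z \<bullet> (\<zeta> :: complex ^ 'n)"
  by (simp add: inner_vec_def inner_complex_def)

context szego_domain
begin

section \<open>Moving scalars between the two arguments of the kernel\<close>

lemma scale_B_in_closure:
  assumes "\<zeta> \<in> B" "cmod l \<le> 1"
  shows "l *s \<zeta> \<in> closure D"
proof (cases "cmod l = 1")
  case True
  then show ?thesis using rotate_in_B assms B_subset by blast
next
  case False
  then show ?thesis using scale_in_D[of \<zeta> l] assms B_subset closure_subset[of D] by auto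
qed

lemma scaleR_in_closure: "\<zeta> \<in> closure D \<Longrightarrow> 0 \<le> \<rho> \<Longrightarrow> \<rho> \<le> 1 \<Longrightarrow> \<rho> *\<^sub>R \<zeta> \<in> closure D"
  using scaleR_in_D[of \<zeta> \<rho>] closure_subset[of D] by (cases "\<rho> = 1") auto

text \<open>Both sides are holomorphic in \<open>l\<close> near the closed disc, the right one
  because \<open>C\<close> is antiholomorphic in its second argument. They agree for
  \<open>cmod l = 1\<close> by rotation invariance of the kernel, hence on the disc.\<close>

lemma kernel_homogeneous:
  assumes z: "z \<in> D" and w: "w \<in> D" and l: "cmod l \<le> 1"
  shows "C (l *s z) w = C z (cnj l *s w)"
proof -
  define S where "S = {l. l *s z \<in> D} \<inter> {l. cnj l *s w \<in> D}"
  have "continuous_on UNIV (\<lambda>l. l *s z)" "continuous_on UNIV (\<lambda>l. l *s w)"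
    by (simp_all add: linear_continuous_on bounded_linear_scale_left)
  moreover from this(2) have "continuous_on UNIV (\<lambda>l. cnj l *s w)"
    by (rule continuous_on_compose2) (auto intro!: continuous_intros)
  ultimately have op: "open {l. l *s z \<in> D}" "open {l. l *s w \<in> D}" "open {l. cnj l *s w \<in> D}"
    using D(2) by (simp_all add: continuous_on_open_vimage[OF open_UNIV] vimage_def)
  then have S: "open S" by (simp add: S_def open_Int)
  have "cball 0 1 \<subseteq> S"
    using scale_in_D_le[OF z] scale_in_D_le[OF w] by (auto simp: S_def)
  have f: "(\<lambda>l. C (l *s z) w) holomorphic_on S"
    by (rule cn_holomorphic_on_slice[OF kernel_holomorphic[OF w] S]) (simp add: S_def)
  \<comment> \<open>Hermitian symmetry presents the right-hand side as the conjugate of a function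
    holomorphic in \<open>cnj l\<close>, and such a conjugate is holomorphic in
    \<open>l\<close>.\<close>
  have "(\<lambda>l. C (l *s w) z) holomorphic_on {l. l *s w \<in> D}"
    by (rule cn_holomorphic_on_slice[OF kernel_holomorphic[OF z] op(2)]) simp
  then have "(\<lambda>l. C (l *s w) z) holomorphic_on cnj ` S"
    by (rule holomorphic_on_subset) (auto simp: S_def)
  from holomorphic_on_compose_cnj_cnj[OF this S]
  have "(\<lambda>l. cnj (C (cnj l *s w) z)) holomorphic_on S" by (simp add: comp_def)
  moreover have "cnj (C (cnj l *s w) z) = C z (cnj l *s w)" if "l \<in> S" for l
    using kernel_hermitian[of "cnj l *s w" z] z that by (simp add: S_def)
  ultimately have g: "(\<lambda>l. C z (cnj l *s w)) holomorphic_on S"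
    using holomorphic_cong by (metis (no_types, lifting))
  show ?thesis
  proof (rule holomorphic_eq_on_disc[OF f g \<open>cball 0 1 \<subseteq> S\<close> _ l])
    fix l :: complex assume l: "cmod l = 1"
    then have "l * cnj l = 1" using complex_norm_square[of l] by (simp only: power_one of_real_1)
    then have "w = l *s (cnj l *s w)" by (simp add: vector_smult_assoc)
    then show "C (l *s z) w = C z (cnj l *s w)"
      using kernel_automorphism[OF rotation_automorphism[OF l] z rotate_in_D[OF w, of "cnj l"]] l
      by (simp add: mat_mult_vec)
  qed
qed

lemma kernel_continuous: "continuous_on (D \<times> closure D) (\<lambda>(z, w). C z w)"
proof -
  obtain U where U: "open U" "D \<times> closure D \<subseteq> U" "C sesqui_holomorphic_on U"
    using szego by (auto simp: is_szego_kernel_def)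
  then have "continuous_on U (\<lambda>(z, w). C z w)"
    unfolding sesqui_holomorphic_on_def
    by (meson continuous_at_imp_continuous_on has_derivative_continuous)
  then show ?thesis using U continuous_on_subset by blast
qed

text \<open>Homogeneity moves a factor \<open>sqrt \<rho>\<close> from the first argument to the
  second. It is available for second arguments inside \<open>D\<close>, so \<open>\<zeta>\<close> is
  first shrunk by \<open>r < 1\<close>, and then \<open>r\<close> tends to \<open>1\<close> along
  the continuous extension of the kernel.\<close>

lemma kernel_boundary:
  assumes \<xi>: "\<xi> \<in> closure D" and \<zeta>: "\<zeta> \<in> closure D" and \<rho>: "0 \<le> \<rho>" "\<rho> < 1"
  shows "C (\<rho> *\<^sub>R \<xi>) \<zeta> = C (sqrt \<rho> *\<^sub>R \<xi>) (sqrt \<rho> *\<^sub>R \<zeta>)"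
proof -
  define s where "s = sqrt \<rho>"
  have s: "0 \<le> s" "s < 1" "\<rho> = s * s" using \<rho> by (auto simp: s_def)
  define g where "g = (\<lambda>r. C (\<rho> *\<^sub>R \<xi>) (r *\<^sub>R \<zeta>) - C (s *\<^sub>R \<xi>) ((r * s) *\<^sub>R \<zeta>))"
  have "g 1 = 0"
  proof (rule continuous_constant_on_closure[where f=g and x=1 and S="{0..<1}"])
    have "continuous_on {0..1} (\<lambda>r. C (a *\<^sub>R \<xi>) ((r * b) *\<^sub>R \<zeta>))"
      if "0 \<le> a" "a < 1" "0 \<le> b" "b \<le> 1" for a b
    proof -
      have "continuous_on {0..1} (\<lambda>r. case (a *\<^sub>R \<xi>, (r * b) *\<^sub>R \<zeta>) of (z, w) \<Rightarrow> C z w)"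
        by (rule continuous_on_compose2[OF kernel_continuous])
          (use that \<xi> \<zeta> scaleR_in_D in \<open>auto intro!: continuous_intros scaleR_in_closure simp: mult_le_one\<close>)
      then show ?thesis by simp
    qed
    from this[of \<rho> 1] this[of s s] show "continuous_on (closure {0..<1}) g"
      unfolding g_def using \<rho> s by (auto intro!: continuous_intros)
    show "g r = 0" if "r \<in> {0..<1}" for r
      using kernel_homogeneous[of "s *\<^sub>R \<xi>" "r *\<^sub>R \<zeta>" "of_real s"] that s scaleR_in_D \<xi> \<zeta>
      by (simp add: g_def mult.commute flip: scaleR_eq_scale)
  qed simp
  then show ?thesis by (simp add: g_def s_def)
qed

text \<open>By \<open>kernel_boundary\<close> both sides are moduli of kernel values at the interior
  points \<open>sqrt \<rho> *\<^sub>R \<xi>\<close> and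
  \<open>sqrt \<rho> *\<^sub>R \<zeta>\<close>, taken in opposite order; there Hermitian symmetry
  holds.\<close>

lemma kernel_boundary_symmetric:
  assumes \<xi>: "\<xi> \<in> closure D" and \<zeta>: "\<zeta> \<in> closure D" and \<rho>: "0 \<le> \<rho>" "\<rho> < 1"
  shows "cmod (C (\<rho> *\<^sub>R \<xi>) \<zeta>) = cmod (C (\<rho> *\<^sub>R \<zeta>) \<xi>)"
proof -
  have "sqrt \<rho> *\<^sub>R \<xi> \<in> D" "sqrt \<rho> *\<^sub>R \<zeta> \<in> D" using scaleR_in_D assms by auto
  then show ?thesis
    using kernel_boundary[OF assms] kernel_boundary[OF \<zeta> \<xi> \<rho>] kernel_hermitian complex_mod_cnj by metis
qed

text \<open>The means increase up to the boundary: by rotation invariance of \<open>\<beta>\<close> they are the squared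
  norms of the \<open>L\<^sup>2(\<beta>)\<close>-valued holomorphic function \<open>l \<mapsto> u (l *s \<cdot>)\<close> of one variable,
  which satisfies the maximum principle.\<close>

lemma hardy_mean_le:
  assumes u: "u cn_holomorphic_on D" "continuous_on (closure D) u" and \<rho>: "0 \<le> \<rho>" "\<rho> < 1"
  shows "hardy_mean \<beta> u \<rho> \<le> (\<integral>\<zeta>. (cmod (u \<zeta>))\<^sup>2 \<partial>\<beta>)"
proof -
  obtain K where K: "\<And>z. z \<in> closure D \<Longrightarrow> cmod (u z) \<le> K"
    using compact_imp_bounded[OF compact_continuous_image[OF u(2) compact_closure_D]] by (auto simp: bounded_iff)
  have cont: "continuous_on (cball 0 1 \<times> B) (\<lambda>(l, \<zeta>). u (l *s \<zeta>))"
    unfolding case_prod_unfold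
    by (rule continuous_on_compose2[OF u(2)])
      (auto intro!: continuous_on_scale_vec continuous_intros scale_B_in_closure)
  have contl: "continuous_on B (\<lambda>\<zeta>. u (l *s \<zeta>))" if "cmod l \<le> 1" for l
    using continuous_on_slice_right[OF cont, of l] that by simp
  note contr = contl[of "of_real \<rho>"]
  \<comment> \<open>\<open>H l\<close> is the \<open>L\<^sup>2\<close> pairing of the dilates of
    \<open>u\<close> by \<open>l\<close> and by \<open>\<rho>\<close>, with value \<open>m\<close>
    at \<open>l = \<rho>\<close>. For unimodular \<open>l\<close> its modulus is at most
    \<open>(M + m) / 2\<close>, by the inequality of arithmetic and geometric means and rotation
    invariance. So the maximum principle gives \<open>m \<le> (M + m) / 2\<close>, that is
    \<open>m \<le> M\<close>.\<close>
  define h where "h = (\<lambda>l \<zeta>. u (l *s \<zeta>) * cnj (u (of_real \<rho> *s \<zeta>)))"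
  define H where "H = (\<lambda>l. \<integral>\<zeta>. h l \<zeta> \<partial>\<beta>)"
  define m where "m = hardy_mean \<beta> u \<rho>"
  define M where "M = (\<integral>\<zeta>. (cmod (u \<zeta>))\<^sup>2 \<partial>\<beta>)"
  have conth: "continuous_on (cball 0 1 \<times> B) (\<lambda>(l, \<zeta>). h l \<zeta>)"
  proof -
    have "continuous_on (cball 0 1 \<times> B) (\<lambda>p. u (of_real \<rho> *s snd p))"
      by (rule continuous_on_compose2[OF contr]) (use \<rho> in \<open>auto intro!: continuous_intros\<close>)
    with cont show ?thesis
      unfolding h_def case_prod_unfold by (intro continuous_intros)
  qed
  have le: "cmod (H (of_real \<rho>)) \<le> (M + m) / 2"
  proof (rule maximum_modulus_frontier[of H "cball 0 1"])
    have "H holomorphic_on ball 0 1"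
      unfolding H_def
    proof (rule holomorphic_on_integral_parameter)
      show "finite_measure \<beta>" by unfold_locales
      show "h l \<in> borel_measurable \<beta>" if "l \<in> ball 0 1" for l
        using that continuous_on_slice_right[OF conth]
        by (intro positive_radon_on_continuous_measurable[OF radon]) auto
      show "(\<lambda>l. h l \<zeta>) holomorphic_on ball 0 1" if "\<zeta> \<in> space \<beta>" for \<zeta>
        unfolding h_def
        by (intro holomorphic_intros cn_holomorphic_on_slice[OF u(1)])
          (use that B_subset in \<open>auto intro: scale_in_D\<close>)
      show "cmod (h l \<zeta>) \<le> K * K" if "l \<in> ball 0 1" "\<zeta> \<in> space \<beta>" for l \<zeta>
        unfolding h_def norm_mult complex_mod_cnj
        using K[OF scale_B_in_closure, of \<zeta> l] K[OF scale_B_in_closure, of \<zeta> "of_real \<rho>"] that \<rho>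
        by (intro mult_mono) (auto intro: order_trans[OF norm_ge_zero])
    qed simp
    then show "H holomorphic_on interior (cball 0 1)" by simp
    show "continuous_on (closure (cball 0 1)) H"
      using continuous_on_integral_parameter[OF radon compact_B _ conth] by (simp add: H_def)
    fix l assume "l \<in> frontier (cball (0::complex) 1)"
    then have l: "cmod l = 1" by simp
    have int: "integrable \<beta> (\<lambda>\<zeta>. (cmod (u (c *s \<zeta>)))\<^sup>2)" if "cmod c \<le> 1" for c
      using contl[OF that] by (intro positive_radon_on_integrable[OF radon compact_B] continuous_intros)
    have "cmod (H l) \<le> (\<integral>\<zeta>. cmod (h l \<zeta>) \<partial>\<beta>)"
      unfolding H_def by (rule integral_norm_bound)
    also have "\<dots> \<le> (\<integral>\<zeta>. ((cmod (u (l *s \<zeta>)))\<^sup>2 + (cmod (u (of_real \<rho> *s \<zeta>)))\<^sup>2) / 2 \<partial>\<beta>)"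
    proof (rule integral_mono)
      show "integrable \<beta> (\<lambda>\<zeta>. cmod (h l \<zeta>))"
        using continuous_on_slice_right[OF conth, of l] l
        by (intro positive_radon_on_integrable[OF radon compact_B] continuous_intros) auto
      show "integrable \<beta> (\<lambda>\<zeta>. ((cmod (u (l *s \<zeta>)))\<^sup>2 + (cmod (u (of_real \<rho> *s \<zeta>)))\<^sup>2) / 2)"
        using int[of l] int[of "of_real \<rho>"] l \<rho> by auto
      show "cmod (h l \<zeta>) \<le> ((cmod (u (l *s \<zeta>)))\<^sup>2 + (cmod (u (of_real \<rho> *s \<zeta>)))\<^sup>2) / 2" for \<zeta>
        using sum_squares_bound[of "cmod (u (l *s \<zeta>))" "cmod (u (of_real \<rho> *s \<zeta>))"]
        by (simp add: h_def norm_mult)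
    qed
    also have "\<dots> = ((\<integral>\<zeta>. (cmod (u (l *s \<zeta>)))\<^sup>2 \<partial>\<beta>) + (\<integral>\<zeta>. (cmod (u (of_real \<rho> *s \<zeta>)))\<^sup>2 \<partial>\<beta>)) / 2"
      using int[of l] int[of "of_real \<rho>"] l \<rho> by (simp add: Bochner_Integration.integral_add)
    also have "(\<integral>\<zeta>. (cmod (u (l *s \<zeta>)))\<^sup>2 \<partial>\<beta>) = M"
    proof -
      have "continuous_on B (\<lambda>\<zeta>. (cmod (u \<zeta>))\<^sup>2)"
        using continuous_on_subset[OF u(2) B_subset(1)] by (intro continuous_intros)
      from integral_automorphism[OF rotation_automorphism[OF l]
          positive_radon_on_continuous_measurable[OF radon this]]
      show ?thesis by (simp add: M_def mat_mult_vec)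
    qed
    also have "(\<integral>\<zeta>. (cmod (u (of_real \<rho> *s \<zeta>)))\<^sup>2 \<partial>\<beta>) = m"
      by (simp add: m_def hardy_mean_def scaleR_eq_scale)
    finally show "cmod (H l) \<le> (M + m) / 2" .
  qed (use \<rho> in auto)
  have "H (of_real \<rho>) = (\<integral>\<zeta>. of_real ((cmod (u (of_real \<rho> *s \<zeta>)))\<^sup>2) \<partial>\<beta>)"
    unfolding H_def h_def complex_norm_square ..
  also have "\<dots> = of_real m"
    unfolding m_def hardy_mean_def scaleR_eq_scale by (rule integral_complex_of_real)
  finally have "cmod (H (of_real \<rho>)) = \<bar>m\<bar>" by simp
  with le show ?thesis by (simp add: m_def M_def)
qed

section \<open>Hardy norms of functions continuous up to the boundary\<close>

lemma continuous_on_hardy_mean: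
  assumes "continuous_on (closure D) u"
  shows "continuous_on {0..1} (hardy_mean \<beta> u)"
proof -
  have "continuous_on ({0..1} \<times> B) (\<lambda>p. u (fst p *\<^sub>R snd p))"
    by (rule continuous_on_compose2[OF assms])
      (use B_subset in \<open>auto intro!: continuous_intros scaleR_in_closure\<close>)
  then have "continuous_on ({0..1} \<times> B) (\<lambda>(\<rho>, \<zeta>). (cmod (u (\<rho> *\<^sub>R \<zeta>)))\<^sup>2)"
    unfolding case_prod_unfold by (intro continuous_intros)
  from continuous_on_integral_parameter[OF radon compact_B _ this]
  show ?thesis by (simp add: hardy_mean_def[abs_def])
qed

text \<open>The supremum over \<open>\<rho> < 1\<close> is the mean at \<open>\<rho> = 1\<close>: no
  earlier mean exceeds it by \<open>hardy_mean_le\<close>, and the means tend to it by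
  continuity.\<close>

lemma hardy_norm_sq_eq:
  assumes u: "u cn_holomorphic_on D" "continuous_on (closure D) u"
  shows "hardy_norm_sq \<beta> u = (\<integral>\<zeta>. (cmod (u \<zeta>))\<^sup>2 \<partial>\<beta>)"
    and hardy_space_continuous: "u \<in> hardy_space D \<beta>"
proof -
  have bdd: "bdd_above (hardy_mean \<beta> u ` {0..<1})"
    using hardy_mean_le[OF u] by (intro bdd_aboveI[of _ "\<integral>\<zeta>. (cmod (u \<zeta>))\<^sup>2 \<partial>\<beta>"]) auto
  then show "u \<in> hardy_space D \<beta>" using u by (simp add: hardy_space_def)
  have "hardy_mean \<beta> u 1 \<le> hardy_norm_sq \<beta> u"
  proof (rule continuous_le_on_closure[where f="hardy_mean \<beta> u" and x=1 and S="{0..<1}"])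
    show "continuous_on (closure {0..<1}) (hardy_mean \<beta> u)"
      using continuous_on_hardy_mean[OF u(2)] by simp
    show "hardy_mean \<beta> u \<rho> \<le> hardy_norm_sq \<beta> u" if "\<rho> \<in> {0..<1}" for \<rho>
      unfolding hardy_norm_sq_def using bdd that by (intro cSUP_upper)
  qed simp
  moreover have "hardy_norm_sq \<beta> u \<le> (\<integral>\<zeta>. (cmod (u \<zeta>))\<^sup>2 \<partial>\<beta>)"
    unfolding hardy_norm_sq_def by (rule cSUP_least) (use hardy_mean_le[OF u] in auto)
  ultimately show "hardy_norm_sq \<beta> u = (\<integral>\<zeta>. (cmod (u \<zeta>))\<^sup>2 \<partial>\<beta>)" by (simp add: hardy_mean_def)
qed

lemma hardy_inner_eq:
  assumes f: "f cn_holomorphic_on D" "continuous_on (closure D) f"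
    and g: "g cn_holomorphic_on D" "continuous_on (closure D) g"
  shows "hardy_inner \<beta> f g = (\<integral>\<zeta>. f \<zeta> * cnj (g \<zeta>) \<partial>\<beta>)"
proof -
  have ig: "(\<lambda>z. \<i> * g z) cn_holomorphic_on D"
    by (rule cn_holomorphic_on_mult[OF cn_holomorphic_on_const g(1)])
  have B: "continuous_on B f" "continuous_on B g"
    using f(2) g(2) B_subset continuous_on_subset by blast+
  show ?thesis
    unfolding hardy_inner_def
  proof (subst integral_polarization)
    show "Complex ((hardy_norm_sq \<beta> (\<lambda>z. f z + g z) - hardy_norm_sq \<beta> (\<lambda>z. f z - g z)) / 4)
      ((hardy_norm_sq \<beta> (\<lambda>z. f z + \<i> * g z) - hardy_norm_sq \<beta> (\<lambda>z. f z - \<i> * g z)) / 4) =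
      Complex (((\<integral>x. (cmod (f x + g x))\<^sup>2 \<partial>\<beta>) - (\<integral>x. (cmod (f x - g x))\<^sup>2 \<partial>\<beta>)) / 4)
      (((\<integral>x. (cmod (f x + \<i> * g x))\<^sup>2 \<partial>\<beta>) - (\<integral>x. (cmod (f x - \<i> * g x))\<^sup>2 \<partial>\<beta>)) / 4)"
      using f g ig
      by (simp add: hardy_norm_sq_eq cn_holomorphic_on_add cn_holomorphic_on_diff continuous_intros)
    show "integrable \<beta> (\<lambda>x. (cmod (f x))\<^sup>2)" "integrable \<beta> (\<lambda>x. (cmod (g x))\<^sup>2)"
      using B by (auto intro!: positive_radon_on_integrable[OF radon compact_B] continuous_intros)
    show "f \<in> borel_measurable \<beta>" "g \<in> borel_measurable \<beta>"
      using B by (auto intro!: positive_radon_on_continuous_measurable[OF radon])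
  qed
qed

lemma kernel_continuous_right: "z \<in> D \<Longrightarrow> continuous_on (closure D) (C z)"
  by (rule continuous_on_slice_right[OF kernel_continuous])

text \<open>The second identity is the reproducing property for the product of \<open>u\<close> and
  the kernel function at \<open>z\<close>.\<close>

lemma hardy_inner_kernel:
  assumes u: "u cn_holomorphic_on D" "continuous_on (closure D) u" and z: "z \<in> D"
  shows "(\<integral>\<zeta>. u \<zeta> * C z \<zeta> \<partial>\<beta>) = u z"
    and "(\<integral>\<zeta>. u \<zeta> * of_real ((cmod (C z \<zeta>))\<^sup>2) \<partial>\<beta>) = u z * C z z"
proof -
  \<comment> \<open>On \<open>D\<close> this is the kernel function at \<open>z\<close>. The
    extension of \<open>C\<close> lives near \<open>D \<times> closure D\<close>, so at boundary
    points \<open>w\<close> it controls \<open>C z w\<close> but not \<open>C w z\<close>; the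
    conjugate of the former is the version that is continuous up to the boundary.\<close>
  define k where "k = (\<lambda>w. cnj (C z w))"
  have k: "C w z = k w" if "w \<in> D" for w using kernel_hermitian[OF z that] by (simp add: k_def)
  have kh: "k cn_holomorphic_on D"
    using cn_holomorphic_on_cong[OF kernel_holomorphic[OF z] D(2) k] .
  have kc: "continuous_on (closure D) k"
    unfolding k_def using kernel_continuous_right[OF z] by (intro continuous_intros)
  have rep: "(\<integral>\<zeta>. v \<zeta> * cnj (k \<zeta>) \<partial>\<beta>) = v z"
    if "v cn_holomorphic_on D" "continuous_on (closure D) v" for v
  proof -
    have "hardy_inner \<beta> v k = hardy_inner \<beta> v (\<lambda>w. C w z)"
      using k scaleR_in_D B_subset by (intro hardy_inner_cong[OF radon, of D]) auto
    also have "\<dots> = v z" by (rule kernel_reproducing[OF z hardy_space_continuous[OF that]])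
    finally show ?thesis using hardy_inner_eq[OF that kh kc] by simp
  qed
  from rep[OF u] show "(\<integral>\<zeta>. u \<zeta> * C z \<zeta> \<partial>\<beta>) = u z" by (simp add: k_def)
  have "(\<integral>\<zeta>. u \<zeta> * k \<zeta> * cnj (k \<zeta>) \<partial>\<beta>) = u z * k z"
    using u kh kc by (intro rep cn_holomorphic_on_mult continuous_intros)
  also have "(\<lambda>\<zeta>. u \<zeta> * k \<zeta> * cnj (k \<zeta>)) = (\<lambda>\<zeta>. u \<zeta> * of_real ((cmod (C z \<zeta>))\<^sup>2))"
    by (simp only: mult.assoc flip: complex_norm_square) (simp add: k_def)
  finally show "(\<integral>\<zeta>. u \<zeta> * of_real ((cmod (C z \<zeta>))\<^sup>2) \<partial>\<beta>) = u z * C z z" using k[OF z] by simp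
qed

text \<open>The lower bound comes from reproducing the constant \<open>1\<close>, which is thereby
  at most the mean of \<open>cmod (C z \<zeta>)\<close> and so of
  \<open>((cmod (C z \<zeta>))\<^sup>2 + 1) / 2\<close>. It keeps the denominator of the
  Poisson-Szego kernel away from zero.\<close>

lemma kernel_diagonal:
  assumes z: "z \<in> D"
  shows "C z z = of_real (Re (C z z))" "Re (C z z) \<ge> 1"
proof -
  show C: "C z z = of_real (Re (C z z))"
    using kernel_hermitian[OF z z] by (simp add: complex_eq_iff)
  have cont: "continuous_on B (C z)"
    using kernel_continuous_right[OF z] B_subset continuous_on_subset by blast
  have int: "integrable \<beta> (\<lambda>\<zeta>. (cmod (C z \<zeta>))\<^sup>2)" "integrable \<beta> (\<lambda>\<zeta>. cmod (C z \<zeta>))"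
    using cont by (auto intro!: positive_radon_on_integrable[OF radon compact_B] continuous_intros)
  note 1 = hardy_inner_kernel[OF cn_holomorphic_on_const continuous_on_const z, of 1, simplified]
  have sq: "(\<integral>\<zeta>. (cmod (C z \<zeta>))\<^sup>2 \<partial>\<beta>) = Re (C z z)"
  proof -
    have "of_real (\<integral>\<zeta>. (cmod (C z \<zeta>))\<^sup>2 \<partial>\<beta>) = C z z"
      using 1(2) by (simp flip: integral_complex_of_real)
    then show ?thesis by (metis Re_complex_of_real)
  qed
  have "1 = cmod (\<integral>\<zeta>. C z \<zeta> \<partial>\<beta>)" using 1(1) by simp
  also have "\<dots> \<le> (\<integral>\<zeta>. cmod (C z \<zeta>) \<partial>\<beta>)" by (rule integral_norm_bound)
  also have "\<dots> \<le> (\<integral>\<zeta>. ((cmod (C z \<zeta>))\<^sup>2 + 1) / 2 \<partial>\<beta>)"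
  proof (rule integral_mono)
    show "cmod (C z \<zeta>) \<le> ((cmod (C z \<zeta>))\<^sup>2 + 1) / 2" for \<zeta>
      using sum_squares_bound[of "cmod (C z \<zeta>)" 1] by simp
  qed (use int in auto)
  also have "\<dots> = (Re (C z z) + 1) / 2"
    using int prob_space by (simp add: sq)
  finally show "Re (C z z) \<ge> 1" by simp
qed

section \<open>The Poisson-Szego kernel as a probability density\<close>

lemma poisson_nonneg: "z \<in> D \<Longrightarrow> poisson_szego C z \<zeta> \<ge> 0"
  using kernel_diagonal(2)[of z] by (simp add: poisson_szego_def)

lemma poisson_continuous: "continuous_on (D \<times> closure D) (\<lambda>(z, \<zeta>). poisson_szego C z \<zeta>)"
proof -
  have "continuous_on (D \<times> closure D) (\<lambda>p. case (fst p, fst p) of (z, w) \<Rightarrow> C z w)"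
    by (rule continuous_on_compose2[OF kernel_continuous])
      (use closure_subset[of D] in \<open>auto intro!: continuous_intros\<close>)
  then have "continuous_on (D \<times> closure D) (\<lambda>p. C (fst p) (fst p))" by simp
  moreover have "Re (C z z) \<noteq> 0" if "z \<in> D" for z using kernel_diagonal(2)[OF that] by auto
  ultimately show ?thesis
    using kernel_continuous unfolding poisson_szego_def case_prod_unfold
    by (intro continuous_intros) auto
qed

lemma poisson_reproducing:
  assumes u: "u cn_holomorphic_on D" "continuous_on (closure D) u" and z: "z \<in> D"
  shows "(\<integral>\<zeta>. of_real (poisson_szego C z \<zeta>) * u \<zeta> \<partial>\<beta>) = u z"
proof -
  have ne: "C z z \<noteq> 0" using kernel_diagonal(2)[OF z] by auto
  have "(\<integral>\<zeta>. of_real (poisson_szego C z \<zeta>) * u \<zeta> \<partial>\<beta>) =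
      (\<integral>\<zeta>. u \<zeta> * of_real ((cmod (C z \<zeta>))\<^sup>2) / of_real (Re (C z z)) \<partial>\<beta>)"
    by (simp add: poisson_szego_def mult.commute)
  also have "\<dots> = (\<integral>\<zeta>. u \<zeta> * of_real ((cmod (C z \<zeta>))\<^sup>2) \<partial>\<beta>) / of_real (Re (C z z))"
    by (rule integral_divide_zero)
  also have "\<dots> = u z"
    unfolding hardy_inner_kernel(2)[OF u z] kernel_diagonal(1)[OF z, symmetric] using ne by simp
  finally show ?thesis .
qed

text \<open>\<open>kernel_boundary_symmetric\<close> settles the numerators. The denominators agree
  because a linear automorphism taking \<open>\<xi>\<close> to \<open>\<zeta>\<close> also takes
  \<open>\<rho> *\<^sub>R \<xi>\<close> to \<open>\<rho> *\<^sub>R \<zeta>\<close> and preserves the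
  diagonal values of the kernel.\<close>

lemma poisson_symmetric:
  assumes "\<xi> \<in> B" "\<zeta> \<in> B" "0 \<le> \<rho>" "\<rho> < 1"
  shows "poisson_szego C (\<rho> *\<^sub>R \<xi>) \<zeta> = poisson_szego C (\<rho> *\<^sub>R \<zeta>) \<xi>"
proof -
  have "\<exists>k\<in>linear_automorphisms D. k *v \<xi> = \<zeta>"
    using domain assms by (simp add: normalized_domain_def)
  then obtain k where k: "k \<in> linear_automorphisms D" "k *v \<xi> = \<zeta>" by blast
  have "\<rho> *\<^sub>R \<zeta> = k *v (\<rho> *\<^sub>R \<xi>)"
    using k(2) by (simp add: scaleR_eq_scale vector_scalar_commute)
  then have "C (\<rho> *\<^sub>R \<zeta>) (\<rho> *\<^sub>R \<zeta>) = C (\<rho> *\<^sub>R \<xi>) (\<rho> *\<^sub>R \<xi>)"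
    using kernel_automorphism[OF k(1), of "\<rho> *\<^sub>R \<xi>" "\<rho> *\<^sub>R \<xi>"] scaleR_in_D assms B_subset by auto
  then show ?thesis
    using kernel_boundary_symmetric[of \<xi> \<zeta> \<rho>] assms B_subset by (auto simp: poisson_szego_def)
qed

lemma poisson_continuous_B:
  assumes "z \<in> D"
  shows "continuous_on B (poisson_szego C z)"
  using continuous_on_slice_right[OF poisson_continuous assms] B_subset continuous_on_subset by blast

lemma integral_poisson: "z \<in> D \<Longrightarrow> (\<integral>\<zeta>. poisson_szego C z \<zeta> \<partial>\<beta>) = 1"
  using poisson_reproducing[OF cn_holomorphic_on_const continuous_on_const, of z 1] by simp

lemma poisson_second_moment:
  assumes \<zeta>: "\<zeta> \<in> B" and \<rho>: "0 \<le> \<rho>" "\<rho> < 1"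
  shows "(\<integral>\<xi>. poisson_szego C (\<rho> *\<^sub>R \<zeta>) \<xi> * (norm (\<xi> - \<zeta>))\<^sup>2 \<partial>\<beta>) = 2 - 2 * \<rho>"
proof -
  define P where "P = poisson_szego C (\<rho> *\<^sub>R \<zeta>)"
  \<comment> \<open>The linear form given by \<open>\<zeta>\<close>. Its real part is the real inner
    product with \<open>\<zeta>\<close>, so on the unit sphere
    \<open>(norm (\<xi> - \<zeta>))\<^sup>2\<close> is \<open>2 - 2 * Re (u \<xi>)\<close>, and
    reproduction at \<open>\<rho> *\<^sub>R \<zeta>\<close> returns \<open>\<rho>\<close>.\<close>
  define u where "u = (\<lambda>z. \<Sum>i\<in>UNIV. z $ i * cnj (\<zeta> $ i))"
  have z: "\<rho> *\<^sub>R \<zeta> \<in> D" using scaleR_in_D assms B_subset by blast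
  have cu: "continuous_on S u" for S
    unfolding u_def by (intro continuous_intros)
  have hu: "u cn_holomorphic_on D"
    unfolding u_def by (rule cn_holomorphic_on_hermitian_product)
  have cP: "continuous_on B P" unfolding P_def by (rule poisson_continuous_B[OF z])
  have int: "integrable \<beta> P" "integrable \<beta> (\<lambda>\<xi>. P \<xi> * Re (u \<xi>))"
    "integrable \<beta> (\<lambda>\<xi>. of_real (P \<xi>) * u \<xi>)"
    by (intro positive_radon_on_integrable[OF radon compact_B] continuous_intros cP cu)+
  have "(\<integral>\<xi>. P \<xi> * Re (u \<xi>) \<partial>\<beta>) = Re (\<integral>\<xi>. of_real (P \<xi>) * u \<xi> \<partial>\<beta>)"
    using integral_Re[OF int(3)] by simp
  also have "\<dots> = Re (u (\<rho> *\<^sub>R \<zeta>))"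
    unfolding P_def poisson_reproducing[OF hu cu z] ..
  also have "\<dots> = \<rho>"
    using norm_B[OF \<zeta>] unfolding u_def Re_hermitian_product by (simp add: dot_square_norm)
  finally have m: "(\<integral>\<xi>. P \<xi> * Re (u \<xi>) \<partial>\<beta>) = \<rho>" .
  have "(\<integral>\<xi>. P \<xi> * (norm (\<xi> - \<zeta>))\<^sup>2 \<partial>\<beta>) = (\<integral>\<xi>. 2 * P \<xi> - 2 * (P \<xi> * Re (u \<xi>)) \<partial>\<beta>)"
  proof (rule Bochner_Integration.integral_cong[OF refl])
    fix \<xi> assume "\<xi> \<in> space \<beta>"
    then have "(norm (\<xi> - \<zeta>))\<^sup>2 = 2 - 2 * Re (u \<xi>)"
      using norm_B[of \<xi>] norm_B[OF \<zeta>] dot_norm_neg[of \<xi> \<zeta>]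
      unfolding u_def Re_hermitian_product by simp
    then show "P \<xi> * (norm (\<xi> - \<zeta>))\<^sup>2 = 2 * P \<xi> - 2 * (P \<xi> * Re (u \<xi>))"
      by (simp only: right_diff_distrib)
  qed
  also have "\<dots> = 2 * 1 - 2 * \<rho>"
    using int m integral_poisson[OF z] by (simp add: P_def)
  finally show ?thesis by (simp add: P_def)
qed

text \<open>A Chebyshev argument with the second moment. The integration variable is the dilated one
  because Fubini with a Clark measure will leave \<open>\<zeta>\<close> as the outer variable;
  \<open>poisson_symmetric\<close> turns the integral into a mean against a probability density
  concentrating at \<open>\<zeta>\<close>.\<close>

lemma poisson_approximate_identity:
  assumes f: "continuous_on B (f :: complex ^ 'n \<Rightarrow> complex)" and e: "e > 0"
  obtains r where "0 \<le> r" "r < 1"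
    "\<And>\<rho> \<zeta>. r \<le> \<rho> \<Longrightarrow> \<rho> < 1 \<Longrightarrow> \<zeta> \<in> B \<Longrightarrow>
      cmod ((\<integral>\<xi>. of_real (poisson_szego C (\<rho> *\<^sub>R \<xi>) \<zeta>) * f \<xi> \<partial>\<beta>) - f \<zeta>) \<le> e"
proof -
  obtain K where K: "\<And>z. z \<in> B \<Longrightarrow> cmod (f z) \<le> K" "K \<ge> 0"
    using compact_imp_bounded[OF compact_continuous_image[OF f compact_B]]
    by (metis bounded_pos imageI less_imp_le)
  obtain d where d: "d > 0" "\<And>x y. x \<in> B \<Longrightarrow> y \<in> B \<Longrightarrow> dist y x < d \<Longrightarrow> dist (f y) (f x) < e / 2"
    using compact_uniformly_continuous[OF f compact_B] e unfolding uniformly_continuous_on_def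
    by (metis half_gt_zero)
  \<comment> \<open>Chosen so that the quadratic term alone covers the trivial bound
    \<open>2 * K\<close> once \<open>\<xi>\<close> and \<open>\<zeta>\<close> are at distance at
    least \<open>d\<close>.\<close>
  define A where "A = 2 * K / d\<^sup>2"
  have A: "A \<ge> 0" using K d by (simp add: A_def)
  have bd: "cmod (f \<xi> - f \<zeta>) \<le> e / 2 + A * (norm (\<xi> - \<zeta>))\<^sup>2" if "\<xi> \<in> B" "\<zeta> \<in> B" for \<xi> \<zeta>
  proof (cases "dist \<xi> \<zeta> < d")
    case True
    then have "cmod (f \<xi> - f \<zeta>) \<le> e / 2" using d(2)[OF that(2,1)] by (simp add: dist_norm)
    then show ?thesis using A by (smt (verit) mult_nonneg_nonneg zero_le_power2)
  next
    case False
    then have "d\<^sup>2 \<le> (norm (\<xi> - \<zeta>))\<^sup>2" using d by (intro power_mono) (auto simp: dist_norm)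
    then have "2 * K \<le> A * (norm (\<xi> - \<zeta>))\<^sup>2"
      using d(1) K(2) by (simp add: A_def divide_simps mult_left_mono)
    moreover have "cmod (f \<xi> - f \<zeta>) \<le> 2 * K"
      using norm_triangle_ineq4[of "f \<xi>" "f \<zeta>"] K(1)[OF that(1)] K(1)[OF that(2)] by simp
    ultimately show ?thesis using e by simp
  qed
  \<comment> \<open>For \<open>\<rho> \<ge> r\<close> this makes \<open>A * (2 - 2 * \<rho>)\<close>
    at most \<open>e / 2\<close>. The denominator has \<open>A + 1\<close> since only
    \<open>A \<ge> 0\<close> is known.\<close>
  define r where "r = max 0 (1 - e / (4 * (A + 1)))"
  have r: "0 \<le> r" "r < 1" using A e by (auto simp: r_def)
  moreover have "cmod ((\<integral>\<xi>. of_real (poisson_szego C (\<rho> *\<^sub>R \<xi>) \<zeta>) * f \<xi> \<partial>\<beta>) - f \<zeta>) \<le> e"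
    if \<rho>: "r \<le> \<rho>" "\<rho> < 1" and \<zeta>: "\<zeta> \<in> B" for \<rho> \<zeta>
  proof -
    have \<rho>0: "0 \<le> \<rho>" using r \<rho> by simp
    define P where "P = poisson_szego C (\<rho> *\<^sub>R \<zeta>)"
    have z: "\<rho> *\<^sub>R \<zeta> \<in> D" using scaleR_in_D \<rho>0 \<rho> \<zeta> B_subset by blast
    have cP: "continuous_on B P" unfolding P_def by (rule poisson_continuous_B[OF z])
    have int: "integrable \<beta> P" "integrable \<beta> (\<lambda>\<xi>. of_real (P \<xi>) * f \<xi>)"
      "integrable \<beta> (\<lambda>\<xi>. of_real (P \<xi>) * f \<zeta>)"
      "integrable \<beta> (\<lambda>\<xi>. of_real (P \<xi>) * (f \<xi> - f \<zeta>))"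
      "integrable \<beta> (\<lambda>\<xi>. P \<xi> * (norm (\<xi> - \<zeta>))\<^sup>2)"
      by (intro positive_radon_on_integrable[OF radon compact_B] continuous_intros cP f)+
    have one: "(\<integral>\<xi>. P \<xi> \<partial>\<beta>) = 1" unfolding P_def by (rule integral_poisson[OF z])
    have sym: "(\<integral>\<xi>. of_real (poisson_szego C (\<rho> *\<^sub>R \<xi>) \<zeta>) * f \<xi> \<partial>\<beta>) = (\<integral>\<xi>. of_real (P \<xi>) * f \<xi> \<partial>\<beta>)"
      unfolding P_def by (rule Bochner_Integration.integral_cong) (use poisson_symmetric \<zeta> \<rho>0 \<rho> in auto)
    have const: "(\<integral>\<xi>. of_real (P \<xi>) * f \<zeta> \<partial>\<beta>) = f \<zeta>"
      by (simp add: one)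
    have "(\<integral>\<xi>. of_real (poisson_szego C (\<rho> *\<^sub>R \<xi>) \<zeta>) * f \<xi> \<partial>\<beta>) - f \<zeta> =
        (\<integral>\<xi>. of_real (P \<xi>) * f \<xi> - of_real (P \<xi>) * f \<zeta> \<partial>\<beta>)"
      unfolding Bochner_Integration.integral_diff[OF int(2,3)] const sym ..
    also have "cmod \<dots> \<le> (\<integral>\<xi>. cmod (of_real (P \<xi>) * f \<xi> - of_real (P \<xi>) * f \<zeta>) \<partial>\<beta>)"
      by (rule integral_norm_bound)
    also have "\<dots> \<le> (\<integral>\<xi>. e / 2 * P \<xi> + A * (P \<xi> * (norm (\<xi> - \<zeta>))\<^sup>2) \<partial>\<beta>)"
    proof (rule integral_mono)
      fix \<xi> assume "\<xi> \<in> space \<beta>"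
      moreover have "P \<xi> \<ge> 0" unfolding P_def by (rule poisson_nonneg[OF z])
      ultimately have "P \<xi> * cmod (f \<xi> - f \<zeta>) \<le> P \<xi> * (e / 2 + A * (norm (\<xi> - \<zeta>))\<^sup>2)"
        using bd \<zeta> by (intro mult_left_mono) auto
      moreover have "cmod (of_real (P \<xi>) * f \<xi> - of_real (P \<xi>) * f \<zeta>) = P \<xi> * cmod (f \<xi> - f \<zeta>)"
        using \<open>P \<xi> \<ge> 0\<close> by (simp add: norm_mult flip: right_diff_distrib)
      ultimately show "cmod (of_real (P \<xi>) * f \<xi> - of_real (P \<xi>) * f \<zeta>) \<le>
          e / 2 * P \<xi> + A * (P \<xi> * (norm (\<xi> - \<zeta>))\<^sup>2)"
        by (simp add: algebra_simps)
    qed (use int in auto)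
    also have "\<dots> = e / 2 + A * (2 - 2 * \<rho>)"
      using int one poisson_second_moment[OF \<zeta> \<rho>0 \<rho>(2)] by (simp add: P_def)
    also have "A * (2 - 2 * \<rho>) \<le> (A + 1) * (2 * (e / (4 * (A + 1))))"
      using \<rho> A by (intro mult_mono) (auto simp: r_def)
    also have "\<dots> = e / 2" using A by (simp add: field_simps)
    finally show ?thesis by simp
  qed
  ultimately show ?thesis by (rule that)
qed

end

section \<open>Continuity and averages of Clark measures\<close>

lemma haar_circle_integrable:
  fixes f :: "complex \<Rightarrow> 'b::{banach,second_countable_topology}"
  shows "continuous_on (sphere 0 1) f \<Longrightarrow> integrable haar_circle f"
  by (rule positive_radon_on_integrable[OF positive_radon_on_haar_circle compact_sphere])

lemma space_haar_circle: "space haar_circle = sphere 0 1"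
  by (rule space_positive_radon_on[OF positive_radon_on_haar_circle])

lemma haar_circle_rotate:
  fixes f :: "complex \<Rightarrow> complex"
  assumes "cmod c = 1" "continuous_on (sphere 0 1) f"
  shows "(\<integral>\<alpha>. f (c * \<alpha>) \<partial>haar_circle) = (\<integral>\<alpha>. f \<alpha> \<partial>haar_circle)"
proof -
  have sets: "sets haar_circle = sets (restrict_space borel (sphere 0 1))"
    by (simp add: haar_circle_def)
  have "(\<lambda>\<alpha>. c * \<alpha>) \<in> restrict_space borel (sphere 0 1) \<rightarrow>\<^sub>M restrict_space borel (sphere 0 1)"
    using assms by (intro measurable_restrict_space3) (auto simp: norm_mult)
  then have "(\<lambda>\<alpha>. c * \<alpha>) \<in> haar_circle \<rightarrow>\<^sub>M haar_circle"
    using sets measurable_cong_sets by blast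
  from integral_distr[OF this positive_radon_on_continuous_measurable[OF positive_radon_on_haar_circle assms(2)]]
  show ?thesis by (simp add: distr_rotation_haar_circle[OF assms(1)])
qed

lemma haar_circle_moment:
  assumes "k > 0"
  shows "(\<integral>\<alpha>. \<alpha> ^ k \<partial>haar_circle) = 0"
proof -
  \<comment> \<open>Rotation by \<open>c\<close> multiplies the integrand by
    \<open>c ^ k = - 1\<close> and preserves the integral, which therefore vanishes.\<close>
  define c where "c = cis (pi / k)"
  have "real k * (pi / real k) = pi" using assms by simp
  then have c: "c ^ k = - 1" by (simp only: c_def Complex.DeMoivre cis_pi)
  have "(\<integral>\<alpha>. (c * \<alpha>) ^ k \<partial>haar_circle) = (\<integral>\<alpha>. \<alpha> ^ k \<partial>haar_circle)"
    by (rule haar_circle_rotate) (auto simp: c_def intro!: continuous_intros)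
  then show ?thesis by (simp add: power_mult_distrib c)
qed

lemma one_minus_mult_nonzero: "cmod z < 1 \<Longrightarrow> cmod \<alpha> = 1 \<Longrightarrow> 1 - z * \<alpha> \<noteq> 0"
  by (metis less_irrefl mult.right_neutral norm_mult norm_one right_minus_eq)

text \<open>The geometric series, of which only the moment of order \<open>0\<close> survives. Its
  terms are peeled off one at a time by \<open>rec\<close>; the factor \<open>z ^ n\<close> in front
  of the remainder tends to zero against a bound that is uniform in \<open>k\<close>.\<close>

lemma haar_circle_geometric:
  assumes z: "cmod z < 1"
  shows "(\<integral>\<alpha>. \<alpha> ^ k / (1 - z * \<alpha>) \<partial>haar_circle) = (if k = 0 then 1 else 0)"
proof -
  interpret prob_space haar_circle by (rule prob_space_haar_circle)
  define I where "I = (\<lambda>k. \<integral>\<alpha>. \<alpha> ^ k / (1 - z * \<alpha>) \<partial>haar_circle)"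
  have int: "integrable haar_circle (\<lambda>\<alpha>. \<alpha> ^ k / (1 - z * \<alpha>))" for k
    using one_minus_mult_nonzero[OF z] by (intro haar_circle_integrable continuous_intros) auto
  have int': "integrable haar_circle (\<lambda>\<alpha>. \<alpha> ^ k)" for k
    by (intro haar_circle_integrable continuous_intros)
  have rec: "I k = (\<integral>\<alpha>. \<alpha> ^ k \<partial>haar_circle) + z * I (Suc k)" for k
  proof -
    have "I k = (\<integral>\<alpha>. \<alpha> ^ k + z * (\<alpha> ^ Suc k / (1 - z * \<alpha>)) \<partial>haar_circle)"
      unfolding I_def
    proof (rule Bochner_Integration.integral_cong[OF refl])
      fix \<alpha> assume "\<alpha> \<in> space haar_circle"
      then have "1 - z * \<alpha> \<noteq> 0" using one_minus_mult_nonzero[OF z] by (simp add: space_haar_circle)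
      then show "\<alpha> ^ k / (1 - z * \<alpha>) = \<alpha> ^ k + z * (\<alpha> ^ Suc k / (1 - z * \<alpha>))"
        by (simp add: field_simps)
    qed
    also have "\<dots> = (\<integral>\<alpha>. \<alpha> ^ k \<partial>haar_circle) + z * I (Suc k)"
      unfolding I_def by (subst Bochner_Integration.integral_add[OF int' integrable_mult_right[OF int]])
        (simp only: integral_mult_right_zero)
    finally show ?thesis .
  qed
  have bound: "cmod (I k) \<le> 1 / (1 - cmod z)" for k
  proof -
    have "cmod (I k) \<le> (\<integral>\<alpha>. cmod (\<alpha> ^ k / (1 - z * \<alpha>)) \<partial>haar_circle)"
      unfolding I_def by (rule integral_norm_bound)
    also have "\<dots> \<le> (\<integral>\<alpha>. 1 / (1 - cmod z) \<partial>haar_circle)"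
    proof (rule integral_mono)
      fix \<alpha> assume "\<alpha> \<in> space haar_circle"
      then have \<alpha>: "cmod \<alpha> = 1" by (simp add: space_haar_circle)
      have "1 - cmod z \<le> cmod (1 - z * \<alpha>)"
        using norm_triangle_ineq2[of 1 "z * \<alpha>"] \<alpha> by (simp add: norm_mult)
      then show "cmod (\<alpha> ^ k / (1 - z * \<alpha>)) \<le> 1 / (1 - cmod z)"
        using z \<alpha> by (simp add: norm_divide norm_power frac_le)
    qed (use int in auto)
    also have "\<dots> = 1 / (1 - cmod z)" by (simp add: prob_space)
    finally show ?thesis .
  qed
  have zero: "I k = 0" if "k > 0" for k
  proof -
    have step: "I k = z ^ n * I (k + n)" for n
    proof (induction n)
      case (Suc n)
      have "I (k + n) = z * I (k + Suc n)"
        using rec[of "k + n"] haar_circle_moment[of "k + n"] that by simp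
      with Suc show ?case by (simp only: power_Suc2 mult.assoc)
    qed simp
    have "cmod (I k) \<le> cmod z ^ n * (1 / (1 - cmod z))" for n
      unfolding step[of n] norm_mult norm_power by (intro mult_left_mono bound) simp
    moreover have "(\<lambda>n. cmod z ^ n * (1 / (1 - cmod z))) \<longlonglongrightarrow> 0 * (1 / (1 - cmod z))"
      using z by (intro tendsto_intros LIMSEQ_realpow_zero) auto
    ultimately have "cmod (I k) \<le> 0"
      by (intro LIMSEQ_le_const) auto
    then show ?thesis by simp
  qed
  have "I 0 = 1" using rec[of 0] zero[of 1] by (simp add: prob_space)
  then show ?thesis using zero[of k] by (auto simp: I_def)
qed

text \<open>On the circle \<open>1 / \<alpha> = cnj \<alpha>\<close>, which splits the Poisson
  kernel into \<open>1\<close>, a part analytic in \<open>\<alpha>\<close> and its conjugate.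
  Integrals against powers of \<open>\<alpha>\<close> can then be read off from
  \<open>haar_circle_geometric\<close>.\<close>

lemma disc_poisson_expansion:
  assumes "cmod \<alpha> = 1" "cmod z < 1"
  shows "of_real (Re ((\<alpha> + z) / (\<alpha> - z))) =
    1 + cnj z * (\<alpha> / (1 - cnj z * \<alpha>)) + cnj (cnj z * (\<alpha> / (1 - cnj z * \<alpha>)))"
proof -
  have a: "\<alpha> * cnj \<alpha> = 1" using complex_norm_square[of \<alpha>] assms(1) by (simp only: power_one of_real_1)
  have ne: "1 - z * cnj \<alpha> \<noteq> 0" using one_minus_mult_nonzero[of z "cnj \<alpha>"] assms by simp
  have \<alpha>: "\<alpha> \<noteq> 0" using assms by auto
  have "\<alpha> + z = \<alpha> * (1 + z * cnj \<alpha>)" "\<alpha> - z = \<alpha> * (1 - z * cnj \<alpha>)"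
    using a by (simp_all add: algebra_simps)
  then have "(\<alpha> + z) / (\<alpha> - z) = (1 + z * cnj \<alpha>) / (1 - z * cnj \<alpha>)"
    using \<alpha> by simp
  also have "\<dots> = 1 + 2 * (z * cnj \<alpha> / (1 - z * cnj \<alpha>))"
    using ne by (simp add: field_simps)
  also have "z * cnj \<alpha> / (1 - z * cnj \<alpha>) = cnj (cnj z * (\<alpha> / (1 - cnj z * \<alpha>)))"
    by simp
  finally have "(\<alpha> + z) / (\<alpha> - z) = 1 + 2 * cnj (cnj z * (\<alpha> / (1 - cnj z * \<alpha>)))" .
  moreover have "of_real (Re (1 + 2 * cnj q)) = 1 + q + cnj q" for q
    by (simp add: complex_eq_iff)
  ultimately show ?thesis by metis
qed

lemma disc_poisson_eq:
  assumes "cmod \<alpha> = 1" "cmod z < 1"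
  shows "Re ((\<alpha> + z) / (\<alpha> - z)) = (1 - (cmod z)\<^sup>2) / (cmod (\<alpha> - z))\<^sup>2"
proof -
  have "Re ((\<alpha> + z) * cnj (\<alpha> - z)) = (cmod \<alpha>)\<^sup>2 - (cmod z)\<^sup>2"
    unfolding cmod_power2 by (simp add: power2_eq_square algebra_simps)
  then show ?thesis
    using assms unfolding complex_div_cnj[of "\<alpha> + z" "\<alpha> - z"] Re_divide_of_real by simp
qed

lemma disc_poisson_pos: "cmod \<alpha> = 1 \<Longrightarrow> cmod z < 1 \<Longrightarrow> 0 < Re ((\<alpha> + z) / (\<alpha> - z))"
  by (auto simp: disc_poisson_eq abs_square_less_1 intro!: divide_pos_pos)

text \<open>The point is uniformity in \<open>\<alpha>\<close>: at \<open>z = \<phi> 0\<close> this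
  bounds the masses of all Clark measures at once.\<close>

lemma disc_poisson_le:
  assumes "cmod \<alpha> = 1" "cmod z < 1"
  shows "Re ((\<alpha> + z) / (\<alpha> - z)) \<le> 1 / (1 - cmod z)\<^sup>2"
  unfolding disc_poisson_eq[OF assms]
proof (rule frac_le)
  show "(1 - cmod z)\<^sup>2 \<le> (cmod (\<alpha> - z))\<^sup>2"
    using norm_triangle_ineq2[of \<alpha> z] assms by (intro power_mono) auto
qed (use assms in auto)

lemma haar_circle_disc_poisson:
  assumes z: "cmod z < 1"
  shows "(\<integral>\<alpha>. of_real (Re ((\<alpha> + z) / (\<alpha> - z))) \<partial>haar_circle) = (1 :: complex)"
    and "(\<integral>\<alpha>. cnj \<alpha> * of_real (Re ((\<alpha> + z) / (\<alpha> - z))) \<partial>haar_circle) = cnj z"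
proof -
  interpret prob_space haar_circle by (rule prob_space_haar_circle)
  \<comment> \<open>The index is the exponent of \<open>\<alpha>\<close>: the Poisson kernel is
    \<open>1 + q 1 \<alpha> + cnj (q 1 \<alpha>)\<close>, and multiplication by
    \<open>cnj \<alpha>\<close> lowers the analytic exponent to \<open>0\<close> and raises the
    conjugate one to \<open>2\<close>. Only exponent \<open>0\<close> contributes to the integral,
    with value \<open>cnj z\<close>.\<close>
  define q where "q = (\<lambda>k \<alpha>. cnj z * (\<alpha> ^ k / (1 - cnj z * \<alpha>)))"
  have int: "integrable haar_circle (q k)" for k
    unfolding q_def using one_minus_mult_nonzero[of "cnj z"] z
    by (intro haar_circle_integrable continuous_intros) auto
  have q: "(\<integral>\<alpha>. q k \<alpha> \<partial>haar_circle) = (if k = 0 then cnj z else 0)" for k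
    unfolding q_def integral_mult_right_zero using haar_circle_geometric[of "cnj z" k] z by simp
  have "(\<integral>\<alpha>. of_real (Re ((\<alpha> + z) / (\<alpha> - z))) \<partial>haar_circle) =
      (\<integral>\<alpha>. 1 + q 1 \<alpha> + cnj (q 1 \<alpha>) \<partial>haar_circle)"
    using disc_poisson_expansion[OF _ z]
    by (intro Bochner_Integration.integral_cong) (auto simp: q_def space_haar_circle)
  also have "\<dots> = 1 + (\<integral>\<alpha>. q 1 \<alpha> \<partial>haar_circle) + cnj (\<integral>\<alpha>. q 1 \<alpha> \<partial>haar_circle)"
    using int[of 1] by (simp add: prob_space)
  finally show "(\<integral>\<alpha>. of_real (Re ((\<alpha> + z) / (\<alpha> - z))) \<partial>haar_circle) = (1 :: complex)"
    by (simp add: q)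
  have "(\<integral>\<alpha>. cnj \<alpha> * of_real (Re ((\<alpha> + z) / (\<alpha> - z))) \<partial>haar_circle) =
      (\<integral>\<alpha>. cnj (\<alpha> ^ 1) + q 0 \<alpha> + cnj (q 2 \<alpha>) \<partial>haar_circle)"
  proof (rule Bochner_Integration.integral_cong[OF refl])
    fix \<alpha> assume "\<alpha> \<in> space haar_circle"
    then have \<alpha>: "cmod \<alpha> = 1" by (simp add: space_haar_circle)
    then have a: "cnj \<alpha> * \<alpha> = 1"
      using complex_norm_square[of \<alpha>] by (simp only: power_one of_real_1 mult.commute)
    have "cnj \<alpha> * (cnj z * (\<alpha> / (1 - cnj z * \<alpha>))) = cnj z * ((cnj \<alpha> * \<alpha>) / (1 - cnj z * \<alpha>))"
      by simp
    also have "\<dots> = q 0 \<alpha>" unfolding a by (simp add: q_def)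
    finally have 1: "cnj \<alpha> * (cnj z * (\<alpha> / (1 - cnj z * \<alpha>))) = q 0 \<alpha>" .
    have 2: "cnj \<alpha> * cnj (cnj z * (\<alpha> / (1 - cnj z * \<alpha>))) = cnj (q 2 \<alpha>)"
      by (simp add: q_def power2_eq_square)
    show "cnj \<alpha> * of_real (Re ((\<alpha> + z) / (\<alpha> - z))) = cnj (\<alpha> ^ 1) + q 0 \<alpha> + cnj (q 2 \<alpha>)"
      unfolding disc_poisson_expansion[OF \<alpha> z] distrib_left 1 2 by simp
  qed
  also have "\<dots> = cnj (\<integral>\<alpha>. \<alpha> ^ 1 \<partial>haar_circle) + (\<integral>\<alpha>. q 0 \<alpha> \<partial>haar_circle) + cnj (\<integral>\<alpha>. q 2 \<alpha> \<partial>haar_circle)"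
    using int haar_circle_integrable[of "\<lambda>\<alpha>. \<alpha> ^ 1"] by (simp add: continuous_on_id)
  finally show "(\<integral>\<alpha>. cnj \<alpha> * of_real (Re ((\<alpha> + z) / (\<alpha> - z))) \<partial>haar_circle) = cnj z"
    using haar_circle_moment[of 1] by (simp add: q)
qed

section \<open>Clark measures as vague limits of their Poisson integrals\<close>

locale clark_family = szego_domain D B \<beta> C
  for D B :: "(complex ^ 'n) set" and \<beta> C +
  fixes \<phi> :: "complex ^ 'n \<Rightarrow> complex" and \<mu> :: "complex \<Rightarrow> (complex ^ 'n) measure"
  assumes phi_continuous: "continuous_on D \<phi>"
    and phi_disc: "z \<in> D \<Longrightarrow> cmod (\<phi> z) < 1"
    and clark: "\<alpha> \<in> sphere 0 1 \<Longrightarrow> is_clark_measure D B C \<phi> \<alpha> (\<mu> \<alpha>)"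
begin

text \<open>The Poisson kernel of the disc with pole \<open>\<alpha>\<close>, evaluated at
  \<open>\<phi> z\<close>.\<close>

definition clark_density :: "complex \<Rightarrow> complex ^ 'n \<Rightarrow> real" where
  "clark_density \<alpha> z = Re ((\<alpha> + \<phi> z) / (\<alpha> - \<phi> z))"

lemma clark_radon: "\<alpha> \<in> sphere 0 1 \<Longrightarrow> positive_radon_on B (\<mu> \<alpha>)"
  using clark by (simp add: is_clark_measure_def)

lemma clark_poisson: "\<alpha> \<in> sphere 0 1 \<Longrightarrow> z \<in> D \<Longrightarrow> (\<integral>\<zeta>. poisson_szego C z \<zeta> \<partial>\<mu> \<alpha>) = clark_density \<alpha> z"
  using clark by (simp add: is_clark_measure_def clark_density_def)

text \<open>At \<open>\<rho> = 0\<close> the symmetry of the kernel makes it independent of the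
  boundary point, and its mean is \<open>1\<close>. So a Poisson integral at the origin is a total
  mass.\<close>

lemma poisson_zero:
  assumes "\<zeta> \<in> B"
  shows "poisson_szego C 0 \<zeta> = 1"
proof -
  have "1 = (\<integral>\<xi>. poisson_szego C 0 \<xi> \<partial>\<beta>)" using integral_poisson[OF zero_in_D] by simp
  also have "\<dots> = (\<integral>\<xi>. poisson_szego C 0 \<zeta> \<partial>\<beta>)"
  proof (rule Bochner_Integration.integral_cong[OF refl])
    fix \<xi> assume "\<xi> \<in> space \<beta>"
    then show "poisson_szego C 0 \<xi> = poisson_szego C 0 \<zeta>"
      using poisson_symmetric[of \<zeta> \<xi> 0] assms by simp
  qed
  also have "\<dots> = poisson_szego C 0 \<zeta>" using prob_space by simp
  finally show ?thesis by simp
qed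

lemma clark_mass:
  assumes "\<alpha> \<in> sphere 0 1"
  shows "measure (\<mu> \<alpha>) B = clark_density \<alpha> 0"
proof -
  have "clark_density \<alpha> 0 = (\<integral>\<zeta>. poisson_szego C 0 \<zeta> \<partial>\<mu> \<alpha>)" using clark_poisson[OF assms zero_in_D] by simp
  also have "\<dots> = (\<integral>\<zeta>. 1 \<partial>\<mu> \<alpha>)"
    using space_positive_radon_on[OF clark_radon[OF assms]] poisson_zero
    by (intro Bochner_Integration.integral_cong) auto
  finally show ?thesis using space_positive_radon_on[OF clark_radon[OF assms]] by simp
qed

lemma clark_density_continuous: "continuous_on (sphere 0 1 \<times> D) (\<lambda>(\<alpha>, z). clark_density \<alpha> z)"
proof -
  have "\<alpha> - \<phi> z \<noteq> 0" if "\<alpha> \<in> sphere 0 1" "z \<in> D" for \<alpha> z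
    using phi_disc[OF that(2)] that by auto
  moreover have "continuous_on (sphere 0 1 \<times> D) (\<lambda>x. \<phi> (snd x))"
    by (rule continuous_on_compose2[OF phi_continuous]) (auto intro!: continuous_intros)
  ultimately show ?thesis
    unfolding clark_density_def case_prod_unfold by (intro continuous_intros) auto
qed

lemma clark_density_continuous_B:
  assumes "0 \<le> \<rho>" "\<rho> < 1"
  shows "continuous_on (sphere 0 1 \<times> B) (\<lambda>(\<alpha>, \<xi>). clark_density \<alpha> (\<rho> *\<^sub>R \<xi>))"
proof -
  have "continuous_on (sphere 0 1 \<times> B) (\<lambda>x. case (fst x, \<rho> *\<^sub>R snd x) of (\<alpha>, z) \<Rightarrow> clark_density \<alpha> z)"
    by (rule continuous_on_compose2[OF clark_density_continuous])
      (use assms scaleR_in_D B_subset in \<open>auto intro!: continuous_intros\<close>)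
  then show ?thesis by (simp add: case_prod_unfold)
qed

lemma clark_density_pos: "\<alpha> \<in> sphere 0 1 \<Longrightarrow> z \<in> D \<Longrightarrow> 0 < clark_density \<alpha> z"
  using disc_poisson_pos phi_disc by (simp add: clark_density_def)

lemma clark_mass_le: "\<alpha> \<in> sphere 0 1 \<Longrightarrow> measure (\<mu> \<alpha>) B \<le> 1 / (1 - cmod (\<phi> 0))\<^sup>2"
  using disc_poisson_le phi_disc[OF zero_in_D] by (simp add: clark_mass clark_density_def)

text \<open>Fubini brings the Poisson integral of \<open>\<mu> \<alpha>\<close> at
  \<open>\<rho> *\<^sub>R \<xi>\<close> inside, where the defining property of the Clark measure
  evaluates it. The inner integral on the left is the one that approximates
  \<open>f \<zeta>\<close>.\<close>

lemma integral_poisson_Fubini: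
  fixes f :: "complex ^ 'n \<Rightarrow> complex"
  assumes f: "continuous_on B f" and \<alpha>: "\<alpha> \<in> sphere 0 1" and \<rho>: "0 \<le> \<rho>" "\<rho> < 1"
  shows "(\<integral>\<zeta>. (\<integral>\<xi>. of_real (poisson_szego C (\<rho> *\<^sub>R \<xi>) \<zeta>) * f \<xi> \<partial>\<beta>) \<partial>\<mu> \<alpha>) =
      (\<integral>\<xi>. f \<xi> * of_real (clark_density \<alpha> (\<rho> *\<^sub>R \<xi>)) \<partial>\<beta>)"
    and "integrable (\<mu> \<alpha>) (\<lambda>\<zeta>. \<integral>\<xi>. of_real (poisson_szego C (\<rho> *\<^sub>R \<xi>) \<zeta>) * f \<xi> \<partial>\<beta>)"
proof -
  have "continuous_on (B \<times> B) (\<lambda>x. case (\<rho> *\<^sub>R snd x, fst x) of (z, \<zeta>) \<Rightarrow> poisson_szego C z \<zeta>)"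
    by (rule continuous_on_compose2[OF poisson_continuous])
      (use \<rho> scaleR_in_D B_subset in \<open>auto intro!: continuous_intros\<close>)
  then have P: "continuous_on (B \<times> B) (\<lambda>x. poisson_szego C (\<rho> *\<^sub>R snd x) (fst x))" by simp
  have "continuous_on (B \<times> B) (\<lambda>x. f (snd x))"
    by (rule continuous_on_compose2[OF f]) (auto intro!: continuous_intros)
  with P have cont: "continuous_on (B \<times> B) (\<lambda>(\<zeta>, \<xi>). of_real (poisson_szego C (\<rho> *\<^sub>R \<xi>) \<zeta>) * f \<xi>)"
    unfolding case_prod_unfold by (intro continuous_intros)
  have "(\<integral>\<zeta>. (\<integral>\<xi>. of_real (poisson_szego C (\<rho> *\<^sub>R \<xi>) \<zeta>) * f \<xi> \<partial>\<beta>) \<partial>\<mu> \<alpha>) =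
      (\<integral>\<xi>. (\<integral>\<zeta>. of_real (poisson_szego C (\<rho> *\<^sub>R \<xi>) \<zeta>) * f \<xi> \<partial>\<mu> \<alpha>) \<partial>\<beta>)"
    by (rule positive_radon_on_Fubini[OF clark_radon[OF \<alpha>] compact_B radon compact_B cont])
  also have "\<dots> = (\<integral>\<xi>. f \<xi> * of_real (clark_density \<alpha> (\<rho> *\<^sub>R \<xi>)) \<partial>\<beta>)"
  proof (rule Bochner_Integration.integral_cong[OF refl])
    fix \<xi> assume "\<xi> \<in> space \<beta>"
    then have "\<rho> *\<^sub>R \<xi> \<in> D" using scaleR_in_D \<rho> B_subset by auto
    from clark_poisson[OF \<alpha> this]
    show "(\<integral>\<zeta>. of_real (poisson_szego C (\<rho> *\<^sub>R \<xi>) \<zeta>) * f \<xi> \<partial>\<mu> \<alpha>) = f \<xi> * of_real (clark_density \<alpha> (\<rho> *\<^sub>R \<xi>))"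
      by (simp add: mult.commute)
  qed
  finally show "(\<integral>\<zeta>. (\<integral>\<xi>. of_real (poisson_szego C (\<rho> *\<^sub>R \<xi>) \<zeta>) * f \<xi> \<partial>\<beta>) \<partial>\<mu> \<alpha>) =
      (\<integral>\<xi>. f \<xi> * of_real (clark_density \<alpha> (\<rho> *\<^sub>R \<xi>)) \<partial>\<beta>)" .
  show "integrable (\<mu> \<alpha>) (\<lambda>\<zeta>. \<integral>\<xi>. of_real (poisson_szego C (\<rho> *\<^sub>R \<xi>) \<zeta>) * f \<xi> \<partial>\<beta>)"
    by (intro positive_radon_on_integrable[OF clark_radon[OF \<alpha>] compact_B]
        continuous_on_integral_parameter[OF radon compact_B compact_B cont])
qed

text \<open>Uniformity in \<open>\<alpha>\<close> has two sources: the approximate identity is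
  uniform over \<open>B\<close>, and the masses of the Clark measures have a common bound.\<close>

lemma clark_uniform_limit:
  fixes f :: "complex ^ 'n \<Rightarrow> complex"
  assumes f: "continuous_on B f"
  shows "uniform_limit (sphere 0 1) (\<lambda>\<rho> \<alpha>. \<integral>\<xi>. f \<xi> * of_real (clark_density \<alpha> (\<rho> *\<^sub>R \<xi>)) \<partial>\<beta>)
    (\<lambda>\<alpha>. \<integral>\<zeta>. f \<zeta> \<partial>\<mu> \<alpha>) (at_left 1)"
  unfolding uniform_limit_iff
proof (intro allI impI)
  fix e :: real assume e: "e > 0"
  define M where "M = 1 / (1 - cmod (\<phi> 0))\<^sup>2"
  have M: "M > 0" using phi_disc[OF zero_in_D] by (simp add: M_def)
  obtain r where r: "0 \<le> r" "r < 1"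
    "\<And>\<rho> \<zeta>. r \<le> \<rho> \<Longrightarrow> \<rho> < 1 \<Longrightarrow> \<zeta> \<in> B \<Longrightarrow>
      cmod ((\<integral>\<xi>. of_real (poisson_szego C (\<rho> *\<^sub>R \<xi>) \<zeta>) * f \<xi> \<partial>\<beta>) - f \<zeta>) \<le> e / (2 * M)"
    using poisson_approximate_identity[OF f, of "e / (2 * M)"] e M by auto
  have "dist (\<integral>\<xi>. f \<xi> * of_real (clark_density \<alpha> (\<rho> *\<^sub>R \<xi>)) \<partial>\<beta>) (\<integral>\<zeta>. f \<zeta> \<partial>\<mu> \<alpha>) < e"
    if \<rho>: "r \<le> \<rho>" "\<rho> < 1" and \<alpha>: "\<alpha> \<in> sphere 0 1" for \<rho> \<alpha>
  proof -
    interpret m: finite_measure "\<mu> \<alpha>" using clark_radon[OF \<alpha>] by (simp add: positive_radon_on_def)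
    have \<rho>0: "0 \<le> \<rho>" using r \<rho> by simp
    note int = integral_poisson_Fubini(2)[OF f \<alpha> \<rho>0 \<rho>(2)]
    have intf: "integrable (\<mu> \<alpha>) f" by (rule positive_radon_on_integrable[OF clark_radon[OF \<alpha>] compact_B f])
    have "dist (\<integral>\<xi>. f \<xi> * of_real (clark_density \<alpha> (\<rho> *\<^sub>R \<xi>)) \<partial>\<beta>) (\<integral>\<zeta>. f \<zeta> \<partial>\<mu> \<alpha>) =
        cmod (\<integral>\<zeta>. (\<integral>\<xi>. of_real (poisson_szego C (\<rho> *\<^sub>R \<xi>) \<zeta>) * f \<xi> \<partial>\<beta>) - f \<zeta> \<partial>\<mu> \<alpha>)"
      unfolding Bochner_Integration.integral_diff[OF int intf]
        integral_poisson_Fubini(1)[OF f \<alpha> \<rho>0 \<rho>(2)] dist_norm ..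
    also have "\<dots> \<le> (\<integral>\<zeta>. cmod ((\<integral>\<xi>. of_real (poisson_szego C (\<rho> *\<^sub>R \<xi>) \<zeta>) * f \<xi> \<partial>\<beta>) - f \<zeta>) \<partial>\<mu> \<alpha>)"
      by (rule integral_norm_bound)
    also have "\<dots> \<le> (\<integral>\<zeta>. e / (2 * M) \<partial>\<mu> \<alpha>)"
      by (rule integral_mono)
        (use r(3)[OF \<rho>] int intf space_positive_radon_on[OF clark_radon[OF \<alpha>]] in auto)
    also have "\<dots> = measure (\<mu> \<alpha>) B * (e / (2 * M))"
      using space_positive_radon_on[OF clark_radon[OF \<alpha>]] by simp
    also have "\<dots> \<le> M * (e / (2 * M))"
      using clark_mass_le[OF \<alpha>] e M by (intro mult_right_mono) (auto simp: M_def)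
    also have "\<dots> < e" using M e by simp
    finally show ?thesis .
  qed
  then show "\<forall>\<^sub>F \<rho> in at_left 1. \<forall>\<alpha>\<in>sphere 0 1.
      dist (\<integral>\<xi>. f \<xi> * of_real (clark_density \<alpha> (\<rho> *\<^sub>R \<xi>)) \<partial>\<beta>) (\<integral>\<zeta>. f \<zeta> \<partial>\<mu> \<alpha>) < e"
    using r by (intro eventually_at_leftI[of r]) auto
qed

lemma eventually_unit_at_left: "\<forall>\<^sub>F \<rho> in at_left 1. 0 \<le> \<rho> \<and> \<rho> < (1::real)"
  by (rule eventually_at_leftI[of 0]) auto

lemma clark_density_integral_continuous:
  fixes f :: "complex ^ 'n \<Rightarrow> complex"
  assumes f: "continuous_on B f" and \<rho>: "0 \<le> \<rho>" "\<rho> < 1"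
  shows "continuous_on (sphere 0 1 \<times> B) (\<lambda>(\<alpha>, \<xi>). f \<xi> * of_real (clark_density \<alpha> (\<rho> *\<^sub>R \<xi>)))"
    and "continuous_on (sphere 0 1) (\<lambda>\<alpha>. \<integral>\<xi>. f \<xi> * of_real (clark_density \<alpha> (\<rho> *\<^sub>R \<xi>)) \<partial>\<beta>)"
proof -
  have "continuous_on (sphere 0 1 \<times> B) (\<lambda>x. f (snd x))"
    by (rule continuous_on_compose2[OF f]) (auto intro!: continuous_intros)
  with clark_density_continuous_B[OF \<rho>]
  show cont: "continuous_on (sphere 0 1 \<times> B) (\<lambda>(\<alpha>, \<xi>). f \<xi> * of_real (clark_density \<alpha> (\<rho> *\<^sub>R \<xi>)))"
    unfolding case_prod_unfold by (intro continuous_intros)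
  show "continuous_on (sphere 0 1) (\<lambda>\<alpha>. \<integral>\<xi>. f \<xi> * of_real (clark_density \<alpha> (\<rho> *\<^sub>R \<xi>)) \<partial>\<beta>)"
    by (rule continuous_on_integral_parameter[OF radon compact_B compact_sphere cont])
qed

lemma clark_continuous:
  fixes f :: "complex ^ 'n \<Rightarrow> complex"
  assumes f: "continuous_on B f"
  shows "continuous_on (sphere 0 1) (\<lambda>\<alpha>. \<integral>\<zeta>. f \<zeta> \<partial>\<mu> \<alpha>)"
proof (rule uniform_limit_theorem[OF _ clark_uniform_limit[OF f]])
  show "\<forall>\<^sub>F \<rho> in at_left 1. continuous_on (sphere 0 1) (\<lambda>\<alpha>. \<integral>\<xi>. f \<xi> * of_real (clark_density \<alpha> (\<rho> *\<^sub>R \<xi>)) \<partial>\<beta>)"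
    using eventually_unit_at_left by eventually_elim (rule clark_density_integral_continuous(2)[OF f], auto)
qed simp

text \<open>Uniform convergence allows integration against the weight \<open>w\<close>. After Fubini
  the weight meets the Poisson kernel at a fixed point of the disc, and that integral is explicit
  for the constant \<open>1\<close> and for \<open>cnj\<close>.\<close>

lemma clark_weighted_limit:
  fixes f :: "complex ^ 'n \<Rightarrow> complex"
  assumes f: "continuous_on B f" and w: "continuous_on (sphere 0 1) w"
  shows "((\<lambda>\<rho>. \<integral>\<xi>. f \<xi> * (\<integral>\<alpha>. w \<alpha> * of_real (clark_density \<alpha> (\<rho> *\<^sub>R \<xi>)) \<partial>haar_circle) \<partial>\<beta>) \<longlongrightarrow>
    (\<integral>\<alpha>. w \<alpha> * (\<integral>\<zeta>. f \<zeta> \<partial>\<mu> \<alpha>) \<partial>haar_circle)) (at_left 1)"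
proof -
  interpret h: prob_space haar_circle by (rule prob_space_haar_circle)
  obtain K where K: "\<And>\<alpha>. \<alpha> \<in> sphere 0 1 \<Longrightarrow> cmod (w \<alpha>) \<le> K" "K > 0"
    using compact_imp_bounded[OF compact_continuous_image[OF w compact_sphere]]
    by (metis bounded_pos imageI)
  define A where "A = (\<lambda>\<rho> \<alpha>. \<integral>\<xi>. f \<xi> * of_real (clark_density \<alpha> (\<rho> *\<^sub>R \<xi>)) \<partial>\<beta>)"
  define L where "L = (\<lambda>\<alpha>. \<integral>\<zeta>. f \<zeta> \<partial>\<mu> \<alpha>)"
  have unif: "uniform_limit (sphere 0 1) A L (at_left 1)"
    unfolding A_def L_def by (rule clark_uniform_limit[OF f])
  have "((\<lambda>\<rho>. \<integral>\<alpha>. w \<alpha> * A \<rho> \<alpha> \<partial>haar_circle) \<longlongrightarrow> (\<integral>\<alpha>. w \<alpha> * L \<alpha> \<partial>haar_circle)) (at_left 1)"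
    unfolding tendsto_iff
  proof (intro allI impI)
    fix e :: real assume e: "e > 0"
    have "\<forall>\<^sub>F \<rho> in at_left 1. \<forall>\<alpha>\<in>sphere 0 1. dist (A \<rho> \<alpha>) (L \<alpha>) < e / (2 * K)"
      using unif e K unfolding uniform_limit_iff by auto
    with eventually_unit_at_left
    show "\<forall>\<^sub>F \<rho> in at_left 1. dist (\<integral>\<alpha>. w \<alpha> * A \<rho> \<alpha> \<partial>haar_circle) (\<integral>\<alpha>. w \<alpha> * L \<alpha> \<partial>haar_circle) < e"
    proof eventually_elim
      case (elim \<rho>)
      have int: "integrable haar_circle (\<lambda>\<alpha>. w \<alpha> * A \<rho> \<alpha>)" "integrable haar_circle (\<lambda>\<alpha>. w \<alpha> * L \<alpha>)"
        unfolding A_def L_def using elim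
        by (intro haar_circle_integrable continuous_intros w clark_density_integral_continuous(2)[OF f] clark_continuous[OF f]; simp)+
      have "dist (\<integral>\<alpha>. w \<alpha> * A \<rho> \<alpha> \<partial>haar_circle) (\<integral>\<alpha>. w \<alpha> * L \<alpha> \<partial>haar_circle) =
          cmod (\<integral>\<alpha>. w \<alpha> * A \<rho> \<alpha> - w \<alpha> * L \<alpha> \<partial>haar_circle)"
        unfolding Bochner_Integration.integral_diff[OF int] dist_norm ..
      also have "\<dots> \<le> (\<integral>\<alpha>. cmod (w \<alpha> * A \<rho> \<alpha> - w \<alpha> * L \<alpha>) \<partial>haar_circle)"
        by (rule integral_norm_bound)
      also have "\<dots> \<le> (\<integral>\<alpha>. K * (e / (2 * K)) \<partial>haar_circle)"
      proof (rule integral_mono)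
        fix \<alpha> assume "\<alpha> \<in> space haar_circle"
        then have \<alpha>: "\<alpha> \<in> sphere 0 1" by (simp only: space_haar_circle)
        have "cmod (w \<alpha> * A \<rho> \<alpha> - w \<alpha> * L \<alpha>) = cmod (w \<alpha>) * dist (A \<rho> \<alpha>) (L \<alpha>)"
          by (simp add: dist_norm norm_mult flip: right_diff_distrib)
        also have "\<dots> \<le> K * (e / (2 * K))"
          using elim \<alpha> K by (intro mult_mono) (auto intro: less_imp_le)
        finally show "cmod (w \<alpha> * A \<rho> \<alpha> - w \<alpha> * L \<alpha>) \<le> K * (e / (2 * K))" .
      qed (use int in auto)
      also have "\<dots> < e" using K e h.prob_space by simp
      finally show ?case .
    qed
  qed
  moreover have "\<forall>\<^sub>F \<rho> in at_left 1. (\<integral>\<alpha>. w \<alpha> * A \<rho> \<alpha> \<partial>haar_circle) =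
      (\<integral>\<xi>. f \<xi> * (\<integral>\<alpha>. w \<alpha> * of_real (clark_density \<alpha> (\<rho> *\<^sub>R \<xi>)) \<partial>haar_circle) \<partial>\<beta>)"
    using eventually_unit_at_left
  proof eventually_elim
    case (elim \<rho>)
    have "continuous_on (sphere 0 1 \<times> B) (\<lambda>x. w (fst x))"
      by (rule continuous_on_compose2[OF w]) (auto intro!: continuous_intros)
    from continuous_on_mult[OF this clark_density_integral_continuous(1)[OF f, of \<rho>, unfolded case_prod_unfold]] elim
    have cont: "continuous_on (sphere 0 1 \<times> B) (\<lambda>(\<alpha>, \<xi>). w \<alpha> * (f \<xi> * of_real (clark_density \<alpha> (\<rho> *\<^sub>R \<xi>))))"
      by (simp add: case_prod_unfold)
    have "(\<integral>\<alpha>. w \<alpha> * A \<rho> \<alpha> \<partial>haar_circle) =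
        (\<integral>\<alpha>. (\<integral>\<xi>. w \<alpha> * (f \<xi> * of_real (clark_density \<alpha> (\<rho> *\<^sub>R \<xi>))) \<partial>\<beta>) \<partial>haar_circle)"
      unfolding A_def integral_mult_right_zero ..
    also have "\<dots> = (\<integral>\<xi>. (\<integral>\<alpha>. w \<alpha> * (f \<xi> * of_real (clark_density \<alpha> (\<rho> *\<^sub>R \<xi>))) \<partial>haar_circle) \<partial>\<beta>)"
      by (rule positive_radon_on_Fubini[OF positive_radon_on_haar_circle compact_sphere radon compact_B cont])
    also have "\<dots> = (\<integral>\<xi>. f \<xi> * (\<integral>\<alpha>. w \<alpha> * of_real (clark_density \<alpha> (\<rho> *\<^sub>R \<xi>)) \<partial>haar_circle) \<partial>\<beta>)"
      by (subst mult.left_commute) (simp only: integral_mult_right_zero)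
    finally show ?case .
  qed
  ultimately show ?thesis
    unfolding L_def by (rule Lim_transform_eventually)
qed

lemma clark_vague_integral:
  fixes f :: "complex ^ 'n \<Rightarrow> complex"
  assumes f: "continuous_on B f"
  shows "(\<integral>\<alpha>. (\<integral>\<zeta>. f \<zeta> \<partial>\<mu> \<alpha>) \<partial>haar_circle) = (\<integral>\<zeta>. f \<zeta> \<partial>\<beta>)"
proof -
  have "\<forall>\<^sub>F \<rho> in at_left 1. (\<integral>\<xi>. f \<xi> * (\<integral>\<alpha>. 1 * of_real (clark_density \<alpha> (\<rho> *\<^sub>R \<xi>)) \<partial>haar_circle) \<partial>\<beta>) = (\<integral>\<zeta>. f \<zeta> \<partial>\<beta>)"
    using eventually_unit_at_left
  proof eventually_elim
    case (elim \<rho>)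
    have "(\<integral>\<alpha>. of_real (clark_density \<alpha> (\<rho> *\<^sub>R \<xi>)) \<partial>haar_circle) = (1 :: complex)" if "\<xi> \<in> B" for \<xi>
      unfolding clark_density_def using that elim scaleR_in_D B_subset
      by (intro haar_circle_disc_poisson(1) phi_disc) auto
    then show ?case by (intro Bochner_Integration.integral_cong) auto
  qed
  with clark_weighted_limit[OF f continuous_on_const, of 1]
  have "((\<lambda>\<rho>. \<integral>\<zeta>. f \<zeta> \<partial>\<beta>) \<longlongrightarrow> (\<integral>\<alpha>. 1 * (\<integral>\<zeta>. f \<zeta> \<partial>\<mu> \<alpha>) \<partial>haar_circle)) (at_left (1::real))"
    by (rule Lim_transform_eventually)
  then show ?thesis by (simp add: tendsto_const_iff)
qed

text \<open>A vague form of the identity for the conjugate boundary value, left as a limit over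
  dilates; it is restated with boundary values where radial limits are assumed.\<close>

lemma clark_cnj_limit:
  fixes f :: "complex ^ 'n \<Rightarrow> complex"
  assumes f: "continuous_on B f"
  shows "((\<lambda>\<rho>. \<integral>\<xi>. f \<xi> * cnj (\<phi> (\<rho> *\<^sub>R \<xi>)) \<partial>\<beta>) \<longlongrightarrow>
    (\<integral>\<alpha>. cnj \<alpha> * (\<integral>\<zeta>. f \<zeta> \<partial>\<mu> \<alpha>) \<partial>haar_circle)) (at_left 1)"
proof -
  have "\<forall>\<^sub>F \<rho> in at_left 1. (\<integral>\<xi>. f \<xi> * (\<integral>\<alpha>. cnj \<alpha> * of_real (clark_density \<alpha> (\<rho> *\<^sub>R \<xi>)) \<partial>haar_circle) \<partial>\<beta>) =
      (\<integral>\<xi>. f \<xi> * cnj (\<phi> (\<rho> *\<^sub>R \<xi>)) \<partial>\<beta>)"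
    using eventually_unit_at_left
  proof eventually_elim
    case (elim \<rho>)
    have "(\<integral>\<alpha>. cnj \<alpha> * of_real (clark_density \<alpha> (\<rho> *\<^sub>R \<xi>)) \<partial>haar_circle) = cnj (\<phi> (\<rho> *\<^sub>R \<xi>))" if "\<xi> \<in> B" for \<xi>
      unfolding clark_density_def using that elim scaleR_in_D B_subset
      by (intro haar_circle_disc_poisson(2) phi_disc) auto
    then show ?case by (intro Bochner_Integration.integral_cong) auto
  qed
  with clark_weighted_limit[OF f continuous_on_cnj[OF continuous_on_id]]
  show ?thesis by (rule Lim_transform_eventually)
qed

end

section \<open>Mixtures of Radon measures\<close>

lemma borel_measurable_completion_AE:
  fixes f g :: "'a \<Rightarrow> 'b::topological_space"
  assumes g: "g \<in> borel_measurable M" and eq: "AE x in M. f x = g x"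
  shows "f \<in> borel_measurable (completion M)"
proof (rule measurableI)
  fix A :: "'b set" assume "A \<in> sets borel"
  then have "g -` A \<inter> space M \<in> sets (completion M)" using g by auto
  moreover have "AE x in completion M. (x \<in> g -` A \<inter> space M) = (x \<in> f -` A \<inter> space M)"
    using AE_completion[OF eq] by eventually_elim auto
  ultimately show "f -` A \<inter> space (completion M) \<in> sets (completion M)"
    using completion.in_sets_AE[of "g -` A \<inter> space M" "f -` A \<inter> space M" M] by simp
qed simp

lemma completion_integral_AE:
  fixes f g :: "'a \<Rightarrow> 'b::{banach,second_countable_topology}"
  assumes g: "g \<in> borel_measurable M" and eq: "AE x in M. f x = g x"
  shows "integrable (completion M) f \<longleftrightarrow> integrable M g"
    and "integral\<^sup>L (completion M) f = integral\<^sup>L M g"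
proof -
  note f = borel_measurable_completion_AE[OF assms]
  have "integrable (completion M) f \<longleftrightarrow> integrable (completion M) g"
    by (rule integrable_cong_AE[OF f measurable_completion[OF g] AE_completion[OF eq]])
  then show "integrable (completion M) f \<longleftrightarrow> integrable M g"
    using integrable_completion[OF g] by simp
  have "integral\<^sup>L (completion M) f = integral\<^sup>L (completion M) g"
    by (rule integral_cong_AE[OF f measurable_completion[OF g] AE_completion[OF eq]])
  then show "integral\<^sup>L (completion M) f = integral\<^sup>L M g"
    using integral_completion[OF g] by simp
qed

lemma completion_ex_borel_measurable_complex:
  fixes f :: "'a \<Rightarrow> complex"
  assumes "f \<in> borel_measurable (completion M)"
  obtains g where "g \<in> borel_measurable M" "AE x in M. f x = g x"
proof -
  obtain u where u: "u \<in> borel_measurable M" "AE x in M. Re (f x) = u x"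
    using completion_ex_borel_measurable_real[of "\<lambda>x. Re (f x)" M] assms by auto
  obtain v where v: "v \<in> borel_measurable M" "AE x in M. Im (f x) = v x"
    using completion_ex_borel_measurable_real[of "\<lambda>x. Im (f x)" M] assms by auto
  have "(\<lambda>x. of_real (u x) + \<i> * of_real (v x)) \<in> borel_measurable M"
    using u v by measurable
  moreover have "AE x in M. f x = of_real (u x) + \<i> * of_real (v x)"
    using u(2) v(2) by eventually_elim (simp add: complex_eq_iff)
  ultimately show ?thesis by (rule that)
qed

text \<open>A decomposition of \<open>M\<close> known only on continuous functions. Measurability in
  \<open>y\<close> of the mass of a fixed Borel set and the formula for general integrands have to
  be derived; the common mass bound \<open>m\<close> supplies the dominating constants.\<close>

locale radon_mixture = finite_measure N
  for N :: "'b measure" +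
  fixes X :: "'a::euclidean_space set" and M and \<kappa> :: "'b \<Rightarrow> 'a measure" and m :: real
  assumes compact_X: "compact X" and M: "positive_radon_on X M"
    and kernel: "y \<in> space N \<Longrightarrow> positive_radon_on X (\<kappa> y)"
    and mass: "y \<in> space N \<Longrightarrow> measure (\<kappa> y) X \<le> m"
    and mixture_measurable:
      "continuous_on X (f :: 'a \<Rightarrow> complex) \<Longrightarrow> (\<lambda>y. \<integral>x. f x \<partial>\<kappa> y) \<in> borel_measurable N"
    and mixture:
      "continuous_on X (f :: 'a \<Rightarrow> complex) \<Longrightarrow> (\<integral>y. (\<integral>x. f x \<partial>\<kappa> y) \<partial>N) = (\<integral>x. f x \<partial>M)"
begin

lemma space_M: "space M = X"
  using M by (rule space_positive_radon_on)

lemma space_kernel: "y \<in> space N \<Longrightarrow> space (\<kappa> y) = X"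
  using kernel by (rule space_positive_radon_on)

lemma sets_kernel: "y \<in> space N \<Longrightarrow> sets (\<kappa> y) = sets M"
  using kernel M by (simp add: positive_radon_on_def)

lemma finite_kernel: "y \<in> space N \<Longrightarrow> finite_measure (\<kappa> y)"
  using kernel by (simp add: positive_radon_on_def)

lemma measurable_kernel: "y \<in> space N \<Longrightarrow> f \<in> M \<rightarrow>\<^sub>M L \<Longrightarrow> f \<in> \<kappa> y \<rightarrow>\<^sub>M L"
  using sets_kernel measurable_cong_sets by blast

lemma sets_Int_X: "A \<in> sets borel \<Longrightarrow> A \<inter> X \<in> sets M"
  using M by (auto simp: positive_radon_on_def sets_restrict_space)

lemma mixture_real:
  assumes "continuous_on X (f :: 'a \<Rightarrow> real)"
  shows "(\<lambda>y. \<integral>x. f x \<partial>\<kappa> y) \<in> borel_measurable N"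
    and "(\<integral>y. (\<integral>x. f x \<partial>\<kappa> y) \<partial>N) = (\<integral>x. f x \<partial>M)"
proof -
  have f: "continuous_on X (\<lambda>x. complex_of_real (f x))"
    using assms by (intro continuous_intros)
  have "(\<lambda>y. Re (\<integral>x. complex_of_real (f x) \<partial>\<kappa> y)) \<in> borel_measurable N"
    using mixture_measurable[OF f] by measurable
  then show "(\<lambda>y. \<integral>x. f x \<partial>\<kappa> y) \<in> borel_measurable N" by simp
  show "(\<integral>y. (\<integral>x. f x \<partial>\<kappa> y) \<partial>N) = (\<integral>x. f x \<partial>M)"
    using mixture[OF f] by simp
qed

lemma closed_mixture:
  assumes A: "closed A"
  shows "(\<lambda>y. measure (\<kappa> y) (A \<inter> X)) \<in> borel_measurable N"
    and "(\<integral>y. measure (\<kappa> y) (A \<inter> X) \<partial>N) = measure M (A \<inter> X)"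
proof -
  \<comment> \<open>Continuous functions decreasing to the indicator of \<open>A\<close>. The empty
    set is treated apart because \<open>infdist\<close> to it is \<open>0\<close> by convention, and
    the formula would give the constant \<open>1\<close>.\<close>
  define f where "f = (\<lambda>n x. if A = {} then 0 else max 0 (1 - real n * infdist x A))"
  have cont: "continuous_on X (f n)" for n
    unfolding f_def by (cases "A = {}") (auto intro!: continuous_intros)
  have bound: "\<bar>f n x\<bar> \<le> 1" for n x
    by (auto simp: f_def infdist_nonneg)
  have lim: "(\<lambda>n. f n x) \<longlonglongrightarrow> indicator A x" for x
  proof (cases "x \<in> A")
    case True
    then have "f n x = 1" for n by (auto simp: f_def)
    then show ?thesis using True by simp
  next
    case False
    show ?thesis
    proof (cases "A = {}")
      case False
      with A \<open>x \<notin> A\<close> have d: "infdist x A > 0"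
        by (metis in_closed_iff_infdist_zero infdist_nonneg less_eq_real_def)
      obtain n0 where n0: "1 < real n0 * infdist x A" using ex_less_of_nat_mult[OF d] by blast
      have "f n x = 0" if "n \<ge> n0" for n
      proof -
        have "real n0 * infdist x A \<le> real n * infdist x A" using that d by (intro mult_right_mono) auto
        then show ?thesis using n0 False by (simp add: f_def)
      qed
      then have "\<forall>\<^sub>F n in sequentially. f n x = indicator A x"
        using \<open>x \<notin> A\<close> by (auto simp: eventually_sequentially)
      then show ?thesis by (rule tendsto_eventually)
    qed (simp add: f_def)
  qed
  have lim_int: "(\<lambda>n. \<integral>x. f n x \<partial>L) \<longlonglongrightarrow> measure L (A \<inter> X)" if L: "positive_radon_on X L" for L
  proof -
    interpret L: finite_measure L using L by (simp add: positive_radon_on_def)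
    have "(\<lambda>n. \<integral>x. f n x \<partial>L) \<longlonglongrightarrow> (\<integral>x. indicator A x \<partial>L)"
    proof (rule integral_dominated_convergence[where w="\<lambda>_. 1"])
      show "(indicator A :: 'a \<Rightarrow> real) \<in> borel_measurable L"
        using A by (intro positive_radon_on_borel_measurable[OF L]) auto
      show "f n \<in> borel_measurable L" for n
        by (rule positive_radon_on_continuous_measurable[OF L cont])
    qed (use lim bound in auto)
    also have "(\<integral>x. indicator A x \<partial>L) = measure L (A \<inter> X)"
      using space_positive_radon_on[OF L] by simp
    finally show ?thesis .
  qed
  note lim_kernel = lim_int[OF kernel]
  show meas: "(\<lambda>y. measure (\<kappa> y) (A \<inter> X)) \<in> borel_measurable N"
    by (rule borel_measurable_LIMSEQ_metric[OF mixture_real(1)[OF cont] lim_kernel])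
  have "(\<lambda>n. \<integral>y. (\<integral>x. f n x \<partial>\<kappa> y) \<partial>N) \<longlonglongrightarrow> (\<integral>y. measure (\<kappa> y) (A \<inter> X) \<partial>N)"
  proof (rule integral_dominated_convergence[where w="\<lambda>_. m"])
    show "AE y in N. norm (\<integral>x. f n x \<partial>\<kappa> y) \<le> m" for n
    proof (rule AE_I2)
      fix y assume y: "y \<in> space N"
      interpret K: finite_measure "\<kappa> y" by (rule finite_kernel[OF y])
      have "norm (\<integral>x. f n x \<partial>\<kappa> y) \<le> (\<integral>x. norm (f n x) \<partial>\<kappa> y)" by (rule integral_norm_bound)
      also have "\<dots> \<le> (\<integral>x. 1 \<partial>\<kappa> y)"
        using bound positive_radon_on_integrable[OF kernel[OF y] compact_X cont]
        by (intro integral_mono) auto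
      also have "\<dots> \<le> m" using mass[OF y] space_kernel[OF y] by simp
      finally show "norm (\<integral>x. f n x \<partial>\<kappa> y) \<le> m" .
    qed
  qed (use meas mixture_real(1)[OF cont] lim_kernel in auto)
  then have "(\<lambda>n. \<integral>x. f n x \<partial>M) \<longlonglongrightarrow> (\<integral>y. measure (\<kappa> y) (A \<inter> X) \<partial>N)"
    by (simp add: mixture_real(2)[OF cont])
  with lim_int[OF M] show "(\<integral>y. measure (\<kappa> y) (A \<inter> X) \<partial>N) = measure M (A \<inter> X)"
    using LIMSEQ_unique by blast
qed

text \<open>Dynkin's lemma from the intersection-stable closed sets. Writing
  \<open>A \<inter> X\<close> lets the induction run over the Borel sets of the ambient space while
  the measures live on \<open>X\<close>.\<close>

lemma emeasure_mixture_Int: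
  assumes "A \<in> sets borel"
  shows "(\<lambda>y. emeasure (\<kappa> y) (A \<inter> X)) \<in> borel_measurable N \<and>
    (\<integral>\<^sup>+y. emeasure (\<kappa> y) (A \<inter> X) \<partial>N) = emeasure M (A \<inter> X)"
proof -
  interpret M: finite_measure M using M by (simp add: positive_radon_on_def)
  have closed: "(\<lambda>y. emeasure (\<kappa> y) (A \<inter> X)) \<in> borel_measurable N \<and>
    (\<integral>\<^sup>+y. emeasure (\<kappa> y) (A \<inter> X) \<partial>N) = emeasure M (A \<inter> X)" if "closed A" for A
  proof -
    have eq: "emeasure (\<kappa> y) (A \<inter> X) = ennreal (measure (\<kappa> y) (A \<inter> X))" if "y \<in> space N" for y
      using finite_measure.emeasure_eq_measure[OF finite_kernel[OF that]] .
    have "(\<lambda>y. ennreal (measure (\<kappa> y) (A \<inter> X))) \<in> borel_measurable N"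
      using closed_mixture(1)[OF that] by measurable
    then have meas: "(\<lambda>y. emeasure (\<kappa> y) (A \<inter> X)) \<in> borel_measurable N"
      using eq by (subst measurable_cong) auto
    have "measure (\<kappa> y) (A \<inter> X) \<le> m" if y: "y \<in> space N" for y
    proof -
      interpret K: finite_measure "\<kappa> y" by (rule finite_kernel[OF y])
      show ?thesis using K.bounded_measure[of "A \<inter> X"] mass[OF y] space_kernel[OF y] by simp
    qed
    then have "integrable N (\<lambda>y. measure (\<kappa> y) (A \<inter> X))"
      by (intro integrable_const_bound[where B=m] closed_mixture(1)[OF that]) auto
    then have "(\<integral>\<^sup>+y. ennreal (measure (\<kappa> y) (A \<inter> X)) \<partial>N) = ennreal (measure M (A \<inter> X))"
      by (subst nn_integral_eq_integral) (auto simp: closed_mixture(2)[OF that])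
    then have "(\<integral>\<^sup>+y. emeasure (\<kappa> y) (A \<inter> X) \<partial>N) = emeasure M (A \<inter> X)"
      using eq by (simp add: M.emeasure_eq_measure cong: nn_integral_cong)
    with meas show ?thesis by simp
  qed
  have "Int_stable (Collect closed :: 'a set set)" "Collect closed \<subseteq> Pow (UNIV :: 'a set)"
    by (auto simp: Int_stable_def)
  moreover have borel: "sets borel = sigma_sets UNIV (Collect closed :: 'a set set)"
    by (simp add: borel_eq_closed)
  then have "A \<in> sigma_sets UNIV (Collect closed)" using assms by simp
  ultimately show ?thesis
  proof (induction rule: sigma_sets_induct_disjoint)
    case (basic A)
    then show ?case using closed[of A] by simp
  next
    case empty
    show ?case by simp
  next
    case (compl A)
    have A: "A \<in> sets borel" using compl borel by simp
    have Diff: "emeasure L ((UNIV - A) \<inter> X) = emeasure L X - emeasure L (A \<inter> X)"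
      if L: "positive_radon_on X L" for L
    proof -
      interpret L: finite_measure L using L by (simp add: positive_radon_on_def)
      have "A \<inter> X \<in> sets L"
        using L A by (auto simp: positive_radon_on_def sets_restrict_space)
      moreover have "(UNIV - A) \<inter> X = space L - A \<inter> X"
        using space_positive_radon_on[OF L] by auto
      ultimately show ?thesis
        using emeasure_compl[of "A \<inter> X" L] space_positive_radon_on[OF L] by simp
    qed
    \<comment> \<open>\<open>X\<close> itself is closed, so the closed case covers the total masses;
      as all masses involved are finite, complements reduce to subtraction.\<close>
    have X: "(\<lambda>y. emeasure (\<kappa> y) X) \<in> borel_measurable N" "(\<integral>\<^sup>+y. emeasure (\<kappa> y) X \<partial>N) = emeasure M X"
      using closed[of X] compact_imp_closed[OF compact_X] by auto
    have "(\<lambda>y. emeasure (\<kappa> y) X - emeasure (\<kappa> y) (A \<inter> X)) \<in> borel_measurable N"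
      by (rule borel_measurable_minus_ennreal[OF X(1) conjunct1[OF compl.IH]])
    then have "(\<lambda>y. emeasure (\<kappa> y) ((UNIV - A) \<inter> X)) \<in> borel_measurable N"
      using Diff[OF kernel] by (subst measurable_cong) auto
    moreover have "(\<integral>\<^sup>+y. emeasure (\<kappa> y) ((UNIV - A) \<inter> X) \<partial>N) =
        (\<integral>\<^sup>+y. emeasure (\<kappa> y) X - emeasure (\<kappa> y) (A \<inter> X) \<partial>N)"
      by (intro nn_integral_cong Diff[OF kernel])
    moreover have "\<dots> = (\<integral>\<^sup>+y. emeasure (\<kappa> y) X \<partial>N) - (\<integral>\<^sup>+y. emeasure (\<kappa> y) (A \<inter> X) \<partial>N)"
    proof (rule nn_integral_diff)
      show "AE y in N. emeasure (\<kappa> y) (A \<inter> X) \<le> emeasure (\<kappa> y) X"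
        using sets_kernel sets_Int_X[of UNIV] by (intro AE_I2 emeasure_mono) auto
      show "(\<integral>\<^sup>+y. emeasure (\<kappa> y) (A \<inter> X) \<partial>N) \<noteq> \<infinity>"
        using compl by simp
    qed (use X compl in auto)
    ultimately show ?case using X compl Diff[OF M] by simp
  next
    case (union A)
    have A: "A i \<in> sets borel" for i using union borel by auto
    have disj: "disjoint_family (\<lambda>i. A i \<inter> X)" using union by (auto simp: disjoint_family_on_def)
    have UN: "emeasure L ((\<Union>i. A i) \<inter> X) = (\<Sum>i. emeasure L (A i \<inter> X))"
      if L: "positive_radon_on X L" for L
    proof -
      have "range (\<lambda>i. A i \<inter> X) \<subseteq> sets L"
        using L A by (auto simp: positive_radon_on_def sets_restrict_space)
      from suminf_emeasure[OF this disj] show ?thesis by simp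
    qed
    have "(\<lambda>y. \<Sum>i. emeasure (\<kappa> y) (A i \<inter> X)) \<in> borel_measurable N"
      by (rule borel_measurable_suminf_order) (use union in auto)
    then have "(\<lambda>y. emeasure (\<kappa> y) ((\<Union>i. A i) \<inter> X)) \<in> borel_measurable N"
      using UN[OF kernel] by (subst measurable_cong) auto
    moreover have "(\<integral>\<^sup>+y. emeasure (\<kappa> y) ((\<Union>i. A i) \<inter> X) \<partial>N) =
        (\<integral>\<^sup>+y. (\<Sum>i. emeasure (\<kappa> y) (A i \<inter> X)) \<partial>N)"
      by (intro nn_integral_cong UN[OF kernel])
    moreover have "\<dots> = (\<Sum>i. \<integral>\<^sup>+y. emeasure (\<kappa> y) (A i \<inter> X) \<partial>N)"
      by (rule nn_integral_suminf) (use union in auto)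
    ultimately show ?case using union UN[OF M] by simp
  qed
qed

lemma emeasure_mixture:
  assumes "A \<in> sets M"
  shows "(\<lambda>y. emeasure (\<kappa> y) A) \<in> borel_measurable N"
    and "(\<integral>\<^sup>+y. emeasure (\<kappa> y) A \<partial>N) = emeasure M A"
proof -
  obtain A' where "A' \<in> sets borel" "A = A' \<inter> X"
    using assms M by (auto simp: positive_radon_on_def sets_restrict_space)
  then show "(\<lambda>y. emeasure (\<kappa> y) A) \<in> borel_measurable N" "(\<integral>\<^sup>+y. emeasure (\<kappa> y) A \<partial>N) = emeasure M A"
    using emeasure_mixture_Int by auto
qed

lemma nn_integral_mixture_aux:
  assumes "f \<in> borel_measurable M"
  shows "(\<lambda>y. \<integral>\<^sup>+x. f x \<partial>\<kappa> y) \<in> borel_measurable N \<and>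
    (\<integral>\<^sup>+y. (\<integral>\<^sup>+x. f x \<partial>\<kappa> y) \<partial>N) = (\<integral>\<^sup>+x. f x \<partial>M)"
  using assms
proof (induction rule: borel_measurable_induct)
  case (cong f g)
  have "(\<integral>\<^sup>+x. f x \<partial>\<kappa> y) = (\<integral>\<^sup>+x. g x \<partial>\<kappa> y)" if "y \<in> space N" for y
    using cong(3) space_kernel[OF that] space_M by (intro nn_integral_cong) auto
  moreover have "(\<integral>\<^sup>+x. f x \<partial>M) = (\<integral>\<^sup>+x. g x \<partial>M)" using cong(3) by (rule nn_integral_cong)
  ultimately show ?case using cong(4) by (simp cong: measurable_cong nn_integral_cong)
next
  case (set A)
  have "(\<integral>\<^sup>+x. indicator A x \<partial>\<kappa> y) = emeasure (\<kappa> y) A" if "y \<in> space N" for y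
    using set sets_kernel[OF that] by simp
  then show ?case using emeasure_mixture[OF set] set by (simp cong: measurable_cong nn_integral_cong)
next
  case (mult u c)
  have "(\<integral>\<^sup>+x. c * u x \<partial>\<kappa> y) = c * (\<integral>\<^sup>+x. u x \<partial>\<kappa> y)" if "y \<in> space N" for y
    using mult measurable_kernel[OF that] by (intro nn_integral_cmult) auto
  moreover have "(\<lambda>y. c * (\<integral>\<^sup>+x. u x \<partial>\<kappa> y)) \<in> borel_measurable N"
    by (rule borel_measurable_times_ennreal[OF borel_measurable_const]) (use mult in auto)
  ultimately show ?case using mult by (simp add: nn_integral_cmult cong: measurable_cong nn_integral_cong)
next
  case (add u v)
  have "(\<integral>\<^sup>+x. v x + u x \<partial>\<kappa> y) = (\<integral>\<^sup>+x. v x \<partial>\<kappa> y) + (\<integral>\<^sup>+x. u x \<partial>\<kappa> y)" if "y \<in> space N" for y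
    using add measurable_kernel[OF that] by (intro nn_integral_add) auto
  moreover have "(\<lambda>y. (\<integral>\<^sup>+x. v x \<partial>\<kappa> y) + (\<integral>\<^sup>+x. u x \<partial>\<kappa> y)) \<in> borel_measurable N"
    by (rule borel_measurable_add) (use add in auto)
  ultimately show ?case using add by (simp add: nn_integral_add cong: measurable_cong nn_integral_cong)
next
  case (seq U)
  have "(\<integral>\<^sup>+x. (SUP i. U i) x \<partial>\<kappa> y) = (SUP i. \<integral>\<^sup>+x. U i x \<partial>\<kappa> y)" if "y \<in> space N" for y
    using seq unfolding SUP_apply
    by (intro nn_integral_monotone_convergence_SUP) (auto intro: measurable_kernel[OF that])
  moreover have "(\<integral>\<^sup>+x. (SUP i. U i) x \<partial>M) = (SUP i. \<integral>\<^sup>+x. U i x \<partial>M)"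
    using seq unfolding SUP_apply by (intro nn_integral_monotone_convergence_SUP) auto
  moreover have "(\<integral>\<^sup>+y. (SUP i. \<integral>\<^sup>+x. U i x \<partial>\<kappa> y) \<partial>N) = (SUP i. \<integral>\<^sup>+y. (\<integral>\<^sup>+x. U i x \<partial>\<kappa> y) \<partial>N)"
    using seq by (intro nn_integral_monotone_convergence_SUP)
      (auto simp: incseq_def le_fun_def intro!: nn_integral_mono)
  moreover have "(\<lambda>y. SUP i. \<integral>\<^sup>+x. U i x \<partial>\<kappa> y) \<in> borel_measurable N"
    by (rule borel_measurable_SUP) (use seq in auto)
  ultimately show ?case using seq by (simp cong: measurable_cong nn_integral_cong)
qed

lemmas nn_integral_mixture_measurable = nn_integral_mixture_aux[THEN conjunct1]
  and nn_integral_mixture = nn_integral_mixture_aux[THEN conjunct2]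

text \<open>A null set of \<open>M\<close> has average mass zero, hence mass zero for almost every
  \<open>\<kappa> y\<close>. This is how almost everywhere statements for \<beta> reach the Clark
  measures.\<close>

lemma AE_mixture:
  assumes "AE x in M. Q x"
  shows "AE y in N. AE x in \<kappa> y. Q x"
proof -
  obtain A where A: "A \<in> null_sets M" "{x \<in> space M. \<not> Q x} \<subseteq> A"
    using assms by (auto simp: eventually_ae_filter)
  then have "(\<integral>\<^sup>+y. emeasure (\<kappa> y) A \<partial>N) = 0"
    using emeasure_mixture(2)[OF null_setsD2[OF A(1)]] null_setsD1[OF A(1)] by simp
  then have "AE y in N. emeasure (\<kappa> y) A = 0"
    using nn_integral_0_iff_AE[OF emeasure_mixture(1)[OF null_setsD2[OF A(1)]]] by simp
  with AE_space show ?thesis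
  proof eventually_elim
    case (elim y)
    then show "AE x in \<kappa> y. Q x"
      using A sets_kernel space_kernel space_M by (intro AE_I'[of A]) (auto simp: null_sets_def)
  qed
qed

lemma integrable_mixture_AE:
  fixes f :: "'a \<Rightarrow> 'c::{banach,second_countable_topology}"
  assumes f: "integrable M f"
  shows "AE y in N. integrable (\<kappa> y) f"
    and "integrable N (\<lambda>y. enn2real (\<integral>\<^sup>+x. norm (f x) \<partial>\<kappa> y))"
proof -
  have meas: "(\<lambda>x. ennreal (norm (f x))) \<in> borel_measurable M" using f by measurable
  have fin: "(\<integral>\<^sup>+y. (\<integral>\<^sup>+x. norm (f x) \<partial>\<kappa> y) \<partial>N) < \<infinity>"
    using f nn_integral_mixture[OF meas] by (simp add: integrable_iff_bounded)
  then have "AE y in N. (\<integral>\<^sup>+x. norm (f x) \<partial>\<kappa> y) \<noteq> \<infinity>"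
    by (intro nn_integral_noteq_infinite nn_integral_mixture_measurable[OF meas]) auto
  then show "AE y in N. integrable (\<kappa> y) f"
  proof (rule AE_mp, intro AE_I2 impI)
    fix y assume "y \<in> space N" "(\<integral>\<^sup>+x. norm (f x) \<partial>\<kappa> y) \<noteq> \<infinity>"
    then show "integrable (\<kappa> y) f"
      using measurable_kernel[OF _ borel_measurable_integrable[OF f]] by (intro integrableI_bounded) (auto simp: less_top)
  qed
  show "integrable N (\<lambda>y. enn2real (\<integral>\<^sup>+x. norm (f x) \<partial>\<kappa> y))"
  proof (rule integrableI_bounded)
    show "(\<lambda>y. enn2real (\<integral>\<^sup>+x. norm (f x) \<partial>\<kappa> y)) \<in> borel_measurable N"
      using nn_integral_mixture_measurable[OF meas] by measurable
    have "(\<integral>\<^sup>+y. norm (enn2real (\<integral>\<^sup>+x. norm (f x) \<partial>\<kappa> y)) \<partial>N) \<le> (\<integral>\<^sup>+y. (\<integral>\<^sup>+x. norm (f x) \<partial>\<kappa> y) \<partial>N)"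
      by (intro nn_integral_mono) (simp add: ennreal_enn2real_if)
    then show "(\<integral>\<^sup>+y. norm (enn2real (\<integral>\<^sup>+x. norm (f x) \<partial>\<kappa> y)) \<partial>N) < \<infinity>"
      using fin by (rule le_less_trans)
  qed
qed

text \<open>\<open>G\<close> is a version of the inner integral. At exceptional \<open>y\<close>,
  where \<open>f\<close> is not integrable, the Bochner integral has the default value
  \<open>0\<close>, so the induction tracks it only almost everywhere.\<close>

lemma integral_mixture:
  fixes f :: "'a \<Rightarrow> 'c::{banach,second_countable_topology}"
  assumes f: "integrable M f"
  obtains G where "integrable N G" "AE y in N. (\<integral>x. f x \<partial>\<kappa> y) = G y" "(\<integral>y. G y \<partial>N) = (\<integral>x. f x \<partial>M)"
proof -
  have "\<exists>G. integrable N G \<and> (AE y in N. (\<integral>x. f x \<partial>\<kappa> y) = G y) \<and> (\<integral>y. G y \<partial>N) = (\<integral>x. f x \<partial>M)"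
    using f
  proof (induction rule: integrable_induct)
    case (base A c)
    define G where "G = (\<lambda>y. enn2real (emeasure (\<kappa> y) A) *\<^sub>R c)"
    have "integrable M (\<lambda>x. indicator A x :: real)" using base by simp
    note int = integrable_mixture_AE(2)[OF this]
    have eq: "enn2real (\<integral>\<^sup>+x. norm (indicator A x :: real) \<partial>\<kappa> y) = enn2real (emeasure (\<kappa> y) A)"
      if "y \<in> space N" for y
      using base sets_kernel[OF that] by (simp add: ennreal_indicator)
    have int': "integrable N (\<lambda>y. enn2real (emeasure (\<kappa> y) A))"
      using int eq by (simp cong: Bochner_Integration.integrable_cong)
    have "(\<integral>y. enn2real (emeasure (\<kappa> y) A) \<partial>N) = enn2real (\<integral>\<^sup>+y. ennreal (enn2real (emeasure (\<kappa> y) A)) \<partial>N)"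
      using int' by (intro integral_eq_nn_integral) auto
    also have "(\<integral>\<^sup>+y. ennreal (enn2real (emeasure (\<kappa> y) A)) \<partial>N) = (\<integral>\<^sup>+y. emeasure (\<kappa> y) A \<partial>N)"
    proof (rule nn_integral_cong)
      fix y assume "y \<in> space N"
      then interpret K: finite_measure "\<kappa> y" by (rule finite_kernel)
      show "ennreal (enn2real (emeasure (\<kappa> y) A)) = emeasure (\<kappa> y) A"
        by (simp add: K.emeasure_eq_measure)
    qed
    also have "\<dots> = emeasure M A" by (rule emeasure_mixture(2)) fact
    finally have "(\<integral>y. G y \<partial>N) = (\<integral>x. indicator A x *\<^sub>R c \<partial>M)"
      using base sets.sets_into_space[OF base(1)] int' by (simp add: G_def measure_def inf.absorb1)
    moreover have "integrable N G" unfolding G_def using int' by (rule integrable_scaleR_left)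
    moreover have "AE y in N. (\<integral>x. indicator A x *\<^sub>R c \<partial>\<kappa> y) = G y"
    proof (rule AE_I2)
      fix y assume y: "y \<in> space N"
      then interpret K: finite_measure "\<kappa> y" by (rule finite_kernel)
      have "A \<inter> space (\<kappa> y) = A"
        using sets.sets_into_space[OF base(1)] space_kernel[OF y] space_M by auto
      moreover have "integrable (\<kappa> y) (indicator A :: 'a \<Rightarrow> real)"
        using base sets_kernel[OF y] by (intro integrable_real_indicator) (auto simp: K.emeasure_eq_measure)
      ultimately show "(\<integral>x. indicator A x *\<^sub>R c \<partial>\<kappa> y) = G y"
        by (simp add: G_def measure_def)
    qed
    ultimately show ?case by blast
  next
    case (add f g)
    then obtain F G where F: "integrable N F" "AE y in N. (\<integral>x. f x \<partial>\<kappa> y) = F y" "(\<integral>y. F y \<partial>N) = (\<integral>x. f x \<partial>M)"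
      and G: "integrable N G" "AE y in N. (\<integral>x. g x \<partial>\<kappa> y) = G y" "(\<integral>y. G y \<partial>N) = (\<integral>x. g x \<partial>M)"
      by blast
    have "AE y in N. (\<integral>x. f x + g x \<partial>\<kappa> y) = F y + G y"
      using F(2) G(2) integrable_mixture_AE(1)[OF add.hyps(1)] integrable_mixture_AE(1)[OF add.hyps(2)]
      by eventually_elim (simp add: Bochner_Integration.integral_add)
    then show ?case
      using F G add by (intro exI[of _ "\<lambda>y. F y + G y"]) (auto simp: Bochner_Integration.integral_add)
  next
    case (lim f s)
    then have "\<forall>i. \<exists>G. integrable N G \<and> (AE y in N. (\<integral>x. s i x \<partial>\<kappa> y) = G y) \<and> (\<integral>y. G y \<partial>N) = (\<integral>x. s i x \<partial>M)"
      by blast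
    then obtain G where G: "\<And>i. integrable N (G i)" "\<And>i. AE y in N. (\<integral>x. s i x \<partial>\<kappa> y) = G i y"
      "\<And>i. (\<integral>y. G i y \<partial>N) = (\<integral>x. s i x \<partial>M)"
      by metis
    \<comment> \<open>Being a pointwise \<open>lim\<close>, \<open>L\<close> is measurable by
      construction; the inner integral of \<open>f\<close> is identified with it almost
      everywhere.\<close>
    define L where "L = (\<lambda>y. lim (\<lambda>i. G i y))"
    \<comment> \<open>The induction provides \<open>norm (s i x) \<le> 2 * norm (f x)\<close>.
      Integrated over \<open>\<kappa> y\<close>, this dominates every \<open>G i\<close>, and
      \<open>integrable_mixture_AE\<close> makes the bound integrable over \<open>N\<close>.\<close>
    define W where "W = (\<lambda>y. enn2real (\<integral>\<^sup>+x. norm (2 *\<^sub>R f x) \<partial>\<kappa> y))"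
    have f2: "integrable M (\<lambda>x. 2 *\<^sub>R f x)" using lim by simp
    have intf: "AE y in N. y \<in> space N \<and> integrable (\<kappa> y) f \<and> (\<forall>i. integrable (\<kappa> y) (s i)) \<and> (\<forall>i. (\<integral>x. s i x \<partial>\<kappa> y) = G i y)"
      using integrable_mixture_AE(1)[OF lim.hyps(4)] integrable_mixture_AE(1)[OF lim.hyps(1)] G(2)
      by (auto simp: AE_all_countable)
    have conv: "AE y in N. (\<lambda>i. G i y) \<longlonglongrightarrow> (\<integral>x. f x \<partial>\<kappa> y) \<and> (\<forall>i. norm (G i y) \<le> W y)"
      using intf
    proof eventually_elim
      case (elim y)
      then have y: "y \<in> space N" by simp
      have meas: "s i \<in> borel_measurable (\<kappa> y)" for i
        using elim by (intro borel_measurable_integrable) simp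
      have "(\<lambda>i. \<integral>x. s i x \<partial>\<kappa> y) \<longlonglongrightarrow> (\<integral>x. f x \<partial>\<kappa> y)"
        by (rule integral_dominated_convergence[where w="\<lambda>x. 2 * norm (f x)"])
          (use elim meas lim.hyps(2,3) space_kernel[OF y] space_M in auto)
      moreover have "norm (\<integral>x. s i x \<partial>\<kappa> y) \<le> W y" for i
      proof -
        have "norm (\<integral>x. s i x \<partial>\<kappa> y) \<le> (\<integral>x. norm (s i x) \<partial>\<kappa> y)" by (rule integral_norm_bound)
        also have "\<dots> \<le> (\<integral>x. norm (2 *\<^sub>R f x) \<partial>\<kappa> y)"
          by (rule integral_mono) (use elim lim.hyps(3) space_kernel[OF y] space_M in auto)
        also have "\<dots> = W y"
          unfolding W_def using elim by (intro integral_eq_nn_integral) auto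
        finally show ?thesis .
      qed
      ultimately show ?case using elim by simp
    qed
    have *: "AE y in N. (\<lambda>i. G i y) \<longlonglongrightarrow> L y \<and> (\<integral>x. f x \<partial>\<kappa> y) = L y"
      using conv
    proof eventually_elim
      case (elim y)
      then have "lim (\<lambda>i. G i y) = (\<integral>x. f x \<partial>\<kappa> y)" by (intro limI) simp
      with elim show ?case by (simp add: L_def)
    qed
    then have L: "AE y in N. (\<lambda>i. G i y) \<longlonglongrightarrow> L y" "AE y in N. (\<integral>x. f x \<partial>\<kappa> y) = L y"
      by auto
    have measL: "L \<in> borel_measurable N"
      unfolding L_def using G(1) by (intro borel_measurable_lim_metric) auto
    have W: "integrable N W" unfolding W_def by (rule integrable_mixture_AE(2)[OF f2])
    have bound: "AE y in N. norm (G i y) \<le> W y" for i using conv by eventually_elim auto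
    have "integrable N L"
      by (rule integrable_dominated_convergence[OF measL _ W L(1) bound]) (use G(1) in auto)
    moreover have "(\<lambda>i. \<integral>y. G i y \<partial>N) \<longlonglongrightarrow> (\<integral>y. L y \<partial>N)"
      by (rule integral_dominated_convergence[OF measL _ W L(1) bound]) (use G(1) in auto)
    moreover have "(\<lambda>i. \<integral>x. s i x \<partial>M) \<longlonglongrightarrow> (\<integral>x. f x \<partial>M)"
      by (rule integral_dominated_convergence[where w="\<lambda>x. 2 * norm (f x)"]) (use lim in auto)
    ultimately have "(\<integral>y. L y \<partial>N) = (\<integral>x. f x \<partial>M)"
      unfolding G(3) by (intro LIMSEQ_unique)
    with \<open>integrable N L\<close> L(2) show ?case by blast
  qed
  then show ?thesis using that by blast
qed

text \<open>A Borel representative of \<open>f\<close> for \<open>M\<close> is also one for almost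
  every \<open>\<kappa> y\<close>, by \<open>AE_mixture\<close>; this reduces the claim to
  \<open>integral_mixture\<close>.\<close>

lemma integral_completion_mixture:
  fixes f :: "'a \<Rightarrow> complex"
  assumes f: "integrable (completion M) f"
  shows "AE y in N. integrable (completion (\<kappa> y)) f"
    and "integrable (completion N) (\<lambda>y. \<integral>x. f x \<partial>completion (\<kappa> y))"
    and "(\<integral>x. f x \<partial>completion M) = (\<integral>y. (\<integral>x. f x \<partial>completion (\<kappa> y)) \<partial>completion N)"
proof -
  obtain g where g: "g \<in> borel_measurable M" "AE x in M. f x = g x"
    using completion_ex_borel_measurable_complex[OF borel_measurable_integrable[OF f]] .
  have ig: "integrable M g" using completion_integral_AE(1)[OF g] f by simp
  obtain G where G: "integrable N G" "AE y in N. (\<integral>x. g x \<partial>\<kappa> y) = G y" "(\<integral>y. G y \<partial>N) = (\<integral>x. g x \<partial>M)"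
    using integral_mixture[OF ig] .
  have "AE y in N. y \<in> space N" by (rule AE_space)
  with AE_mixture[OF g(2)] integrable_mixture_AE(1)[OF ig] G(2)
  have *: "AE y in N. integrable (completion (\<kappa> y)) f \<and> (\<integral>x. f x \<partial>completion (\<kappa> y)) = G y"
  proof eventually_elim
    case (elim y)
    then show ?case
      using completion_integral_AE[OF measurable_kernel[OF _ g(1)], of y f] by simp
  qed
  then show "AE y in N. integrable (completion (\<kappa> y)) f" by auto
  have eq: "AE y in N. (\<integral>x. f x \<partial>completion (\<kappa> y)) = G y" using * by auto
  note C = completion_integral_AE[OF borel_measurable_integrable[OF G(1)] eq]
  show "integrable (completion N) (\<lambda>y. \<integral>x. f x \<partial>completion (\<kappa> y))" using C(1) G(1) by simp
  show "(\<integral>x. f x \<partial>completion M) = (\<integral>y. (\<integral>x. f x \<partial>completion (\<kappa> y)) \<partial>completion N)"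
    using C(2) G(3) completion_integral_AE(2)[OF g] by simp
qed

end

section \<open>Inner functions\<close>

lemma radial_limitD:
  assumes "radial_limit f \<zeta> = Some l"
  shows "((\<lambda>\<rho>. f (\<rho> *\<^sub>R \<zeta>)) \<longlongrightarrow> l) (at_left (1::real))"
proof -
  obtain l' where l': "((\<lambda>\<rho>. f (\<rho> *\<^sub>R \<zeta>)) \<longlongrightarrow> l') (at_left (1::real))"
    using assms by (auto simp: radial_limit_def split: if_splits)
  then have "Lim (at_left (1::real)) (\<lambda>\<rho>. f (\<rho> *\<^sub>R \<zeta>)) = l'"
    by (intro tendsto_Lim) auto
  then show ?thesis using assms l' by (auto simp: radial_limit_def split: if_splits)
qed

text \<open>The equality case of \<open>Re w \<le> cmod w\<close> for
  \<open>w = cnj a * b\<close>.\<close>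

lemma unit_eq_of_Re_cnj_mult:
  assumes "cmod a = 1" "cmod b = 1" "Re (cnj a * b) = 1"
  shows "b = a"
proof -
  have "cmod (cnj a * b) = 1" using assms by (simp add: norm_mult)
  then have "(Re (cnj a * b))\<^sup>2 + (Im (cnj a * b))\<^sup>2 = 1" by (metis cmod_power2 power_one)
  then have "Im (cnj a * b) = 0" using assms(3) by simp
  then have 1: "cnj a * b = 1" using assms(3) by (simp only: complex_eq_iff one_complex.sel simp_thms)
  have "a * cnj a = 1" using complex_norm_square[of a] assms(1) by (simp only: power_one of_real_1)
  then have "b = a * (cnj a * b)" by (simp only: mult.assoc[symmetric] mult_1)
  then show ?thesis using 1 by simp
qed

context clark_family
begin

sublocale mix: radon_mixture haar_circle B \<beta> \<mu> "1 / (1 - cmod (\<phi> 0))\<^sup>2"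
proof -
  interpret h: prob_space haar_circle by (rule prob_space_haar_circle)
  show "radon_mixture haar_circle B \<beta> \<mu> (1 / (1 - cmod (\<phi> 0))\<^sup>2)"
  proof
    fix f :: "complex ^ 'n \<Rightarrow> complex" assume f: "continuous_on B f"
    show "(\<lambda>y. \<integral>x. f x \<partial>\<mu> y) \<in> borel_measurable haar_circle"
      by (rule positive_radon_on_continuous_measurable[OF positive_radon_on_haar_circle clark_continuous[OF f]])
    show "(\<integral>y. (\<integral>x. f x \<partial>\<mu> y) \<partial>haar_circle) = (\<integral>x. f x \<partial>\<beta>)"
      by (rule clark_vague_integral[OF f])
  qed (use compact_B radon clark_radon clark_mass_le in \<open>simp_all only: space_haar_circle\<close>)
qed

text \<open>A sequence in place of the filter \<open>at_left 1\<close>, since dominated convergence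
  and measurability of limits are sequential.\<close>

definition radius :: "nat \<Rightarrow> real" where
  "radius n = 1 - inverse (real (Suc n))"

lemma radius_unit: "0 \<le> radius n" "radius n < 1"
  by (auto simp: radius_def inverse_le_1_iff)

lemma filterlim_radius: "filterlim radius (at_left 1) sequentially"
proof (rule tendsto_imp_filterlim_at_left)
  have "(\<lambda>n. 1 - inverse (real (Suc n))) \<longlonglongrightarrow> 1 - 0"
    by (intro tendsto_intros LIMSEQ_inverse_real_of_nat)
  then show "radius \<longlonglongrightarrow> 1" by (simp add: radius_def[abs_def])
qed (simp add: radius_unit)

definition dilation :: "nat \<Rightarrow> complex ^ 'n \<Rightarrow> complex" where
  "dilation n \<zeta> = \<phi> (radius n *\<^sub>R \<zeta>)"

lemma dilation_continuous: "continuous_on B (dilation n)"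
  unfolding dilation_def
  by (rule continuous_on_compose2[OF phi_continuous])
    (use radius_unit scaleR_in_D B_subset in \<open>auto intro!: continuous_intros\<close>)

lemma dilation_le: "\<zeta> \<in> B \<Longrightarrow> cmod (dilation n \<zeta>) \<le> 1"
  using phi_disc[of "radius n *\<^sub>R \<zeta>"] radius_unit scaleR_in_D B_subset by (auto simp: dilation_def intro: less_imp_le)

text \<open>A total measurable version of the radial limit. The default \<open>1\<close> makes it
  unimodular everywhere, so that it maps into the circle and is bounded without exceptional
  sets.\<close>

definition boundary_value :: "complex ^ 'n \<Rightarrow> complex" where
  "boundary_value \<zeta> = (let l = lim (\<lambda>n. dilation n \<zeta>) in if cmod l = 1 then l else 1)"

lemma norm_boundary_value: "cmod (boundary_value \<zeta>) = 1"
  by (simp add: boundary_value_def Let_def)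

lemma boundary_value_borel_measurable: "boundary_value \<in> borel_measurable \<beta>"
proof -
  have "dilation n \<in> borel_measurable \<beta>" for n
    by (rule positive_radon_on_continuous_measurable[OF radon dilation_continuous])
  then have [measurable]: "(\<lambda>\<zeta>. lim (\<lambda>n. dilation n \<zeta>)) \<in> borel_measurable \<beta>"
    by (rule borel_measurable_lim_metric)
  show ?thesis unfolding boundary_value_def Let_def by measurable
qed

lemma boundary_value_measurable: "boundary_value \<in> \<beta> \<rightarrow>\<^sub>M haar_circle"
proof -
  have "boundary_value \<in> \<beta> \<rightarrow>\<^sub>M restrict_space borel (sphere 0 1)"
    by (rule measurable_restrict_space2[OF _ boundary_value_borel_measurable]) (simp add: norm_boundary_value)
  moreover have "sets haar_circle = sets (restrict_space borel (sphere 0 1))"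
    by (simp add: haar_circle_def)
  ultimately show ?thesis using measurable_cong_sets by blast
qed

end

locale inner_clark_family = clark_family D B \<beta> C \<phi> \<mu>
  for D B :: "(complex ^ 'n) set" and \<beta> C \<phi> \<mu> +
  assumes inner: "AE \<zeta> in \<beta>. \<exists>l\<in>sphere 0 1. radial_limit \<phi> \<zeta> = Some l"
begin

lemma AE_boundary_value: "AE \<zeta> in \<beta>. radial_limit \<phi> \<zeta> = Some (boundary_value \<zeta>) \<and> (\<lambda>n. dilation n \<zeta>) \<longlonglongrightarrow> boundary_value \<zeta>"
  using inner
proof eventually_elim
  case (elim \<zeta>)
  then obtain l where l: "cmod l = 1" "radial_limit \<phi> \<zeta> = Some l" by auto
  have "(\<lambda>n. dilation n \<zeta>) \<longlonglongrightarrow> l"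
    unfolding dilation_def using filterlim_compose[OF radial_limitD[OF l(2)] filterlim_radius] .
  moreover from limI[OF this] have "boundary_value \<zeta> = l" using l(1) by (simp add: boundary_value_def)
  ultimately show ?case using l by simp
qed

text \<open>Since \<open>\<bar>\<phi>\<^sub>1\<bar> = 1\<close>, the total defect \<open>\<integral>\<integral> (1 - Re (cnj \<alpha> * \<phi>\<^sub>1)) d\<mu>\<^sub>\<alpha> d\<alpha>\<close> equals
  \<open>1 - \<integral> \<bar>\<phi>\<^sub>1\<bar>\<^sup>2 d\<beta> = 0\<close>.\<close>

lemma AE_clark_boundary_value: "AE \<alpha> in haar_circle. AE \<zeta> in \<mu> \<alpha>. boundary_value \<zeta> = \<alpha>"
proof -
  define m where "m = 1 / (1 - cmod (\<phi> 0))\<^sup>2"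
  define L where "L = (\<lambda>n \<alpha>. \<integral>\<zeta>. dilation n \<zeta> \<partial>\<mu> \<alpha>)"
  \<comment> \<open>As a limit of the continuous functions \<open>L n\<close> this is measurable at
    once; for almost every \<open>\<alpha>\<close> it is the integral of the boundary value against
    \<open>\<mu> \<alpha>\<close>.\<close>
  define L' where "L' = (\<lambda>\<alpha>. lim (\<lambda>n. L n \<alpha>))"
  have circle: "cmod \<alpha> = 1" "\<alpha> \<in> sphere 0 1" if "\<alpha> \<in> space haar_circle" for \<alpha>
    using that by (auto simp: space_haar_circle)
  have int_boundary_value: "integrable (\<mu> \<alpha>) boundary_value" and meas_boundary_value: "boundary_value \<in> borel_measurable (\<mu> \<alpha>)"
    if "\<alpha> \<in> space haar_circle" for \<alpha>
  proof -
    interpret K: finite_measure "\<mu> \<alpha>" by (rule mix.finite_kernel[OF that])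
    show "boundary_value \<in> borel_measurable (\<mu> \<alpha>)" by (rule mix.measurable_kernel[OF that boundary_value_borel_measurable])
    then show "integrable (\<mu> \<alpha>) boundary_value" by (intro K.integrable_const_bound[where B=1]) (auto simp: norm_boundary_value)
  qed
  have contL: "continuous_on (sphere 0 1) (L n)" for n
    unfolding L_def by (rule clark_continuous[OF dilation_continuous])
  have measL: "L n \<in> borel_measurable haar_circle" for n
    by (rule positive_radon_on_continuous_measurable[OF positive_radon_on_haar_circle contL])
  then have measL': "L' \<in> borel_measurable haar_circle"
    unfolding L'_def by (rule borel_measurable_lim_metric)
  have leL: "cmod (L n \<alpha>) \<le> m" if \<alpha>: "\<alpha> \<in> space haar_circle" for n \<alpha>
  proof -
    interpret K: finite_measure "\<mu> \<alpha>" by (rule mix.finite_kernel[OF \<alpha>])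
    have "cmod (L n \<alpha>) \<le> (\<integral>\<zeta>. cmod (dilation n \<zeta>) \<partial>\<mu> \<alpha>)" unfolding L_def by (rule integral_norm_bound)
    also have "\<dots> \<le> (\<integral>\<zeta>. 1 \<partial>\<mu> \<alpha>)"
      using dilation_le mix.space_kernel[OF \<alpha>]
        positive_radon_on_integrable[OF mix.kernel[OF \<alpha>] compact_B dilation_continuous]
      by (intro integral_mono) auto
    also have "\<dots> \<le> m" using mix.mass[OF \<alpha>] mix.space_kernel[OF \<alpha>] by (simp add: m_def)
    finally show ?thesis .
  qed
  \<comment> \<open>A single \<open>\<mu> \<alpha>\<close> may charge a \<beta>-null set; the
    convergence passes to \<open>\<mu> \<alpha>\<close> for almost every
    \<open>\<alpha>\<close>.\<close>
  have "AE \<zeta> in \<beta>. (\<lambda>n. dilation n \<zeta>) \<longlonglongrightarrow> boundary_value \<zeta>" using AE_boundary_value by eventually_elim simp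
  from AE_space mix.AE_mixture[OF this]
  have conv: "AE \<alpha> in haar_circle. (\<lambda>n. L n \<alpha>) \<longlonglongrightarrow> L' \<alpha> \<and> L' \<alpha> = (\<integral>\<zeta>. boundary_value \<zeta> \<partial>\<mu> \<alpha>)"
  proof eventually_elim
    case (elim \<alpha>)
    interpret K: finite_measure "\<mu> \<alpha>" by (rule mix.finite_kernel[OF elim(1)])
    have "(\<lambda>n. L n \<alpha>) \<longlonglongrightarrow> (\<integral>\<zeta>. boundary_value \<zeta> \<partial>\<mu> \<alpha>)"
      unfolding L_def
    proof (rule integral_dominated_convergence[where w="\<lambda>_. 1"])
      show "dilation n \<in> borel_measurable (\<mu> \<alpha>)" for n
        by (rule positive_radon_on_continuous_measurable[OF mix.kernel[OF elim(1)] dilation_continuous])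
      show "AE \<zeta> in \<mu> \<alpha>. norm (dilation n \<zeta>) \<le> 1" for n
        using dilation_le mix.space_kernel[OF elim(1)] by (intro AE_I2) auto
    qed (use meas_boundary_value elim in auto)
    moreover from limI[OF this] have "L' \<alpha> = (\<integral>\<zeta>. boundary_value \<zeta> \<partial>\<mu> \<alpha>)" by (simp add: L'_def)
    ultimately show ?case by simp
  qed
  have dom: "(\<lambda>k. \<integral>\<zeta>. u k \<zeta> \<partial>\<beta>) \<longlonglongrightarrow> (\<integral>\<zeta>. v \<zeta> \<partial>\<beta>)"
    if "\<And>k. u k \<in> borel_measurable \<beta>" "v \<in> borel_measurable \<beta>"
      "AE \<zeta> in \<beta>. (\<lambda>k. u k \<zeta>) \<longlonglongrightarrow> v \<zeta>" "\<And>k \<zeta>. \<zeta> \<in> B \<Longrightarrow> cmod (u k \<zeta>) \<le> 1" for u v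
    by (rule integral_dominated_convergence[where w="\<lambda>_. 1"]) (use that in auto)
  have meas_dilation [measurable]: "dilation n \<in> borel_measurable \<beta>" for n
    by (rule positive_radon_on_continuous_measurable[OF radon dilation_continuous])
  note boundary_value_borel_measurable [measurable]
  \<comment> \<open>First of two limits: the test function must be continuous, so
    \<open>dilation n\<close> stays fixed while the conjugated dilates tend to the boundary value.
    Letting \<open>n\<close> grow afterwards yields the integral of the squared modulus of the
    boundary value, which is \<open>1\<close>.\<close>
  have c: "(\<integral>\<alpha>. cnj \<alpha> * L n \<alpha> \<partial>haar_circle) = (\<integral>\<zeta>. dilation n \<zeta> * cnj (boundary_value \<zeta>) \<partial>\<beta>)" for n
  proof -
    have "(\<lambda>k. \<integral>\<zeta>. dilation n \<zeta> * cnj (dilation k \<zeta>) \<partial>\<beta>) \<longlonglongrightarrow> (\<integral>\<alpha>. cnj \<alpha> * L n \<alpha> \<partial>haar_circle)"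
      unfolding L_def dilation_def[of _ "_ :: complex ^ 'n"]
      using filterlim_compose[OF clark_cnj_limit[OF dilation_continuous[of n]] filterlim_radius]
      by (simp add: dilation_def)
    moreover have "(\<lambda>k. \<integral>\<zeta>. dilation n \<zeta> * cnj (dilation k \<zeta>) \<partial>\<beta>) \<longlonglongrightarrow> (\<integral>\<zeta>. dilation n \<zeta> * cnj (boundary_value \<zeta>) \<partial>\<beta>)"
    proof (rule dom)
      show "AE \<zeta> in \<beta>. (\<lambda>k. dilation n \<zeta> * cnj (dilation k \<zeta>)) \<longlonglongrightarrow> dilation n \<zeta> * cnj (boundary_value \<zeta>)"
        using AE_boundary_value by eventually_elim (auto intro!: tendsto_intros)
      show "cmod (dilation n \<zeta> * cnj (dilation k \<zeta>)) \<le> 1" if "\<zeta> \<in> B" for k \<zeta>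
        using dilation_le[OF that] by (simp add: norm_mult mult_le_one)
    qed measurable
    ultimately show ?thesis by (rule LIMSEQ_unique)
  qed
  have "(\<lambda>n. \<integral>\<zeta>. dilation n \<zeta> * cnj (boundary_value \<zeta>) \<partial>\<beta>) \<longlonglongrightarrow> (\<integral>\<zeta>. boundary_value \<zeta> * cnj (boundary_value \<zeta>) \<partial>\<beta>)"
  proof (rule dom)
    show "AE \<zeta> in \<beta>. (\<lambda>n. dilation n \<zeta> * cnj (boundary_value \<zeta>)) \<longlonglongrightarrow> boundary_value \<zeta> * cnj (boundary_value \<zeta>)"
      using AE_boundary_value by eventually_elim (auto intro!: tendsto_intros)
    show "cmod (dilation n \<zeta> * cnj (boundary_value \<zeta>)) \<le> 1" if "\<zeta> \<in> B" for n \<zeta>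
      using dilation_le[OF that] by (simp add: norm_mult norm_boundary_value)
  qed measurable
  also have "(\<integral>\<zeta>. boundary_value \<zeta> * cnj (boundary_value \<zeta>) \<partial>\<beta>) = 1"
    using prob_space by (simp add: norm_boundary_value flip: complex_norm_square)
  finally have c1: "(\<lambda>n. \<integral>\<alpha>. cnj \<alpha> * L n \<alpha> \<partial>haar_circle) \<longlonglongrightarrow> 1" unfolding c .
  have meas_id: "(\<lambda>\<alpha>. cnj \<alpha>) \<in> borel_measurable haar_circle"
    by (rule positive_radon_on_continuous_measurable[OF positive_radon_on_haar_circle
          continuous_on_cnj[OF continuous_on_id]])
  note [measurable] = measL measL' meas_id
  have convc: "AE \<alpha> in haar_circle. (\<lambda>n. cnj \<alpha> * L n \<alpha>) \<longlonglongrightarrow> cnj \<alpha> * L' \<alpha>"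
    using conv by eventually_elim (auto intro!: tendsto_intros)
  have boundc: "AE \<alpha> in haar_circle. norm (cnj \<alpha> * L n \<alpha>) \<le> m" for n
    using leL circle by (intro AE_I2) (simp add: norm_mult)
  have "(\<lambda>n. \<integral>\<alpha>. cnj \<alpha> * L n \<alpha> \<partial>haar_circle) \<longlonglongrightarrow> (\<integral>\<alpha>. cnj \<alpha> * L' \<alpha> \<partial>haar_circle)"
    by (rule integral_dominated_convergence[OF _ _ _ convc boundc]) auto
  then have one: "(\<integral>\<alpha>. cnj \<alpha> * L' \<alpha> \<partial>haar_circle) = 1"
    using c1 LIMSEQ_unique by blast
  have intL': "integrable haar_circle (\<lambda>\<alpha>. cnj \<alpha> * L' \<alpha>)"
    by (rule integrable_dominated_convergence[OF _ _ _ convc boundc]) auto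
  have mass: "(\<lambda>\<alpha>. measure (\<mu> \<alpha>) B) \<in> borel_measurable haar_circle"
    "(\<integral>\<alpha>. measure (\<mu> \<alpha>) B \<partial>haar_circle) = 1"
    using mix.closed_mixture[OF compact_imp_closed[OF compact_B]] prob_space by simp_all
  have int_mass: "integrable haar_circle (\<lambda>\<alpha>. measure (\<mu> \<alpha>) B)"
    using mix.mass by (intro mix.integrable_const_bound[where B=m] mass(1)) (auto simp: m_def)
  \<comment> \<open>The defect for a single \<open>\<alpha>\<close>. It is nonnegative almost
    everywhere and integrates to \<open>1 - 1\<close>, so it vanishes for almost every
    \<open>\<alpha>\<close>; then its nonnegative integrand vanishes almost everywhere for
    \<open>\<mu> \<alpha>\<close>.\<close>
  define q where "q = (\<lambda>\<alpha>. measure (\<mu> \<alpha>) B - Re (cnj \<alpha> * L' \<alpha>))"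
  have intRe: "integrable haar_circle (\<lambda>\<alpha>. Re (cnj \<alpha> * L' \<alpha>))" by (rule integrable_Re[OF intL'])
  have defect: "q \<alpha> = (\<integral>\<zeta>. 1 - Re (cnj \<alpha> * boundary_value \<zeta>) \<partial>\<mu> \<alpha>)"
    if \<alpha>: "\<alpha> \<in> space haar_circle" and L': "L' \<alpha> = (\<integral>\<zeta>. boundary_value \<zeta> \<partial>\<mu> \<alpha>)" for \<alpha>
  proof -
    interpret K: finite_measure "\<mu> \<alpha>" by (rule mix.finite_kernel[OF \<alpha>])
    have int: "integrable (\<mu> \<alpha>) (\<lambda>\<zeta>. cnj \<alpha> * boundary_value \<zeta>)" using int_boundary_value[OF \<alpha>] by simp
    have "(\<integral>\<zeta>. 1 - Re (cnj \<alpha> * boundary_value \<zeta>) \<partial>\<mu> \<alpha>) = (\<integral>\<zeta>. 1 \<partial>\<mu> \<alpha>) - (\<integral>\<zeta>. Re (cnj \<alpha> * boundary_value \<zeta>) \<partial>\<mu> \<alpha>)"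
      by (rule Bochner_Integration.integral_diff[OF _ integrable_Re[OF int]]) simp
    also have "(\<integral>\<zeta>. Re (cnj \<alpha> * boundary_value \<zeta>) \<partial>\<mu> \<alpha>) = Re (cnj \<alpha> * L' \<alpha>)"
      unfolding L' integral_Re[OF int] integral_mult_right_zero ..
    finally show ?thesis using mix.space_kernel[OF \<alpha>] by (simp add: q_def)
  qed
  have nonneg: "0 \<le> 1 - Re (cnj \<alpha> * boundary_value \<zeta>)" if "cmod \<alpha> = 1" for \<alpha> \<zeta>
    using complex_Re_le_cmod[of "cnj \<alpha> * boundary_value \<zeta>"] that by (simp add: norm_mult norm_boundary_value del: times_complex.sel)
  have "AE \<alpha> in haar_circle. 0 \<le> q \<alpha>"
    using AE_space conv
  proof eventually_elim
    case (elim \<alpha>)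
    then show ?case using defect nonneg circle by (simp del: times_complex.sel)
  qed
  moreover have "integrable haar_circle q" unfolding q_def using int_mass intRe by (rule Bochner_Integration.integrable_diff)
  moreover have "(\<integral>\<alpha>. q \<alpha> \<partial>haar_circle) = 0"
    unfolding q_def Bochner_Integration.integral_diff[OF int_mass intRe] integral_Re[OF intL'] one mass(2) by simp
  ultimately have "AE \<alpha> in haar_circle. q \<alpha> = 0"
    by (simp add: integral_nonneg_eq_0_iff_AE)
  with AE_space conv show ?thesis
  proof eventually_elim
    case (elim \<alpha>)
    then have \<alpha>: "\<alpha> \<in> space haar_circle" by simp
    interpret K: finite_measure "\<mu> \<alpha>" by (rule mix.finite_kernel[OF \<alpha>])
    have int: "integrable (\<mu> \<alpha>) (\<lambda>\<zeta>. 1 - Re (cnj \<alpha> * boundary_value \<zeta>))"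
      by (rule Bochner_Integration.integrable_diff[OF _ integrable_Re]) (use int_boundary_value[OF \<alpha>] in simp_all)
    have "(\<integral>\<zeta>. 1 - Re (cnj \<alpha> * boundary_value \<zeta>) \<partial>\<mu> \<alpha>) = 0" using defect[OF \<alpha>] elim by simp
    then have "AE \<zeta> in \<mu> \<alpha>. 1 - Re (cnj \<alpha> * boundary_value \<zeta>) = 0"
      using integral_nonneg_eq_0_iff_AE[OF int] nonneg[OF circle(1)[OF \<alpha>]] by simp
    then show ?case
    proof eventually_elim
      case (elim \<zeta>)
      then show ?case using circle(1)[OF \<alpha>] norm_boundary_value by (intro unit_eq_of_Re_cnj_mult) auto
    qed
  qed
qed

text \<open>For almost every \<open>\<alpha>\<close>, both \<open>\<alpha> \<notin> A\<close> and
  the boundary value is \<open>\<alpha>\<close> almost everywhere for \<open>\<mu> \<alpha>\<close>.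
  So the preimage of \<open>A\<close> is null for \<open>\<mu> \<alpha>\<close>, and averaging makes
  it null for \<beta>.\<close>

lemma boundary_value_null_sets:
  assumes A: "A \<in> null_sets haar_circle"
  shows "boundary_value -` A \<inter> B \<in> null_sets \<beta>"
proof -
  have sets: "boundary_value -` A \<inter> B \<in> sets \<beta>"
    using measurable_sets[OF boundary_value_measurable, of A] A by auto
  have "AE \<alpha> in haar_circle. emeasure (\<mu> \<alpha>) (boundary_value -` A \<inter> B) = 0"
    using AE_space AE_clark_boundary_value AE_not_in[OF A]
  proof eventually_elim
    case (elim \<alpha>)
    from elim(2) have "AE \<zeta> in \<mu> \<alpha>. \<zeta> \<notin> boundary_value -` A \<inter> B"
      by eventually_elim (use elim(3) in auto)
    then have "boundary_value -` A \<inter> B \<in> null_sets (\<mu> \<alpha>)"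
      using sets mix.sets_kernel[OF elim(1)] by (subst AE_iff_null_sets) auto
    then show ?case by auto
  qed
  then have "(\<integral>\<^sup>+\<alpha>. emeasure (\<mu> \<alpha>) (boundary_value -` A \<inter> B) \<partial>haar_circle) = 0"
    using nn_integral_0_iff_AE[OF mix.emeasure_mixture(1)[OF sets]] by simp
  then show ?thesis using mix.emeasure_mixture(2)[OF sets] sets by (intro null_setsI) auto
qed

lemma radial_pseudo_image: "pseudo_image_measure \<beta> (radial_limit \<phi>) haar_circle"
  unfolding pseudo_image_measure_def
proof (intro conjI allI impI)
  have AE: "AE \<zeta> in \<beta>. radial_limit \<phi> \<zeta> = Some (boundary_value \<zeta>)" using AE_boundary_value by eventually_elim simp
  then show "\<exists>g. ae_version \<beta> haar_circle (radial_limit \<phi>) g"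
    using boundary_value_measurable by (auto simp: ae_version_def)
  \<comment> \<open>\<open>N\<close> need not be Borel, so both directions work with Borel null sets
    covering the sets in question. \<open>Z\<close> covers the points where the radial limit is
    missing or differs from its version.\<close>
  obtain Z where Z: "Z \<in> null_sets \<beta>" "{\<zeta> \<in> space \<beta>. radial_limit \<phi> \<zeta> \<noteq> Some (boundary_value \<zeta>)} \<subseteq> Z"
    using AE by (auto simp: eventually_ae_filter)
  fix N assume N: "N \<subseteq> space haar_circle"
  let ?E = "{x \<in> space \<beta>. \<exists>y\<in>N. radial_limit \<phi> x = Some y}"
  show "N \<in> null_sets (completion haar_circle) \<longleftrightarrow> ?E \<in> null_sets (completion \<beta>)"
  proof
    assume "N \<in> null_sets (completion haar_circle)"
    then obtain A where A: "A \<in> null_sets haar_circle" "N \<subseteq> A" by (auto simp: null_sets_completion_iff2)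
    have "?E \<subseteq> (boundary_value -` A \<inter> B) \<union> Z"
    proof
      fix \<zeta> assume \<zeta>: "\<zeta> \<in> ?E"
      show "\<zeta> \<in> (boundary_value -` A \<inter> B) \<union> Z"
      proof (cases "\<zeta> \<in> Z")
        case False
        then have "radial_limit \<phi> \<zeta> = Some (boundary_value \<zeta>)" using \<zeta> Z(2) by blast
        then show ?thesis using \<zeta> A(2) by auto
      qed simp
    qed
    moreover have "(boundary_value -` A \<inter> B) \<union> Z \<in> null_sets \<beta>"
      using boundary_value_null_sets[OF A(1)] Z(1) by (rule null_sets.Un)
    ultimately show "?E \<in> null_sets (completion \<beta>)" unfolding null_sets_completion_iff2 by blast
  next
    assume "?E \<in> null_sets (completion \<beta>)"
    then obtain A where A: "A \<in> null_sets \<beta>" "?E \<subseteq> A" by (auto simp: null_sets_completion_iff2)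
    have "AE \<zeta> in \<beta>. \<zeta> \<notin> A \<and> \<zeta> \<notin> Z" using AE_not_in[OF A(1)] AE_not_in[OF Z(1)] by eventually_elim simp
    from AE_space mix.AE_mixture[OF this] AE_clark_boundary_value
    have "AE \<alpha> in haar_circle. \<alpha> \<notin> N"
    proof eventually_elim
      case (elim \<alpha>)
      have \<alpha>: "\<alpha> \<in> sphere 0 1" using elim(1) by (simp only: space_haar_circle)
      show "\<alpha> \<notin> N"
      proof
        assume N: "\<alpha> \<in> N"
        \<comment> \<open>With \<open>\<alpha>\<close> in \<open>N\<close>, almost every point for
          \<open>\<mu> \<alpha>\<close> would have radial limit \<open>\<alpha>\<close> and hence
          lie in the excluded set \<open>A\<close>. So \<open>\<mu> \<alpha>\<close> would vanish,
          against its positive mass.\<close>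
        from AE_space elim(2,3) have "AE \<zeta> in \<mu> \<alpha>. False"
        proof eventually_elim
          case (elim \<zeta>)
          then have "\<zeta> \<in> space \<beta>" using mix.space_kernel[OF \<open>\<alpha> \<in> space haar_circle\<close>] by simp
          then show ?case using elim Z(2) A(2) N by auto
        qed
        then have "emeasure (\<mu> \<alpha>) (space (\<mu> \<alpha>)) = 0"
          using emeasure_eq_0_AE[of "\<lambda>_. True" "\<mu> \<alpha>"] by simp
        then have "measure (\<mu> \<alpha>) B = 0" using mix.space_kernel[OF elim(1)] by (simp add: measure_def)
        then show False using clark_mass[OF \<alpha>] clark_density_pos[OF \<alpha> zero_in_D] by simp
      qed
    qed
    then obtain A' where "A' \<in> null_sets haar_circle" "{\<alpha> \<in> space haar_circle. \<not> \<alpha> \<notin> N} \<subseteq> A'"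
      unfolding eventually_ae_filter by blast
    then show "N \<in> null_sets (completion haar_circle)"
      unfolding null_sets_completion_iff2 using N by blast
  qed
qed

lemma radial_disintegration: "disintegration \<beta> (radial_limit \<phi>) haar_circle \<mu>"
  unfolding disintegration_def
proof (intro conjI allI impI ballI)
  show "weak_pseudo_image_measure \<beta> (radial_limit \<phi>) haar_circle"
    using radial_pseudo_image unfolding pseudo_image_measure_def weak_pseudo_image_measure_def by blast
  show "sets (\<mu> y) = sets \<beta>" "finite_measure (\<mu> y)" if "y \<in> space haar_circle" for y
    using mix.sets_kernel[OF that] mix.finite_kernel[OF that] .
  have "AE \<zeta> in \<beta>. radial_limit \<phi> \<zeta> = Some (boundary_value \<zeta>)" using AE_boundary_value by eventually_elim simp
  from mix.AE_mixture[OF this] AE_clark_boundary_value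
  show "AE y in haar_circle. AE x in \<mu> y. radial_limit \<phi> x = Some y"
  proof eventually_elim
    case (elim \<alpha>)
    then show ?case by eventually_elim simp
  qed
qed (fact mix.integral_completion_mixture)+

text \<open>With \<open>\<phi> 0 = 0\<close> every Clark measure is a probability, and almost every
  one is concentrated where the boundary value is its parameter. It therefore gives the preimage of
  \<open>A\<close> the mass \<open>indicator A \<alpha>\<close>, which is then averaged.\<close>

lemma radial_image_measure:
  assumes "\<phi> 0 = 0"
  shows "has_image_measure \<beta> (radial_limit \<phi>) haar_circle"
  unfolding has_image_measure_def
proof (intro exI conjI)
  show "ae_version \<beta> haar_circle (radial_limit \<phi>) boundary_value"
    unfolding ae_version_def using boundary_value_measurable AE_boundary_value by auto
  show "distr \<beta> haar_circle boundary_value = haar_circle"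
  proof (rule measure_eqI)
    fix A assume "A \<in> sets (distr \<beta> haar_circle boundary_value)"
    then have A: "A \<in> sets haar_circle" by simp
    have sets: "boundary_value -` A \<inter> B \<in> sets \<beta>" using measurable_sets[OF boundary_value_measurable A] by simp
    have "emeasure (distr \<beta> haar_circle boundary_value) A = emeasure \<beta> (boundary_value -` A \<inter> B)"
      using emeasure_distr[OF boundary_value_measurable A] by simp
    also have "\<dots> = (\<integral>\<^sup>+\<alpha>. emeasure (\<mu> \<alpha>) (boundary_value -` A \<inter> B) \<partial>haar_circle)"
      by (rule mix.emeasure_mixture(2)[OF sets, symmetric])
    also have "\<dots> = (\<integral>\<^sup>+\<alpha>. indicator A \<alpha> \<partial>haar_circle)"
    proof (rule nn_integral_cong_AE)
      show "AE \<alpha> in haar_circle. emeasure (\<mu> \<alpha>) (boundary_value -` A \<inter> B) = indicator A \<alpha>"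
        using AE_space AE_clark_boundary_value
      proof eventually_elim
        case (elim \<alpha>)
        interpret K: finite_measure "\<mu> \<alpha>" by (rule mix.finite_kernel[OF elim(1)])
        have \<alpha>: "\<alpha> \<in> sphere 0 1" using elim(1) by (simp only: space_haar_circle)
        have one: "emeasure (\<mu> \<alpha>) B = 1"
          using clark_mass[OF \<alpha>] \<alpha> by (auto simp add: K.emeasure_eq_measure clark_density_def assms dist_norm)
        have "AE \<zeta> in \<mu> \<alpha>. \<zeta> \<in> boundary_value -` A \<inter> B \<longleftrightarrow> \<zeta> \<in> (if \<alpha> \<in> A then B else {})"
          using AE_space elim(2) by eventually_elim (use mix.space_kernel[OF elim(1)] in auto)
        then have "emeasure (\<mu> \<alpha>) (boundary_value -` A \<inter> B) = emeasure (\<mu> \<alpha>) (if \<alpha> \<in> A then B else {})"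
          using sets mix.sets_kernel[OF elim(1)] sets.top[of \<beta>] by (intro emeasure_eq_AE) auto
        then show ?case using one by simp
      qed
    qed
    also have "\<dots> = emeasure haar_circle A" using A by simp
    finally show "emeasure (distr \<beta> haar_circle boundary_value) A = emeasure haar_circle A" .
  qed simp
qed

end

theorem theorem4p9:
  fixes D B :: "(complex ^ 'n) set"
    and \<beta> :: "(complex ^ 'n) measure"
    and C :: "complex ^ 'n \<Rightarrow> complex ^ 'n \<Rightarrow> complex"
    and \<phi> :: "complex ^ 'n \<Rightarrow> complex"
    and \<mu> :: "complex \<Rightarrow> (complex ^ 'n) measure"
  assumes "normalized_domain D B"
    and "invariant_probability D B \<beta>"
    and "is_szego_kernel D \<beta> C"
    and "\<phi> cn_holomorphic_on D" and "\<phi> ` D \<subseteq> ball 0 1"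
    and "\<And>\<alpha>. \<alpha> \<in> sphere 0 1 \<Longrightarrow> is_clark_measure D B C \<phi> \<alpha> (\<mu> \<alpha>)"
  shows "vaguely_continuous_on B (sphere 0 1) \<mu> \<and>
    has_vague_integral B haar_circle \<mu> \<beta> \<and>
    (inner_function D \<beta> \<phi> \<longrightarrow>
       pseudo_image_measure \<beta> (radial_limit \<phi>) haar_circle \<and>
       disintegration \<beta> (radial_limit \<phi>) haar_circle \<mu>) \<and>
    (inner_function D \<beta> \<phi> \<and> \<phi> 0 = 0 \<longrightarrow>
       has_image_measure \<beta> (radial_limit \<phi>) haar_circle)"
proof -
  interpret clark_family D B \<beta> C \<phi> \<mu>
    by unfold_locales
      (use assms in \<open>auto intro: cn_holomorphic_on_imp_continuous_on simp: subset_iff\<close>)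
  have inner: "inner_clark_family D B \<beta> C \<phi> \<mu>" if "inner_function D \<beta> \<phi>"
    by unfold_locales (use that in \<open>auto simp: inner_function_def\<close>)
  show ?thesis
    unfolding vaguely_continuous_on_def has_vague_integral_def
    using clark_continuous clark_vague_integral haar_circle_integrable[OF clark_continuous]
      inner_clark_family.radial_pseudo_image[OF inner] inner_clark_family.radial_disintegration[OF inner]
      inner_clark_family.radial_image_measure[OF inner]
    by blast
qed

end
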